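(* Let data $(\xi,f,g,A,L,U,l,u,\alpha,\delta)$ be given as in the context, and let $l^{*,\delta}$ and $(-u)^{*,\alpha}$ be the processes defined in the context. Then $(Y,Z,K^+,K^-)$ is a solution of the doubly reflected BSDE with irregular barriers associated with these data (defined in the context) if and only if $(Y,Z,K^+,K^-)$ satisfies (i) $Y_t=\xi+\int_t^T\big[f(s,Y_s,Z_s)ds+g(s,Y_{s-},Y_s)dA_s+dK^+_s-dK^-_s-Z_sdB_s\big]$, $t\le T$; (ii) for all $t\in\,]0,T]$, $L_{t-}\vee l^{*,\delta}(t)\le Y_{t-}\le \big(-(-u)^{*,\alpha}(t)\big)\wedge U_{t-}$; (iii) $\int_0^T\big(Y_{t-}-[L_{t-}\vee l^{*,\delta}(t)]\big)dK^+_t=\int_0^T\big([U_{t-}\wedge(-(-u)^{*,\alpha}(t))]-Y_{t-}\big)dK^-_t=0$ a.s.; (iv) $Y\in\mathcal{D}$, $K^+,K^-\in\mathcal{K}$, $Z\in\mathcal{L}^{2,d}$; (v) $dK^+\perp dK^-$.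
   Context: Setting. $T>0$; $(B_t)_{t\le T}$ is a $d$-dimensional Brownian motion on a probability space $(\Omega,\mathcal{F},P)$ and $(\mathcal{F}_t)_{t\le T}$ is the standard augmentation of its natural filtration. $\mathcal{P}$ is the $\sigma$-algebra of predictable subsets of $[0,T]\times\Omega$. $\mathcal{D}$ is the set of real-valued $\mathcal{P}$-measurable rcll processes $(Y_t)_{t\le T}$; $Y_{t-}=\lim_{s\nearrow t}Y_s$, $Y_{0-}=Y_0$. $\mathcal{K}=\{K\in\mathcal{D}: K \text{ nondecreasing},\,K_0=0\}$. $\mathcal{L}^{2,d}$ is the set of $\mathbb{R}^d$-valued $\mathcal{P}$-measurable processes $Z$ with $\int_0^T|Z_s|^2ds<\infty$ $P$-a.s. Integrals $\int_a^b dV_s$ are over $]a,b]$. $a\vee b\wedge c$ means $(a\vee b)\wedge c$; $a^+=a\vee0$, $a^-=(-a)\vee0$. For $K^1,K^2\in\mathcal{K}$, $dK^1\perp dK^2$ means there is $D\in\mathcal{P}$ with $E\int_0^T1_D\,dK^1_s=E\int_0^T1_{D^c}\,dK^2_s=0$. Data. $\xi$ is a real $\mathcal{F}_T$-measurable random variable; $L,U\in\mathcal{D}$; $l,u$ are real-valued $\mathcal{P}$-measurable processes; $\alpha,\delta,A\in\mathcal{K}$; $f:[0,T]\times\Omega\times\mathbb{R}\times\mathbb{R}^d\to\mathbb{R}$ is such that $(t,\omega)\mapsto f(t,\omega,L_t\vee y\wedge U_t,z)$ is $\mathcal{P}$-measurable for every $(y,z)$; $g:[0,T]\times\Omega\times\mathbb{R}\times\mathbb{R}\to\mathbb{R}$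 is such that $(t,\omega)\mapsto g(t,\omega,L_{t-}\vee x\wedge U_{t-},L_t\vee y\wedge U_t)$ is $\mathcal{P}$-measurable for every $(x,y)$. $Dom$ is the set of $Y\in\mathcal{D}$ such that $$E\int_0^T(L_{t-}-Y_{t-})^+dt+(l_t-Y_{t-})^+d\delta_t+(U_{t-}-Y_{t-})^-dt+(u_t-Y_{t-})^-d\alpha_t=0.$$ Doubly reflected BSDE with irregular barriers. A solution is a quadruple $(Y,Z,K^+,K^-)$ such that: $Y\in Dom$, $Z\in\mathcal{L}^{2,d}$, $K^+,K^-\in\mathcal{K}$, $dK^+\perp dK^-$; $Y_t=\xi+\int_t^T\big[f(s,Y_s,Z_s)ds+g(s,Y_{s-},Y_s)dA_s+dK^+_s-dK^-_s-Z_sdB_s\big]$ for $t\le T$; and for all $L^*\in Dom$, $E\int_0^T(Y_{t-}-L^*_{t-})^+dK^+_t+(Y_{t-}-L^*_{t-})^-dK^-_t=0$. The processes $l^{*,\delta}$ and $(-u)^{*,\alpha}$ (with values in $[-\infty,+\infty]$) are defined pathwise by $$l^{*,\delta}(t)=\inf_{n\in\mathbb{N}}\Big\{-nt+\inf\Big\{a\in\mathbb{R}:\int_0^t[l_s+ns-a]^+d\delta_s=0\Big\}\Big\},$$ $$(-u)^{*,\alpha}(t)=\inf_{n\in\mathbb{N}}\Big\{-nt+\inf\Big\{a\in\mathbb{R}:\int_0^t[-u_s+ns-a]^+d\alpha_s=0\Big\}\Big\}.$$ *)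

theory Defs
  imports "HOL-Probability.Probability"
begin

text \<open>
  Processes are functions of type \<open>real \<Rightarrow> 'a \<Rightarrow> _\<close>; all notions below depend only on their
  restriction to times in \<open>{0..T}\<close> and to sample points in \<open>space M\<close>.
  Expectations of nonnegative quantities are \<open>nn_integral\<close>s over \<open>M\<close>.  The probability space is not
  assumed complete, but \<open>nn_integral\<close> and \<open>AE\<close> are the same for \<open>M\<close> and for \<open>completion M\<close>, so
  quantities that are only measurable for the augmented filtration are integrated correctly.
\<close>

section \<open>Brownian motion, its augmented filtration, predictable processes\<close>

definition brownian_motion :: "'a measure \<Rightarrow> real \<Rightarrow> (real \<Rightarrow> 'a \<Rightarrow> real ^ 'd) \<Rightarrow> bool" where
  "brownian_motion M T B \<longleftrightarrow>
     (\<forall>t\<in>{0..T}. B t \<in> borel_measurable M) \<and>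
     (AE \<omega> in M. B 0 \<omega> = 0) \<and>
     (AE \<omega> in M. continuous_on {0..T} (\<lambda>t. B t \<omega>)) \<and>
     (\<forall>s t. 0 \<le> s \<and> s < t \<and> t \<le> T \<longrightarrow>
        distributed M lborel (\<lambda>\<omega>. B t \<omega> - B s \<omega>)
          (\<lambda>x. ennreal (\<Prod>i\<in>UNIV. normal_density 0 (sqrt (t - s)) (x $ i)))) \<and>
     (\<forall>(n::nat) \<tau>. mono_on {..n} \<tau> \<and> \<tau> ` {..n} \<subseteq> {0..T} \<longrightarrow>
        prob_space.indep_vars M (\<lambda>_. borel) (\<lambda>i \<omega>. B (\<tau> (Suc i)) \<omega> - B (\<tau> i) \<omega>) {..<n})"

text \<open>Only the \<open>\<sigma>\<close>-algebra of \<open>aug_filtration M B t\<close> is meaningful, not its measure.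
  The null sets of \<open>completion M\<close> are exactly the subsets of the null sets of \<open>M\<close>.\<close>

definition aug_filtration :: "'a measure \<Rightarrow> (real \<Rightarrow> 'a \<Rightarrow> real ^ 'd) \<Rightarrow> real \<Rightarrow> 'a measure" where
  "aug_filtration M B t = sigma (space M)
     ({B s -` S \<inter> space M | s S. s \<in> {0..t} \<and> S \<in> sets borel} \<union> null_sets (completion M))"

definition predictable :: "'a measure \<Rightarrow> real \<Rightarrow> (real \<Rightarrow> 'a \<Rightarrow> real ^ 'd) \<Rightarrow> (real \<times> 'a) measure" where
  "predictable M T B = sigma ({0..T} \<times> space M)
     ({{0} \<times> S | S. S \<in> sets (aug_filtration M B 0)} \<union>
      {{s<..t} \<times> S | s t S. 0 \<le> s \<and> s < t \<and> t \<le> T \<and> S \<in> sets (aug_filtration M B s)})"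

definition predictable_process ::
  "'a measure \<Rightarrow> real \<Rightarrow> (real \<Rightarrow> 'a \<Rightarrow> real ^ 'd) \<Rightarrow> (real \<Rightarrow> 'a \<Rightarrow> 'b::topological_space) \<Rightarrow> bool" where
  "predictable_process M T B X \<longleftrightarrow> (\<lambda>(t, \<omega>). X t \<omega>) \<in> borel_measurable (predictable M T B)"

definition rcll_on :: "real \<Rightarrow> (real \<Rightarrow> real) \<Rightarrow> bool" where
  "rcll_on T x \<longleftrightarrow> (\<forall>t\<in>{0..<T}. (x \<longlongrightarrow> x t) (at_right t)) \<and> (\<forall>t\<in>{0<..T}. \<exists>l. (x \<longlongrightarrow> l) (at_left t))"

definition left_lim :: "(real \<Rightarrow> 'a \<Rightarrow> real) \<Rightarrow> real \<Rightarrow> 'a \<Rightarrow> real" where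
  "left_lim X t \<omega> = (if t = 0 then X 0 \<omega> else Lim (at_left t) (\<lambda>s. X s \<omega>))"

definition rcll_processes :: "'a measure \<Rightarrow> real \<Rightarrow> (real \<Rightarrow> 'a \<Rightarrow> real ^ 'd) \<Rightarrow> (real \<Rightarrow> 'a \<Rightarrow> real) set" where
  "rcll_processes M T B =
     {Y. predictable_process M T B Y \<and> (\<forall>\<omega>\<in>space M. rcll_on T (\<lambda>t. Y t \<omega>))}"

definition increasing_processes :: "'a measure \<Rightarrow> real \<Rightarrow> (real \<Rightarrow> 'a \<Rightarrow> real ^ 'd) \<Rightarrow> (real \<Rightarrow> 'a \<Rightarrow> real) set" where
  "increasing_processes M T B =
     {K \<in> rcll_processes M T B. \<forall>\<omega>\<in>space M. mono_on {0..T} (\<lambda>t. K t \<omega>) \<and> K 0 \<omega> = 0}"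

definition L2_processes :: "'a measure \<Rightarrow> real \<Rightarrow> (real \<Rightarrow> 'a \<Rightarrow> real ^ 'd) \<Rightarrow> (real \<Rightarrow> 'a \<Rightarrow> real ^ 'd) set" where
  "L2_processes M T B =
     {Z. predictable_process M T B Z \<and>
         (AE \<omega> in M. (\<integral>\<^sup>+s\<in>{0..T}. ennreal ((norm (Z s \<omega>))\<^sup>2) \<partial>lborel) < \<infinity>)}"

section \<open>Pathwise Stieltjes measures\<close>

text \<open>The measure \<open>dK\<^sub>t(\<omega>)\<close> on \<open>]0,T]\<close>: the path is extended to the real line by constants, so that
  no mass is put outside \<open>]0,T]\<close> (in particular none at \<open>0\<close>).\<close>

definition stieltjes :: "real \<Rightarrow> (real \<Rightarrow> 'a \<Rightarrow> real) \<Rightarrow> 'a \<Rightarrow> real measure" where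
  "stieltjes T K \<omega> = interval_measure (\<lambda>t. K (max 0 (min T t)) \<omega>)"

definition mutually_singular ::
  "'a measure \<Rightarrow> real \<Rightarrow> (real \<Rightarrow> 'a \<Rightarrow> real ^ 'd) \<Rightarrow> (real \<Rightarrow> 'a \<Rightarrow> real) \<Rightarrow> (real \<Rightarrow> 'a \<Rightarrow> real) \<Rightarrow> bool" where
  "mutually_singular M T B K1 K2 \<longleftrightarrow> (\<exists>D \<in> sets (predictable M T B).
     (\<integral>\<^sup>+\<omega>. (\<integral>\<^sup>+s\<in>{0<..T}. indicator D (s, \<omega>) \<partial>stieltjes T K1 \<omega>) \<partial>M) = 0 \<and>
     (\<integral>\<^sup>+\<omega>. (\<integral>\<^sup>+s\<in>{0<..T}. indicator (- D) (s, \<omega>) \<partial>stieltjes T K2 \<omega>) \<partial>M) = 0)"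

text \<open>Lebesgue integral of an extended-real function as the difference of the integrals of its
  positive and negative parts (\<open>e2ennreal\<close> sends negative values to \<open>0\<close>).  The undefined case
  \<open>\<infinity> - \<infinity>\<close> evaluates to \<open>\<infinity>\<close>, hence is never \<open>0\<close>.\<close>

definition ereal_integral :: "'b measure \<Rightarrow> 'b set \<Rightarrow> ('b \<Rightarrow> ereal) \<Rightarrow> ereal" where
  "ereal_integral N S h =
     enn2ereal (\<integral>\<^sup>+x\<in>S. e2ennreal (h x) \<partial>N) - enn2ereal (\<integral>\<^sup>+x\<in>S. e2ennreal (- h x) \<partial>N)"

section \<open>The Ito integral\<close>

text \<open>A step integrand is
  \<open>\<Sum>i<n. \<phi> i 1\<^bsub>]\<tau> i, \<tau> (i+1)]\<^esub>\<close> with deterministic times and bounded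
  \<open>\<phi> i\<close> measurable at time \<open>\<tau> i\<close>.\<close>

definition step_integrand ::
  "'a measure \<Rightarrow> real \<Rightarrow> (real \<Rightarrow> 'a \<Rightarrow> real ^ 'd) \<Rightarrow> nat \<Rightarrow> (nat \<Rightarrow> real) \<Rightarrow> (nat \<Rightarrow> 'a \<Rightarrow> real ^ 'd) \<Rightarrow> bool" where
  "step_integrand M T B n \<tau> \<phi> \<longleftrightarrow>
     mono_on {..n} \<tau> \<and> \<tau> ` {..n} \<subseteq> {0..T} \<and>
     (\<forall>i<n. \<phi> i \<in> borel_measurable (aug_filtration M B (\<tau> i)) \<and>
            (\<exists>C. \<forall>\<omega>\<in>space M. norm (\<phi> i \<omega>) \<le> C))"

definition step_process :: "nat \<Rightarrow> (nat \<Rightarrow> real) \<Rightarrow> (nat \<Rightarrow> 'a \<Rightarrow> real ^ 'd) \<Rightarrow> real \<Rightarrow> 'a \<Rightarrow> real ^ 'd" where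
  "step_process n \<tau> \<phi> t \<omega> = (\<Sum>i<n. indicator {\<tau> i<..\<tau> (Suc i)} t *\<^sub>R \<phi> i \<omega>)"

definition step_ito ::
  "(real \<Rightarrow> 'a \<Rightarrow> real ^ 'd) \<Rightarrow> nat \<Rightarrow> (nat \<Rightarrow> real) \<Rightarrow> (nat \<Rightarrow> 'a \<Rightarrow> real ^ 'd) \<Rightarrow> real \<Rightarrow> 'a \<Rightarrow> real" where
  "step_ito B n \<tau> \<phi> t \<omega> =
     (\<Sum>i<n. \<phi> i \<omega> \<bullet> (B (min (\<tau> (Suc i)) t) \<omega> - B (min (\<tau> i) t) \<omega>))"

definition null_in_prob :: "'a measure \<Rightarrow> (nat \<Rightarrow> 'a \<Rightarrow> ennreal) \<Rightarrow> bool" where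
  "null_in_prob M X \<longleftrightarrow>
     (\<forall>\<epsilon>>0. (\<lambda>k. measure (completion M) {\<omega>\<in>space M. ennreal \<epsilon> < X k \<omega>}) \<longlonglongrightarrow> 0)"

text \<open>\<open>ito_integral M T B Z I\<close>: the process \<open>I\<close> is (a version of) \<open>t \<mapsto> \<integral>\<^sub>0\<^sup>t Z\<^sub>s dB\<^sub>s\<close>, i.e. the
  adapted, a.s. continuous limit, uniformly on \<open>[0,T]\<close> in probability, of the integrals of step
  integrands that converge to \<open>Z\<close> in \<open>L\<^sup>2(dt)\<close> in probability.  It is unique up to
  indistinguishability.\<close>

definition ito_integral ::
  "'a measure \<Rightarrow> real \<Rightarrow> (real \<Rightarrow> 'a \<Rightarrow> real ^ 'd) \<Rightarrow> (real \<Rightarrow> 'a \<Rightarrow> real ^ 'd) \<Rightarrow> (real \<Rightarrow> 'a \<Rightarrow> real) \<Rightarrow> bool" where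
  "ito_integral M T B Z I \<longleftrightarrow>
     (\<forall>t\<in>{0..T}. I t \<in> borel_measurable (aug_filtration M B t)) \<and>
     (AE \<omega> in M. continuous_on {0..T} (\<lambda>t. I t \<omega>)) \<and>
     (\<exists>n \<tau> \<phi>. (\<forall>k. step_integrand M T B (n k) (\<tau> k) (\<phi> k)) \<and>
        null_in_prob M (\<lambda>k \<omega>. \<integral>\<^sup>+s\<in>{0..T}.
          ennreal ((norm (step_process (n k) (\<tau> k) (\<phi> k) s \<omega> - Z s \<omega>))\<^sup>2) \<partial>lborel) \<and>
        null_in_prob M (\<lambda>k \<omega>. SUP t\<in>{0..T}.
          ennreal \<bar>step_ito B (n k) (\<tau> k) (\<phi> k) t \<omega> - I t \<omega>\<bar>))"

section \<open>Doubly reflected BSDEs with irregular barriers\<close>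

definition trunc_between :: "real \<Rightarrow> real \<Rightarrow> real \<Rightarrow> real" where
  "trunc_between a y b = min (max a y) b"

definition Dom ::
  "'a measure \<Rightarrow> real \<Rightarrow> (real \<Rightarrow> 'a \<Rightarrow> real ^ 'd) \<Rightarrow>
   (real \<Rightarrow> 'a \<Rightarrow> real) \<Rightarrow> (real \<Rightarrow> 'a \<Rightarrow> real) \<Rightarrow> (real \<Rightarrow> 'a \<Rightarrow> real) \<Rightarrow> (real \<Rightarrow> 'a \<Rightarrow> real) \<Rightarrow>
   (real \<Rightarrow> 'a \<Rightarrow> real) \<Rightarrow> (real \<Rightarrow> 'a \<Rightarrow> real) \<Rightarrow> (real \<Rightarrow> 'a \<Rightarrow> real) set" where
  "Dom M T B L U l u \<alpha> \<delta> = {Y \<in> rcll_processes M T B.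
     (\<integral>\<^sup>+\<omega>.
        (\<integral>\<^sup>+t\<in>{0<..T}. ennreal (max 0 (left_lim L t \<omega> - left_lim Y t \<omega>)) \<partial>lborel) +
        (\<integral>\<^sup>+t\<in>{0<..T}. ennreal (max 0 (l t \<omega> - left_lim Y t \<omega>)) \<partial>stieltjes T \<delta> \<omega>) +
        (\<integral>\<^sup>+t\<in>{0<..T}. ennreal (max 0 (- (left_lim U t \<omega> - left_lim Y t \<omega>))) \<partial>lborel) +
        (\<integral>\<^sup>+t\<in>{0<..T}. ennreal (max 0 (- (u t \<omega> - left_lim Y t \<omega>))) \<partial>stieltjes T \<alpha> \<omega>) \<partial>M) = 0}"

text \<open>The backward equation, with \<open>\<integral>\<^sub>t\<^sup>T dK = K\<^sub>T - K\<^sub>t\<close>.  That the \<open>ds\<close>- and \<open>dA\<close>-integrals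
  exist a.s. is part of the equation, since the Bochner integral is \<open>0\<close> by convention otherwise.\<close>

definition bsde_equation ::
  "'a measure \<Rightarrow> real \<Rightarrow> (real \<Rightarrow> 'a \<Rightarrow> real ^ 'd) \<Rightarrow> ('a \<Rightarrow> real) \<Rightarrow>
   (real \<Rightarrow> 'a \<Rightarrow> real \<Rightarrow> real ^ 'd \<Rightarrow> real) \<Rightarrow> (real \<Rightarrow> 'a \<Rightarrow> real \<Rightarrow> real \<Rightarrow> real) \<Rightarrow> (real \<Rightarrow> 'a \<Rightarrow> real) \<Rightarrow>
   (real \<Rightarrow> 'a \<Rightarrow> real) \<Rightarrow> (real \<Rightarrow> 'a \<Rightarrow> real ^ 'd) \<Rightarrow> (real \<Rightarrow> 'a \<Rightarrow> real) \<Rightarrow> (real \<Rightarrow> 'a \<Rightarrow> real) \<Rightarrow> bool" where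
  "bsde_equation M T B \<xi> f g A Y Z Kp Km \<longleftrightarrow> (\<exists>I. ito_integral M T B Z I \<and>
     (AE \<omega> in M.
        set_integrable lborel {0..T} (\<lambda>s. f s \<omega> (Y s \<omega>) (Z s \<omega>)) \<and>
        set_integrable (stieltjes T A \<omega>) {0<..T} (\<lambda>s. g s \<omega> (left_lim Y s \<omega>) (Y s \<omega>)) \<and>
        (\<forall>t\<in>{0..T}. Y t \<omega> = \<xi> \<omega>
           + set_lebesgue_integral lborel {t<..T} (\<lambda>s. f s \<omega> (Y s \<omega>) (Z s \<omega>))
           + set_lebesgue_integral (stieltjes T A \<omega>) {t<..T} (\<lambda>s. g s \<omega> (left_lim Y s \<omega>) (Y s \<omega>))
           + (Kp T \<omega> - Kp t \<omega>) - (Km T \<omega> - Km t \<omega>) - (I T \<omega> - I t \<omega>))))"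

definition drbsde_solution ::
  "'a measure \<Rightarrow> real \<Rightarrow> (real \<Rightarrow> 'a \<Rightarrow> real ^ 'd) \<Rightarrow> ('a \<Rightarrow> real) \<Rightarrow>
   (real \<Rightarrow> 'a \<Rightarrow> real \<Rightarrow> real ^ 'd \<Rightarrow> real) \<Rightarrow> (real \<Rightarrow> 'a \<Rightarrow> real \<Rightarrow> real \<Rightarrow> real) \<Rightarrow> (real \<Rightarrow> 'a \<Rightarrow> real) \<Rightarrow>
   (real \<Rightarrow> 'a \<Rightarrow> real) \<Rightarrow> (real \<Rightarrow> 'a \<Rightarrow> real) \<Rightarrow> (real \<Rightarrow> 'a \<Rightarrow> real) \<Rightarrow> (real \<Rightarrow> 'a \<Rightarrow> real) \<Rightarrow>
   (real \<Rightarrow> 'a \<Rightarrow> real) \<Rightarrow> (real \<Rightarrow> 'a \<Rightarrow> real) \<Rightarrow>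
   (real \<Rightarrow> 'a \<Rightarrow> real) \<Rightarrow> (real \<Rightarrow> 'a \<Rightarrow> real ^ 'd) \<Rightarrow> (real \<Rightarrow> 'a \<Rightarrow> real) \<Rightarrow> (real \<Rightarrow> 'a \<Rightarrow> real) \<Rightarrow> bool" where
  "drbsde_solution M T B \<xi> f g A L U l u \<alpha> \<delta> Y Z Kp Km \<longleftrightarrow>
     Y \<in> Dom M T B L U l u \<alpha> \<delta> \<and>
     Z \<in> L2_processes M T B \<and>
     Kp \<in> increasing_processes M T B \<and> Km \<in> increasing_processes M T B \<and>
     mutually_singular M T B Kp Km \<and>
     bsde_equation M T B \<xi> f g A Y Z Kp Km \<and>
     (\<forall>Ls \<in> Dom M T B L U l u \<alpha> \<delta>.
        (\<integral>\<^sup>+\<omega>.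
          (\<integral>\<^sup>+t\<in>{0<..T}. ennreal (max 0 (left_lim Y t \<omega> - left_lim Ls t \<omega>)) \<partial>stieltjes T Kp \<omega>) +
          (\<integral>\<^sup>+t\<in>{0<..T}. ennreal (max 0 (- (left_lim Y t \<omega> - left_lim Ls t \<omega>))) \<partial>stieltjes T Km \<omega>) \<partial>M) = 0)"

text \<open>\<open>upper_env T \<delta> l\<close> is \<open>l\<^sup>*\<^sup>,\<^sup>\<delta>\<close>; \<open>upper_env T \<alpha> (\<lambda>s \<omega>. - u s \<omega>)\<close> is \<open>(-u)\<^sup>*\<^sup>,\<^sup>\<alpha>\<close>.
  The infimum over \<open>n\<close> includes \<open>n = 0\<close>, which does not matter as the expression
  is nonincreasing in \<open>n\<close>.\<close>

definition upper_env ::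
  "real \<Rightarrow> (real \<Rightarrow> 'a \<Rightarrow> real) \<Rightarrow> (real \<Rightarrow> 'a \<Rightarrow> real) \<Rightarrow> real \<Rightarrow> 'a \<Rightarrow> ereal" where
  "upper_env T \<delta> l t \<omega> = (INF n::nat. ereal (- real n * t) +
     Inf (ereal ` {a. (\<integral>\<^sup>+s\<in>{0<..t}. ennreal (max 0 (l s \<omega> + real n * s - a)) \<partial>stieltjes T \<delta> \<omega>) = 0}))"

end

theory Submission
  imports Defs
begin

text \<open>
  An rcll process \<open>Y\<close> satisfies \<open>l \<le> Y\<^sub>-\<close> \<open>d\<delta>\<close>-almost everywhere if and only if
  \<open>l\<^sup>*\<^sup>,\<^sup>\<delta> \<le> Y\<^sub>-\<close> everywhere on \<open>]0, T]\<close>: left limits of rcll paths are left continuous, so the term \<open>n s\<close> confines the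
  essential supremum to a left neighbourhood of \<open>t\<close>, and conversely \<open>l \<le> l\<^sup>*\<^sup>,\<^sup>\<delta>\<close> holds
  \<open>d\<delta>\<close>-almost everywhere.  It follows that the flatness condition implies the minimality of \<open>K\<^sup>+\<close> and
  \<open>K\<^sup>-\<close>, the latter by changing signs.

  For the converse, suppose that \<open>Y\<close> exceeds both \<open>L\<^sub>-\<close> and (almost everywhere) \<open>l\<close> by \<open>e\<close> on a random
  interval \<open>J\<close> that starts at a rational time \<open>q\<close> and ends, with or without its right end point, at an
  optional time \<open>\<rho>\<close>.  If \<open>\<eta>\<close> is rcll and predictable with \<open>0 \<le> \<eta>\<^sub>- \<le> 1\<close> and \<open>\<eta>\<^sub>- > 0\<close>
  exactly on \<open>J\<close>, then \<open>Y - e \<eta>\<close> is in the domain, so \<open>K\<^sup>+\<close> does not charge \<open>J\<close>; countably many such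
  intervals cover the set where \<open>Y\<^sub>-\<close> exceeds its lower bound.  The process \<open>\<eta>\<close> must drop to \<open>0\<close> at \<open>\<rho>\<close>
  predictably, with a left limit at \<open>\<rho>\<close> that is positive only if \<open>\<rho>\<close> belongs to \<open>J\<close>.  This is where the
  Brownian filtration enters: its bounded martingales have continuous versions, because this holds for
  products of continuous functions of \<open>B\<close> at fixed times, by independence of the increments, and is
  preserved under limits in \<open>L\<^sup>1\<close>, by Doob's maximal inequality.
\<close>

section \<open>The augmented filtration and predictable processes\<close>

text \<open>The obstacle is that lowering Y on J requires a process whose left limits, not values,
  are positive exactly on J. Just before the end point \<rho> it must therefore already reflect
  whether \<rho> itself belongs to J; announcing \<rho> is not enough. A continuous martingale
  closed by the indicator of this event tends to the right value at \<rho>, and adding E[\<rho> | F]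
  - t keeps the sum positive before \<rho> without disturbing its value at \<rho>. The interval J is
  the zero set of a predictable increasing defect, the integral of the shortfall from the required
  distance, so its end point is detected at rational times. Optional times are accordingly specified
  by strict inequalities, and they are approximated strictly from the right when a martingale is
  sampled. Paths must be rcll at every sample point, whereas most facts hold almost surely; since
  all null sets belong to the filtration from time 0 on, processes can be corrected on null sets
  without losing adaptedness.\<close>

locale brownian_setting = prob_space M
  for M :: "'a measure" +
  fixes T :: real and B :: "real \<Rightarrow> 'a \<Rightarrow> real ^ 'd"
  assumes T_pos: "0 < T" and brownian: "brownian_motion M T B"
begin

text \<open>Since \<open>F t\<close> contains the null sets of the completion, adapted processes are
  measurable for \<open>Mc\<close> but perhaps not for \<open>M\<close>. They are integrated over
  \<open>Mc\<close>; \<open>AE\<close> statements pass freely between the two.\<close>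

abbreviation Mc :: "'a measure" where "Mc \<equiv> completion M"
abbreviation F :: "real \<Rightarrow> 'a measure" where "F \<equiv> aug_filtration M B"
abbreviation Pr :: "(real \<times> 'a) measure" where "Pr \<equiv> predictable M T B"

lemma prob_space_Mc: "prob_space Mc"
  by (rule prob_spaceI) (simp add: emeasure_space_1)

lemma B_measurable: "t \<in> {0..T} \<Longrightarrow> B t \<in> borel_measurable M"
  using brownian by (auto simp: brownian_motion_def)

lemma space_F [simp]: "space (F t) = space M"
  by (simp add: aug_filtration_def space_measure_of_conv)

lemma F_generators_Pow:
  "{B s -` S \<inter> space M | s S. s \<in> {0..t} \<and> S \<in> sets borel} \<union> null_sets Mc \<subseteq> Pow (space M)"
  using sets.sets_into_space[of _ Mc] by fastforce

lemma sets_F: "sets (F t) = sigma_sets (space M)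
    ({B s -` S \<inter> space M | s S. s \<in> {0..t} \<and> S \<in> sets borel} \<union> null_sets Mc)"
  unfolding aug_filtration_def by (rule sets_measure_of[OF F_generators_Pow])

lemma sets_F_mono: "s \<le> t \<Longrightarrow> sets (F s) \<subseteq> sets (F t)"
  unfolding sets_F
proof (rule sigma_sets_mono', rule Un_mono, safe)
  fix r S assume "s \<le> t" "r \<in> {0..s}" "S \<in> sets (borel :: (real ^ 'd) measure)"
  then show "\<exists>r' S'. B r -` S \<inter> space M = B r' -` S' \<inter> space M \<and> r' \<in> {0..t} \<and> S' \<in> sets borel"
    by (intro exI[of _ r] exI[of _ S]) simp
qed

lemma sets_F_Mc: "t \<le> T \<Longrightarrow> sets (F t) \<subseteq> sets Mc"
proof -
  assume t: "t \<le> T"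
  have "sigma_sets (space Mc)
      ({B s -` S \<inter> space M | s S. s \<in> {0..t} \<and> S \<in> sets borel} \<union> null_sets Mc) \<subseteq> sets Mc"
  proof (rule sets.sigma_sets_subset)
    have "B s -` S \<inter> space M \<in> sets Mc" if "s \<in> {0..t}" "S \<in> sets borel" for s S
      using measurable_sets[OF B_measurable[of s], of S] that t by auto
    then show "{B s -` S \<inter> space M | s S. s \<in> {0..t} \<and> S \<in> sets borel} \<union> null_sets Mc \<subseteq> sets Mc"
      by auto
  qed
  then show ?thesis by (simp add: sets_F)
qed

lemma null_sets_F: "N \<in> null_sets Mc \<Longrightarrow> N \<in> sets (F t)"
  unfolding sets_F by (auto intro: sigma_sets.Basic)

lemma measurable_F_mono: "s \<le> t \<Longrightarrow> X \<in> measurable (F s) N \<Longrightarrow> X \<in> measurable (F t) N"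
  using sets_F_mono[of s t] by (auto simp: measurable_def)

lemma measurable_F_Mc: "t \<le> T \<Longrightarrow> X \<in> measurable (F t) N \<Longrightarrow> X \<in> measurable Mc N"
  using sets_F_Mc[of t] by (auto simp: measurable_def)

lemma B_measurable_F: "s \<in> {0..t} \<Longrightarrow> B s \<in> borel_measurable (F t)"
  by (rule measurableI) (auto simp: sets_F intro!: sigma_sets.Basic)

text \<open>Every \<open>F t\<close>, \<open>F 0\<close> included, contains all null sets of
  \<open>Mc\<close>. A process can thus be corrected on an exceptional set, so that pathwise
  properties hold at every sample point, and stay adapted.\<close>

lemma measurable_F_null_cong:
  assumes X: "X \<in> borel_measurable (F t)" and N: "N \<in> null_sets Mc"
    and eq: "\<And>\<omega>. \<omega> \<in> space M - N \<Longrightarrow> Y \<omega> = X \<omega>"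
  shows "Y \<in> borel_measurable (F t)"
proof (rule measurableI)
  fix S :: "'b set" assume S: "S \<in> sets borel"
  have NF: "N \<in> sets (F t)" by (rule null_sets_F[OF N])
  have "Y -` S \<inter> N \<in> null_sets Mc"
    using N by (rule null_sets_completion_subset[rotated]) auto
  then have "Y -` S \<inter> N \<in> sets (F t)" by (rule null_sets_F)
  moreover have "X -` S \<inter> space (F t) - N \<in> sets (F t)"
    using measurable_sets[OF X S] NF by auto
  moreover have "Y -` S \<inter> space (F t) = (X -` S \<inter> space (F t) - N) \<union> (Y -` S \<inter> N)"
    using eq sets.sets_into_space[OF NF] by auto
  ultimately show "Y -` S \<inter> space (F t) \<in> sets (F t)" by auto
qed simp

lemma AE_null_set_ex:
  assumes "AE \<omega> in Mc. P \<omega>"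
  shows "\<exists>N\<in>null_sets Mc. \<forall>\<omega>\<in>space M - N. P \<omega>"
proof -
  obtain N where "\<And>\<omega>. \<omega> \<in> space Mc - N \<Longrightarrow> P \<omega>" "N \<in> null_sets Mc"
    using AE_E3[OF assms] by blast
  then show ?thesis by (intro bexI[of _ N]) auto
qed

lemma space_Pr [simp]: "space Pr = {0..T} \<times> space M"
  by (simp add: predictable_def space_measure_of_conv)

lemma Pr_generators_Pow:
  "{{0} \<times> S | S. S \<in> sets (F 0)} \<union>
    {{s<..t} \<times> S | s t S. 0 \<le> s \<and> s < t \<and> t \<le> T \<and> S \<in> sets (F s)} \<subseteq> Pow ({0..T} \<times> space M)"
  using sets.sets_into_space[of _ "F _"] T_pos by fastforce

lemma sets_Pr: "sets Pr = sigma_sets ({0..T} \<times> space M)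
    ({{0} \<times> S | S. S \<in> sets (F 0)} \<union>
     {{s<..t} \<times> S | s t S. 0 \<le> s \<and> s < t \<and> t \<le> T \<and> S \<in> sets (F s)})"
  unfolding predictable_def by (rule sets_measure_of[OF Pr_generators_Pow])

lemma Pr_zero: "S \<in> sets (F 0) \<Longrightarrow> {0} \<times> S \<in> sets Pr"
  unfolding sets_Pr by (rule sigma_sets.Basic) auto

lemma Pr_Ioc:
  assumes "0 \<le> s" "t \<le> T" "S \<in> sets (F s)"
  shows "{s<..t} \<times> S \<in> sets Pr"
proof (cases "s < t")
  case True
  then show ?thesis unfolding sets_Pr using assms by (intro sigma_sets.Basic) auto
qed auto

lemma measurable_PrI:
  assumes sp: "\<And>x. x \<in> space N \<Longrightarrow> h x \<in> {0..T} \<times> space M"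
    and zero: "\<And>S. S \<in> sets (F 0) \<Longrightarrow> h -` ({0} \<times> S) \<inter> space N \<in> sets N"
    and Ioc: "\<And>s t S. 0 \<le> s \<Longrightarrow> s < t \<Longrightarrow> t \<le> T \<Longrightarrow> S \<in> sets (F s) \<Longrightarrow>
      h -` ({s<..t} \<times> S) \<inter> space N \<in> sets N"
  shows "h \<in> measurable N Pr"
  unfolding predictable_def
  by (rule measurable_measure_of[OF Pr_generators_Pow]) (use assms in auto)

lemma measurable_Pr_section:
  assumes t: "t \<in> {0..T}"
  shows "(\<lambda>\<omega>. (t, \<omega>)) \<in> measurable (F t) Pr"
proof (rule measurable_PrI)
  fix S assume "S \<in> sets (F 0)"
  then have "S \<in> sets (F t)" using sets_F_mono[of 0 t] t by auto
  moreover have "(\<lambda>\<omega>. (t, \<omega>)) -` ({0} \<times> S) \<inter> space (F t) = (if t = 0 then S else {})"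
    using sets.sets_into_space[OF \<open>S \<in> sets (F t)\<close>] by auto
  ultimately show "(\<lambda>\<omega>. (t, \<omega>)) -` ({0} \<times> S) \<inter> space (F t) \<in> sets (F t)" by auto
next
  fix s r S assume "0 \<le> s" "s < r" "r \<le> T" and S: "S \<in> sets (F s)"
  have eq: "(\<lambda>\<omega>. (t, \<omega>)) -` ({s<..r} \<times> S) \<inter> space (F t) = (if s < t \<and> t \<le> r then S else {})"
    using sets.sets_into_space[OF S] by auto
  show "(\<lambda>\<omega>. (t, \<omega>)) -` ({s<..r} \<times> S) \<inter> space (F t) \<in> sets (F t)"
    unfolding eq using S sets_F_mono[of s t] by auto
qed (use t in auto)

lemma Int_in_sets_restrict_space: "A \<in> sets N \<Longrightarrow> \<Omega> \<inter> A \<in> sets (restrict_space N \<Omega>)"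
  unfolding sets_restrict_space by (rule imageI)

lemma measurable_Pr_path:
  assumes \<omega>: "\<omega> \<in> space M"
  shows "(\<lambda>t. (t, \<omega>)) \<in> measurable (restrict_space borel {0..T}) Pr"
proof (rule measurable_PrI)
  fix S assume "S \<in> sets (F 0)"
  have eq: "(\<lambda>t. (t, \<omega>)) -` ({0} \<times> S) \<inter> space (restrict_space borel {0..T}) = {0..T} \<inter> (if \<omega> \<in> S then {0} else {})"
    by (auto simp: space_restrict_space)
  show "(\<lambda>t. (t, \<omega>)) -` ({0} \<times> S) \<inter> space (restrict_space borel {0..T}) \<in> sets (restrict_space borel {0..T})"
    unfolding eq by (rule Int_in_sets_restrict_space) auto
next
  fix s r S assume "0 \<le> s" "s < r" "r \<le> T" and S: "S \<in> sets (F s)"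
  have eq: "(\<lambda>t. (t, \<omega>)) -` ({s<..r} \<times> S) \<inter> space (restrict_space borel {0..T}) = {0..T} \<inter> (if \<omega> \<in> S then {s<..r} else {})"
    by (auto simp: space_restrict_space)
  show "(\<lambda>t. (t, \<omega>)) -` ({s<..r} \<times> S) \<inter> space (restrict_space borel {0..T}) \<in> sets (restrict_space borel {0..T})"
    unfolding eq by (rule Int_in_sets_restrict_space) auto
qed (use \<omega> in \<open>auto simp: space_restrict_space\<close>)

text \<open>Predictable sets are jointly measurable, which is what evaluation at a random time
  requires in \<open>measurable_Pr_graph\<close>.\<close>

lemma measurable_Pr_id: "id \<in> measurable (restrict_space borel {0..T} \<Otimes>\<^sub>M Mc) Pr"
proof (rule measurable_PrI)
  fix S assume "S \<in> sets (F 0)"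
  then have "S \<in> sets Mc" using sets_F_Mc[of 0] T_pos by auto
  moreover have "{0..T} \<inter> {0} \<in> sets (restrict_space borel {0..T})"
    by (rule Int_in_sets_restrict_space) auto
  ultimately have "({0..T} \<inter> {0}) \<times> S \<in> sets (restrict_space borel {0..T} \<Otimes>\<^sub>M Mc)" by auto
  moreover have "id -` ({0} \<times> S) \<inter> space (restrict_space borel {0..T} \<Otimes>\<^sub>M Mc) = ({0..T} \<inter> {0}) \<times> S"
    using sets.sets_into_space[OF \<open>S \<in> sets Mc\<close>] by (auto simp: space_pair_measure space_restrict_space)
  ultimately show "id -` ({0} \<times> S) \<inter> space (restrict_space borel {0..T} \<Otimes>\<^sub>M Mc) \<in> sets (restrict_space borel {0..T} \<Otimes>\<^sub>M Mc)"
    by simp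
next
  fix s r S assume H: "0 \<le> s" "s < r" "r \<le> T" "S \<in> sets (F s)"
  then have "S \<in> sets Mc" using sets_F_Mc[of s] by auto
  moreover have "{0..T} \<inter> {s<..r} \<in> sets (restrict_space borel {0..T})"
    by (rule Int_in_sets_restrict_space) auto
  ultimately have "({0..T} \<inter> {s<..r}) \<times> S \<in> sets (restrict_space borel {0..T} \<Otimes>\<^sub>M Mc)" by auto
  moreover have "id -` ({s<..r} \<times> S) \<inter> space (restrict_space borel {0..T} \<Otimes>\<^sub>M Mc) = ({0..T} \<inter> {s<..r}) \<times> S"
    using sets.sets_into_space[OF \<open>S \<in> sets Mc\<close>] by (auto simp: space_pair_measure space_restrict_space)
  ultimately show "id -` ({s<..r} \<times> S) \<inter> space (restrict_space borel {0..T} \<Otimes>\<^sub>M Mc) \<in> sets (restrict_space borel {0..T} \<Otimes>\<^sub>M Mc)"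
    by simp
qed (auto simp: space_pair_measure space_restrict_space)

lemma measurable_Pr_graph:
  assumes \<rho>: "\<rho> \<in> borel_measurable Mc" "\<And>\<omega>. \<omega> \<in> space M \<Longrightarrow> \<rho> \<omega> \<in> {0..T}"
  shows "(\<lambda>\<omega>. (\<rho> \<omega>, \<omega>)) \<in> measurable Mc Pr"
proof -
  have "\<rho> \<in> measurable Mc (restrict_space borel {0..T})"
    using \<rho> by (intro measurable_restrict_space2) auto
  then have "(\<lambda>\<omega>. (\<rho> \<omega>, \<omega>)) \<in> measurable Mc (restrict_space borel {0..T} \<Otimes>\<^sub>M Mc)" by simp
  from measurable_compose[OF this measurable_Pr_id] show ?thesis by simp
qed

lemma fst_measurable_Pr: "fst \<in> borel_measurable Pr"
proof (rule borel_measurableI_greater)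
  fix y :: real
  have "{x \<in> space Pr. y < fst x} =
      (if y < 0 then space Pr else if y < T then {y<..T} \<times> space M else {})"
    by auto
  also have "\<dots> \<in> sets Pr"
    using Pr_Ioc[of y T "space M"] sets.top[of "F y"] sets.top[of Pr] by (auto simp del: sets.top)
  finally show "{x \<in> space Pr. y < fst x} \<in> sets Pr" .
qed

lemma Pr_section_event:
  assumes "D \<in> sets Pr" "t \<in> {0..T}"
  shows "{\<omega> \<in> space M. (t, \<omega>) \<in> D} \<in> sets (F t)"
  using measurable_sets[OF measurable_Pr_section[OF assms(2)] assms(1)]
  by (simp add: vimage_def Int_def conj_commute)

lemma predictable_adapted:
  assumes "predictable_process M T B X" "t \<in> {0..T}"
  shows "X t \<in> borel_measurable (F t)"
  using measurable_compose[OF measurable_Pr_section[OF assms(2)] assms(1)[unfolded predictable_process_def]]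
  by simp

text \<open>X at t is the limit of X at grid points strictly to the left of t. The process frozen at
  these points takes on each cell ]s, r] a value known at s, so its preimages are finite unions of
  generators of \<open>Pr\<close>.\<close>

lemma left_continuous_adapted_predictable:
  fixes X :: "real \<Rightarrow> 'a \<Rightarrow> 'b::metric_space"
  assumes X: "\<And>t. t \<in> {0..T} \<Longrightarrow> X t \<in> borel_measurable (F t)"
    and lc: "\<And>\<omega> t. \<omega> \<in> space M \<Longrightarrow> t \<in> {0<..T} \<Longrightarrow> ((\<lambda>s. X s \<omega>) \<longlongrightarrow> X t \<omega>) (at_left t)"
  shows "predictable_process M T B X"
  unfolding predictable_process_def
proof (rule borel_measurable_LIMSEQ_metric)
  \<comment> \<open>For t > 0 this is the largest multiple of 1/(n+1) strictly below t, or 0;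
    ceiling minus one rather than floor keeps it strictly below t when t is a grid point. The
    maximum with 0 fixes the value at t = 0.\<close>
  define g where "g n t = max 0 (real_of_int (\<lceil>t * real (Suc n)\<rceil> - 1) / real (Suc n))" for n :: nat and t
  let ?Xn = "\<lambda>n (t, \<omega>). X (g n t) \<omega>"
  have g_bd: "0 \<le> g n t" "t - 1 / real (Suc n) \<le> g n t" for n t
  proof -
    have "t * real (Suc n) - 1 \<le> real_of_int (\<lceil>t * real (Suc n)\<rceil> - 1)" by linarith
    then have "(t * real (Suc n) - 1) / real (Suc n) \<le> real_of_int (\<lceil>t * real (Suc n)\<rceil> - 1) / real (Suc n)"
      by (rule divide_right_mono) simp
    moreover have "(t * real (Suc n) - 1) / real (Suc n) = t - 1 / real (Suc n)"
      by (simp add: diff_divide_distrib del: of_nat_Suc)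
    ultimately show "t - 1 / real (Suc n) \<le> g n t" unfolding g_def by linarith
  qed (simp add: g_def)
  have g_less: "g n t < t" if "0 < t" for n t
  proof -
    have "real_of_int (\<lceil>t * real (Suc n)\<rceil> - 1) < t * real (Suc n)" by linarith
    then have "real_of_int (\<lceil>t * real (Suc n)\<rceil> - 1) / real (Suc n) < t"
      by (simp add: pos_divide_less_eq del: of_nat_Suc)
    then show ?thesis using that unfolding g_def by linarith
  qed
  have g0: "g n 0 = 0" for n by (simp add: g_def)
  show "?Xn n \<in> borel_measurable Pr" for n
  proof (rule measurableI)
    fix A :: "'b set" assume A: "A \<in> sets borel"
    define m where "m = nat \<lceil>T * real (Suc n)\<rceil>"
    \<comment> \<open>Cells are cut off at T. The conditional puts the empty event where a cell
      would start after T, since adaptedness of X is known only up to T; such a cell is empty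
      anyway.\<close>
    have "?Xn n -` A \<inter> space Pr = ({0} \<times> (X 0 -` A \<inter> space M)) \<union>
       (\<Union>k\<in>{..<m}. {real k / real (Suc n) <.. min T (real (Suc k) / real (Suc n))} \<times> (if real k / real (Suc n) \<le> T then X (real k / real (Suc n)) -` A \<inter> space M else {}))"
      (is "_ = ?R")
    proof (intro set_eqI iffI)
      fix x assume x: "x \<in> ?Xn n -` A \<inter> space Pr"
      obtain t \<omega> where [simp]: "x = (t, \<omega>)" by force
      from x have t: "t \<in> {0..T}" "\<omega> \<in> space M" "X (g n t) \<omega> \<in> A" by auto
      show "x \<in> ?R"
      proof (cases "t = 0")
        case True then show ?thesis using t g0 by auto
      next
        case False
        define k where "k = nat (\<lceil>t * real (Suc n)\<rceil> - 1)"
        have pos: "0 < t * real (Suc n)" using False t by auto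
        have c1: "\<lceil>t * real (Suc n)\<rceil> \<ge> 1" using pos by linarith
        have k: "real k = real_of_int (\<lceil>t * real (Suc n)\<rceil> - 1)" using c1 by (simp add: k_def)
        have gk: "g n t = real k / real (Suc n)" unfolding g_def k[symmetric] by simp
        have k1: "real k < t * real (Suc n)" "t * real (Suc n) \<le> real (Suc k)" using k by linarith+
        have k2: "real k / real (Suc n) < t" "t \<le> real (Suc k) / real (Suc n)"
          using k1 by (simp_all add: pos_divide_less_eq pos_le_divide_eq del: of_nat_Suc)
        have "t * real (Suc n) \<le> T * real (Suc n)" using t by (intro mult_right_mono) auto
        then have "real k < T * real (Suc n)" using k1 by linarith
        then have "k < m" unfolding m_def by linarith
        then show ?thesis using t k2 gk by (auto intro!: bexI[of _ k])
      qed
    next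
      fix x assume x: "x \<in> ?R"
      obtain t \<omega> where [simp]: "x = (t, \<omega>)" by force
      from x consider "t = 0" "X 0 \<omega> \<in> A" "\<omega> \<in> space M" | k where
         "real k / real (Suc n) < t" "t \<le> min T (real (Suc k) / real (Suc n))"
         "\<omega> \<in> (if real k / real (Suc n) \<le> T then X (real k / real (Suc n)) -` A \<inter> space M else {})"
        by auto
      then show "x \<in> ?Xn n -` A \<inter> space Pr"
      proof cases
        case 1 then show ?thesis using T_pos g0 by auto
      next
        case 2
        have "real k < t * real (Suc n)" "t * real (Suc n) \<le> real (Suc k)"
          using 2 by (simp_all add: pos_divide_less_eq pos_le_divide_eq del: of_nat_Suc)
        then have "\<lceil>t * real (Suc n)\<rceil> = int (Suc k)"
          by (intro ceiling_unique) auto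
        then have "g n t = real k / real (Suc n)" by (simp add: g_def)
        moreover have "0 \<le> real k / real (Suc n)" by simp
        then have "0 \<le> t" using 2(1) by linarith
        ultimately show ?thesis using 2 by (auto split: if_splits simp del: of_nat_Suc)
      qed
    qed
    also have "\<dots> \<in> sets Pr"
    proof (intro sets.Un sets.finite_UN Pr_zero Pr_Ioc)
      show "X 0 -` A \<inter> space M \<in> sets (F 0)" using measurable_sets[OF X[of 0] A] T_pos by auto
      show "(if real k / real (Suc n) \<le> T then X (real k / real (Suc n)) -` A \<inter> space M else {}) \<in> sets (F (real k / real (Suc n)))" for k
        using measurable_sets[OF X[of "real k / real (Suc n)"] A] by auto
    qed auto
    finally show "?Xn n -` A \<inter> space Pr \<in> sets Pr" .
  qed simp
  show "(\<lambda>n. ?Xn n x) \<longlonglongrightarrow> (\<lambda>(t, \<omega>). X t \<omega>) x" if "x \<in> space Pr" for x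
  proof -
    obtain t \<omega> where [simp]: "x = (t, \<omega>)" by force
    from that have t: "t \<in> {0..T}" "\<omega> \<in> space M" by auto
    show ?thesis
    proof (cases "t = 0")
      case True then show ?thesis using g0 by simp
    next
      case False
      then have t0: "t \<in> {0<..T}" using t by auto
      have "(\<lambda>n. g n t) \<longlonglongrightarrow> t"
      proof (rule tendsto_sandwich)
        show "\<forall>\<^sub>F n in sequentially. t - 1 / real (Suc n) \<le> g n t" using g_bd by simp
        show "\<forall>\<^sub>F n in sequentially. g n t \<le> t" using t0 by (intro always_eventually allI less_imp_le g_less) simp
        show "(\<lambda>n. t - 1 / real (Suc n)) \<longlonglongrightarrow> t"
          using tendsto_diff[OF tendsto_const LIMSEQ_Suc[OF lim_inverse_n'], of t] by simp
      qed auto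
      then have "filterlim (\<lambda>n. g n t) (at_left t) sequentially"
        using g_less[of t] t0 by (auto simp: filterlim_at intro!: always_eventually less_imp_neq)
      from filterlim_compose[OF lc[OF t(2) t0] this] show ?thesis by simp
    qed
  qed
qed

lemma predictable_path_measurable:
  assumes "h \<in> borel_measurable Pr" "\<omega> \<in> space M"
  shows "(\<lambda>t. h (t, \<omega>)) \<in> borel_measurable (restrict_space borel {0..T})"
  using measurable_compose[OF measurable_Pr_path[OF assms(2)] assms(1)] .

end

section \<open>Left limits and integrals against increasing processes\<close>

lemma rcll_onD:
  assumes "rcll_on T x"
  shows "t \<in> {0..<T} \<Longrightarrow> (x \<longlongrightarrow> x t) (at_right t)"
    and "t \<in> {0<..T} \<Longrightarrow> \<exists>l. (x \<longlongrightarrow> l) (at_left t)"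
  using assms by (auto simp: rcll_on_def)

lemma rcll_on_add:
  assumes "rcll_on T x" "rcll_on T y" shows "rcll_on T (\<lambda>t. x t + y t)"
  unfolding rcll_on_def
proof (intro conjI ballI)
  show "((\<lambda>t. x t + y t) \<longlongrightarrow> x t + y t) (at_right t)" if "t \<in> {0..<T}" for t
    by (intro tendsto_add rcll_onD(1)[OF assms(1) that] rcll_onD(1)[OF assms(2) that])
  show "\<exists>l. ((\<lambda>t. x t + y t) \<longlongrightarrow> l) (at_left t)" if "t \<in> {0<..T}" for t
    using rcll_onD(2)[OF assms(1) that] rcll_onD(2)[OF assms(2) that] tendsto_add by blast
qed

lemma rcll_on_cmult:
  assumes "rcll_on T x" shows "rcll_on T (\<lambda>t. c * x t)"
  unfolding rcll_on_def
proof (intro conjI ballI)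
  show "((\<lambda>t. c * x t) \<longlongrightarrow> c * x t) (at_right t)" if "t \<in> {0..<T}" for t
    by (intro tendsto_mult_left rcll_onD(1)[OF assms that])
  show "\<exists>l. ((\<lambda>t. c * x t) \<longlongrightarrow> l) (at_left t)" if "t \<in> {0<..T}" for t
    using rcll_onD(2)[OF assms that] tendsto_mult_left by blast
qed

text \<open>Bisection replaces compactness: at every t the one-sided limits bound x on punctured
  half-neighbourhoods, and bounds on adjacent intervals combine by the maximum.\<close>

lemma rcll_on_bounded:
  assumes x: "rcll_on T x" and T: "0 < T"
  obtains C where "\<And>t. t \<in> {0..T} \<Longrightarrow> \<bar>x t\<bar> \<le> C"
proof -
  \<comment> \<open>Intersecting with [0, T] makes the property meaningful on intervals that stick
    out at the end points, which the local hypothesis of \<open>Bolzano\<close> includes.\<close>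
  define P where "P a b \<longleftrightarrow> (\<exists>C. \<forall>s\<in>{a..b} \<inter> {0..T}. \<bar>x s\<bar> \<le> C)" for a b
  have "P 0 T"
  proof (rule Bolzano[of 0 T P])
    show "0 \<le> T" using T by simp
  next
    fix a b c
    assume "P a b" "P b c"
    then obtain C1 C2 where C: "\<forall>s\<in>{a..b} \<inter> {0..T}. \<bar>x s\<bar> \<le> C1" "\<forall>s\<in>{b..c} \<inter> {0..T}. \<bar>x s\<bar> \<le> C2"
      unfolding P_def by blast
    have "\<bar>x s\<bar> \<le> max C1 C2" if "s \<in> {a..c} \<inter> {0..T}" for s
      using C that by (cases "s \<le> b") (force simp: le_max_iff_disj)+
    then show "P a c" unfolding P_def by blast
  next
    fix t assume t: "0 \<le> t" "t \<le> T"
    obtain d1 C1 where d1: "d1 > 0" "\<And>s. t < s \<Longrightarrow> s < t + d1 \<Longrightarrow> s \<le> T \<Longrightarrow> \<bar>x s\<bar> \<le> C1"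
    proof (cases "t < T")
      case True
      then have "(x \<longlongrightarrow> x t) (at_right t)" using rcll_onD(1)[OF x] t by auto
      from tendstoD[OF this zero_less_one] obtain b where b: "b > t" "\<And>s. t < s \<Longrightarrow> s < b \<Longrightarrow> dist (x s) (x t) < 1"
        unfolding eventually_at_right_field by blast
      show ?thesis
        by (rule that[of "b - t" "\<bar>x t\<bar> + 1"]) (use b in \<open>auto simp: dist_real_def dest!: spec\<close>, smt (verit))
    next
      case False
      then show ?thesis using t by (intro that[of 1 0]) auto
    qed
    obtain d2 C2 where d2: "d2 > 0" "\<And>s. s < t \<Longrightarrow> t - d2 < s \<Longrightarrow> 0 \<le> s \<Longrightarrow> \<bar>x s\<bar> \<le> C2"
    proof (cases "0 < t")
      case True
      then obtain l where "(x \<longlongrightarrow> l) (at_left t)" using rcll_onD(2)[OF x] t by auto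
      from tendstoD[OF this zero_less_one] obtain b where b: "b < t" "\<And>s. b < s \<Longrightarrow> s < t \<Longrightarrow> dist (x s) l < 1"
        unfolding eventually_at_left_field by blast
      show ?thesis
        by (rule that[of "t - b" "\<bar>l\<bar> + 1"]) (use b in \<open>auto simp: dist_real_def\<close>, smt (verit))
    next
      case False
      then show ?thesis using t by (intro that[of 1 0]) auto
    qed
    show "\<exists>d>0. \<forall>a b. a \<le> t \<and> t \<le> b \<and> b - a < d \<longrightarrow> P a b"
    proof (intro exI[of _ "min d1 d2"] conjI allI impI)
      show "0 < min d1 d2" using d1 d2 by simp
      fix a b assume ab: "a \<le> t \<and> t \<le> b \<and> b - a < min d1 d2"
      show "P a b"
        unfolding P_def
      proof (intro exI[of _ "max \<bar>x t\<bar> (max C1 C2)"] ballI)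
        fix s assume s: "s \<in> {a..b} \<inter> {0..T}"
        consider "s = t" | "t < s" | "s < t" by linarith
        then show "\<bar>x s\<bar> \<le> max \<bar>x t\<bar> (max C1 C2)"
        proof cases
          case 2
          then have "\<bar>x s\<bar> \<le> C1" using d1(2)[of s] s ab by auto
          then show ?thesis by simp
        next
          case 3
          then have "\<bar>x s\<bar> \<le> C2" using d2(2)[of s] s ab by auto
          then show ?thesis by simp
        qed simp
      qed
    qed
  qed
  then obtain C where "\<forall>s\<in>{0..T}. \<bar>x s\<bar> \<le> C" unfolding P_def by auto
  then show ?thesis by (intro that[of C]) auto
qed

lemma left_lim_tendsto:
  assumes "rcll_on T (\<lambda>t. X t \<omega>)" "t \<in> {0<..T}"
  shows "((\<lambda>s. X s \<omega>) \<longlongrightarrow> left_lim X t \<omega>) (at_left t)"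
proof -
  obtain l where l: "((\<lambda>s. X s \<omega>) \<longlongrightarrow> l) (at_left t)" using rcll_onD(2)[OF assms] by blast
  then have "left_lim X t \<omega> = l" using assms(2) by (auto simp: left_lim_def intro: tendsto_Lim)
  then show ?thesis using l by simp
qed

lemma left_lim_eqI:
  assumes "((\<lambda>s. X s \<omega>) \<longlongrightarrow> l) (at_left t)" "0 < t"
  shows "left_lim X t \<omega> = l"
  using assms by (auto simp: left_lim_def intro: tendsto_Lim)

text \<open>Close to t, X stays within e/2 of its left limit at t; the left limits at nearby s are
  limits of such values and inherit the weak inequality.\<close>

lemma left_lim_left_continuous:
  assumes x: "rcll_on T (\<lambda>t. X t \<omega>)" and t: "t \<in> {0<..T}"
  shows "((\<lambda>s. left_lim X s \<omega>) \<longlongrightarrow> left_lim X t \<omega>) (at_left t)"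
proof (rule tendstoI)
  fix e :: real assume e: "0 < e"
  then have "eventually (\<lambda>s. dist (X s \<omega>) (left_lim X t \<omega>) < e / 2) (at_left t)"
    using tendstoD[OF left_lim_tendsto[where X=X and \<omega>=\<omega>, OF x t], of "e / 2"] by simp
  then obtain b where b: "b < t" "\<And>s. b < s \<Longrightarrow> s < t \<Longrightarrow> dist (X s \<omega>) (left_lim X t \<omega>) < e / 2"
    unfolding eventually_at_left_field by blast
  \<comment> \<open>Positivity of s matters: at time 0 \<open>left_lim\<close> is \<open>X 0\<close>
    by convention and not a limit.\<close>
  have "dist (left_lim X s \<omega>) (left_lim X t \<omega>) < e" if s: "max b 0 < s" "s < t" for s
  proof -
    have "((\<lambda>r. dist (X r \<omega>) (left_lim X t \<omega>)) \<longlongrightarrow> dist (left_lim X s \<omega>) (left_lim X t \<omega>)) (at_left s)"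
      by (intro tendsto_dist tendsto_const left_lim_tendsto[where X=X and \<omega>=\<omega>, OF x]) (use s t in auto)
    moreover have "eventually (\<lambda>r. dist (X r \<omega>) (left_lim X t \<omega>) \<le> e / 2) (at_left s)"
      unfolding eventually_at_left_field using s b by (intro exI[of _ b]) (auto intro!: less_imp_le)
    ultimately have "dist (left_lim X s \<omega>) (left_lim X t \<omega>) \<le> e / 2"
      by (rule tendsto_upperbound) simp
    then show ?thesis using e by linarith
  qed
  then show "eventually (\<lambda>s. dist (left_lim X s \<omega>) (left_lim X t \<omega>) < e) (at_left t)"
    unfolding eventually_at_left_field using b(1) t by (intro exI[of _ "max b 0"]) auto
qed

lemma left_lim_bounded:
  assumes x: "rcll_on T (\<lambda>t. X t \<omega>)" and T: "0 < T"
  obtains C where "\<And>t. t \<in> {0<..T} \<Longrightarrow> \<bar>left_lim X t \<omega>\<bar> \<le> C"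
proof -
  obtain C where C: "\<And>t. t \<in> {0..T} \<Longrightarrow> \<bar>X t \<omega>\<bar> \<le> C" using rcll_on_bounded[OF x T] by blast
  have "\<bar>left_lim X t \<omega>\<bar> \<le> C" if t: "t \<in> {0<..T}" for t
  proof (rule tendsto_upperbound)
    show "((\<lambda>s. \<bar>X s \<omega>\<bar>) \<longlongrightarrow> \<bar>left_lim X t \<omega>\<bar>) (at_left t)"
      by (intro tendsto_rabs left_lim_tendsto[where X=X and \<omega>=\<omega>, OF x t])
    show "eventually (\<lambda>s. \<bar>X s \<omega>\<bar> \<le> C) (at_left t)"
      unfolding eventually_at_left_field using t by (intro exI[of _ 0]) (auto intro!: C)
  qed simp
  then show ?thesis by (rule that)
qed

context brownian_setting
begin

abbreviation rcllP :: "(real \<Rightarrow> 'a \<Rightarrow> real) set" where "rcllP \<equiv> rcll_processes M T B"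
abbreviation incP :: "(real \<Rightarrow> 'a \<Rightarrow> real) set" where "incP \<equiv> increasing_processes M T B"

lemma rcllP_path: "X \<in> rcllP \<Longrightarrow> \<omega> \<in> space M \<Longrightarrow> rcll_on T (\<lambda>t. X t \<omega>)"
  by (simp add: rcll_processes_def)

lemma rcllP_predictable: "X \<in> rcllP \<Longrightarrow> predictable_process M T B X"
  by (simp add: rcll_processes_def)

lemma rcllP_add_cmult:
  assumes "X \<in> rcllP" "Y \<in> rcllP" shows "(\<lambda>t \<omega>. X t \<omega> + c * Y t \<omega>) \<in> rcllP"
proof -
  have "(\<lambda>x. (\<lambda>(t, \<omega>). X t \<omega>) x + c * (\<lambda>(t, \<omega>). Y t \<omega>) x) \<in> borel_measurable Pr"
    using assms by (intro borel_measurable_add borel_measurable_times borel_measurable_const)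
      (auto simp: rcll_processes_def predictable_process_def)
  then show ?thesis using assms
    by (auto simp: rcll_processes_def predictable_process_def split_beta' intro!: rcll_on_add rcll_on_cmult)
qed

lemma left_lim_add_cmult:
  assumes "X \<in> rcllP" "Y \<in> rcllP" "\<omega> \<in> space M" "t \<in> {0<..T}"
  shows "left_lim (\<lambda>t \<omega>. X t \<omega> + c * Y t \<omega>) t \<omega> = left_lim X t \<omega> + c * left_lim Y t \<omega>"
  using assms by (intro left_lim_eqI tendsto_intros left_lim_tendsto[of T] rcllP_path) auto

lemma rcllP_uminus:
  assumes "X \<in> rcllP" shows "(\<lambda>t \<omega>. - X t \<omega>) \<in> rcllP"
proof -
  have "(\<lambda>x. - (\<lambda>(t, \<omega>). X t \<omega>) x) \<in> borel_measurable Pr"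
    using assms by (intro borel_measurable_uminus) (auto simp: rcll_processes_def predictable_process_def)
  moreover have "rcll_on T (\<lambda>t. - X t \<omega>)" if "\<omega> \<in> space M" for \<omega>
    using rcll_on_cmult[OF rcllP_path[OF assms that], of "-1"] by simp
  ultimately show ?thesis
    by (auto simp: rcll_processes_def predictable_process_def split_beta')
qed

lemma left_lim_uminus:
  assumes "X \<in> rcllP" "\<omega> \<in> space M" "t \<in> {0<..T}"
  shows "left_lim (\<lambda>t \<omega>. - X t \<omega>) t \<omega> = - left_lim X t \<omega>"
  using assms by (intro left_lim_eqI tendsto_intros left_lim_tendsto[of T] rcllP_path) auto

lemma left_lim_predictable:
  assumes X: "X \<in> rcllP"
  shows "predictable_process M T B (left_lim X)"
proof (rule left_continuous_adapted_predictable)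
  fix t assume t: "t \<in> {0..T}"
  show "left_lim X t \<in> borel_measurable (F t)"
  proof (cases "t = 0")
    case True
    have "left_lim X 0 = X 0" by (simp add: left_lim_def fun_eq_iff)
    then show ?thesis using True predictable_adapted[OF rcllP_predictable[OF X], of 0] T_pos by simp
  next
    case False
    \<comment> \<open>Subtracting a fraction of t itself keeps the times in [0, t[, beginning with
      \<open>r 0 = 0\<close>; the values of X there are known at t.\<close>
    define r where "r n = t - t / real (Suc n)" for n
    have r: "0 \<le> r n" "r n < t" for n
      using False t by (auto simp: r_def divide_le_eq mult_le_cancel_left1)
    have "r \<longlonglongrightarrow> t - 0"
      unfolding r_def by (intro tendsto_diff tendsto_const LIMSEQ_Suc lim_const_over_n)
    then have fl: "filterlim r (at_left t) sequentially"
      using r by (auto simp: filterlim_at intro!: always_eventually less_imp_neq)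
    show ?thesis
    proof (rule borel_measurable_LIMSEQ_metric)
      show "X (r n) \<in> borel_measurable (F t)" for n
        using predictable_adapted[OF rcllP_predictable[OF X], of "r n"] r[of n] t
        by (intro measurable_F_mono[of "r n" t]) auto
      show "(\<lambda>n. X (r n) \<omega>) \<longlonglongrightarrow> left_lim X t \<omega>" if "\<omega> \<in> space (F t)" for \<omega>
        using filterlim_compose[OF left_lim_tendsto[where X=X and \<omega>=\<omega>, OF rcllP_path[OF X, of \<omega>], of t] fl] that False t by simp
    qed
  qed
next
  fix \<omega> t assume "\<omega> \<in> space M" "t \<in> {0<..T}"
  then show "((\<lambda>s. left_lim X s \<omega>) \<longlongrightarrow> left_lim X t \<omega>) (at_left t)"
    using left_lim_left_continuous[where X=X and \<omega>=\<omega>, OF rcllP_path[OF X]] by blast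
qed

section \<open>Predictability of pathwise Stieltjes integrals\<close>

lemma sets_stieltjes [simp, measurable_cong]: "sets (stieltjes T K \<omega>) = sets borel"
  and space_stieltjes [simp]: "space (stieltjes T K \<omega>) = UNIV"
  by (simp_all add: stieltjes_def)

lemma incP_path:
  assumes "K \<in> incP" "\<omega> \<in> space M"
  shows "K 0 \<omega> = 0" "\<And>s t. 0 \<le> s \<Longrightarrow> s \<le> t \<Longrightarrow> t \<le> T \<Longrightarrow> K s \<omega> \<le> K t \<omega>" "K \<in> rcllP"
  using assms by (auto simp: increasing_processes_def mono_on_def)

lemma emeasure_stieltjes_Ioc:
  assumes K: "K \<in> incP" and \<omega>: "\<omega> \<in> space M" and ab: "0 \<le> a" "a \<le> b" "b \<le> T"
  shows "emeasure (stieltjes T K \<omega>) {a<..b} = ennreal (K b \<omega> - K a \<omega>)"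
proof -
  note Kp = incP_path[OF K \<omega>]
  let ?G = "\<lambda>t. K (max 0 (min T t)) \<omega>"
  have mono: "?G x \<le> ?G y" if "x \<le> y" for x y
    by (rule Kp(2)) (use that T_pos in auto)
  have rc: "continuous (at_right x) ?G" for x
  proof -
    \<comment> \<open>Outside [0, T[ the extended path is constant immediately to the right of x;
      inside, it coincides there with K.\<close>
    consider "x < 0" | "0 \<le> x" "x < T" | "T \<le> x" by linarith
    then have "(?G \<longlongrightarrow> ?G x) (at_right x)"
    proof cases
      case 1
      have "eventually (\<lambda>y. ?G y = ?G x) (at_right x)"
        unfolding eventually_at_right_field using 1 T_pos by (intro exI[of _ 0]) auto
      then show ?thesis by (rule tendsto_eventually)
    next
      case 2
      have *: "((\<lambda>t. K t \<omega>) \<longlongrightarrow> K x \<omega>) (at_right x)"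
        using rcll_onD(1)[OF rcllP_path[OF Kp(3) \<omega>], of x] 2 by auto
      have "((\<lambda>t. K t \<omega>) \<longlongrightarrow> K x \<omega>) (at_right x) = (?G \<longlongrightarrow> K x \<omega>) (at_right x)"
        by (rule tendsto_cong) (use 2 in \<open>auto simp: eventually_at_right_field intro!: exI[of _ T]\<close>)
      then show ?thesis using * 2 by simp
    next
      case 3
      have "eventually (\<lambda>y. ?G y = ?G x) (at_right x)"
        unfolding eventually_at_right_field using 3 T_pos by (intro exI[of _ "x + 1"]) auto
      then show ?thesis by (rule tendsto_eventually)
    qed
    then show ?thesis by (simp add: continuous_within)
  qed
  have "emeasure (stieltjes T K \<omega>) {a<..b} = ennreal (?G b - ?G a)"
    unfolding stieltjes_def by (rule emeasure_interval_measure_Ioc[OF ab(2) mono rc])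
  then show ?thesis using ab by simp
qed

text \<open>What dK and dt have in common: a predictable distribution function, and finite mass on
  ]0, T], which makes complements computable by subtraction in the Dynkin argument below.\<close>

definition predictable_kernel :: "('a \<Rightarrow> real measure) \<Rightarrow> bool" where
  "predictable_kernel N \<longleftrightarrow>
     (\<forall>\<omega>\<in>space M. sets (N \<omega>) = sets borel \<and> emeasure (N \<omega>) {0<..T} < \<infinity>) \<and>
     (\<lambda>(t, \<omega>). emeasure (N \<omega>) {0<..t}) \<in> borel_measurable Pr"

lemma predictable_kernel_stieltjes:
  assumes K: "K \<in> incP" shows "predictable_kernel (stieltjes T K)"
proof -
  have "(\<lambda>x. ennreal ((\<lambda>(t, \<omega>). K t \<omega>) x)) \<in> borel_measurable Pr"
    using K by (intro measurable_compose[OF _ measurable_ennreal])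
      (auto simp: increasing_processes_def rcll_processes_def predictable_process_def)
  also have "?this \<longleftrightarrow> (\<lambda>(t, \<omega>). emeasure (stieltjes T K \<omega>) {0<..t}) \<in> borel_measurable Pr"
    by (rule measurable_cong) (auto simp: emeasure_stieltjes_Ioc[OF K] incP_path(1)[OF K])
  finally show ?thesis
    using T_pos by (auto simp: predictable_kernel_def emeasure_stieltjes_Ioc[OF K])
qed

lemma predictable_kernel_lborel: "predictable_kernel (\<lambda>_. lborel)"
proof -
  have "(\<lambda>x. ennreal (fst x)) \<in> borel_measurable Pr"
    by (rule measurable_compose[OF fst_measurable_Pr measurable_ennreal])
  also have "?this \<longleftrightarrow> (\<lambda>(t, \<omega>). emeasure lborel {0<..t}) \<in> borel_measurable Pr"
    by (rule measurable_cong) auto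
  finally show ?thesis using T_pos by (auto simp: predictable_kernel_def)
qed

lemma path_indicator_borel:
  fixes h :: "real \<times> 'a \<Rightarrow> ennreal"
  assumes h: "h \<in> borel_measurable Pr" and \<omega>: "\<omega> \<in> space M" and t: "t \<le> T"
  shows "(\<lambda>s. h (s, \<omega>) * indicator {0<..t} s) \<in> borel_measurable borel"
proof -
  have "(\<lambda>s. h (s, \<omega>) * indicator {0..T} s) \<in> borel_measurable borel"
    using predictable_path_measurable[OF h \<omega>]
      borel_measurable_restrict_space_iff_ennreal[of "{0..T}" borel "\<lambda>t. h (t, \<omega>)"] by simp
  then have "(\<lambda>s. (h (s, \<omega>) * indicator {0..T} s) * indicator {0<..t} s) \<in> borel_measurable borel"
    by (rule borel_measurable_times_ennreal) simp
  also have "(\<lambda>s. (h (s, \<omega>) * indicator {0..T} s) * indicator {0<..t} s) = (\<lambda>s. h (s, \<omega>) * indicator {0<..t} s)"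
    using t by (auto simp: fun_eq_iff indicator_def)
  finally show ?thesis .
qed

text \<open>Rectangles ]s, T] x S with S in \<open>F s\<close> are predictable, hence so are frozen
  values that are switched on strictly after s. Such terms carry the boundary values of integrals
  over rectangles.\<close>

lemma delayed_measurable_Pr:
  fixes X :: "'a \<Rightarrow> ennreal"
  assumes X: "X \<in> borel_measurable (F s)" and s: "0 \<le> s"
  shows "(\<lambda>(t, \<omega>). X \<omega> * indicator {s<..T} t) \<in> borel_measurable Pr"
proof (rule measurableI)
  fix A :: "ennreal set" assume A: "A \<in> sets borel"
  have eq: "(\<lambda>(t, \<omega>). X \<omega> * indicator {s<..T} t) -` A \<inter> space Pr =
    ({s<..T} \<times> (X -` A \<inter> space (F s))) \<union> (if 0 \<in> A then space Pr - {s<..T} \<times> space M else {})"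
  proof (intro set_eqI)
    fix x :: "real \<times> 'a"
    show "x \<in> (\<lambda>(t, \<omega>). X \<omega> * indicator {s<..T} t) -` A \<inter> space Pr \<longleftrightarrow> x \<in> ({s<..T} \<times> (X -` A \<inter> space (F s))) \<union> (if 0 \<in> A then space Pr - {s<..T} \<times> space M else {})"
      using s by (cases "fst x \<in> {s<..T}") auto
  qed
  have "{s<..T} \<times> (X -` A \<inter> space (F s)) \<in> sets Pr"
    by (rule Pr_Ioc[OF s order_refl measurable_sets[OF X A]])
  moreover have "{s<..T} \<times> space M \<in> sets Pr"
    using Pr_Ioc[OF s order_refl sets.top[of "F s"]] by simp
  ultimately show "(\<lambda>(t, \<omega>). X \<omega> * indicator {s<..T} t) -` A \<inter> space Pr \<in> sets Pr"
    unfolding eq using sets.compl_sets by (auto simp del: space_Pr)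
qed simp

text \<open>A Dynkin argument over the rectangles generating \<open>Pr\<close>, which are stable
  under intersection. On ]s, r] x S the integral up to t is the indicator of S times the mass of ]s,
  min t r], a difference of distribution functions.\<close>

lemma kernel_integral_indicator:
  assumes N: "predictable_kernel N" and D: "D \<in> sets Pr"
  shows "(\<lambda>(t, \<omega>). \<integral>\<^sup>+s\<in>{0<..t}. indicator D (s, \<omega>) \<partial>N \<omega>) \<in> borel_measurable Pr"
proof -
  define G where "G = {{0} \<times> S | S. S \<in> sets (F 0)} \<union>
    {{s<..t} \<times> S | s t S. 0 \<le> s \<and> s < t \<and> t \<le> T \<and> S \<in> sets (F s)}"
  define V where "V = (\<lambda>(t, \<omega>). emeasure (N \<omega>) {0<..t})"
  have V: "V \<in> borel_measurable Pr" using N by (simp add: predictable_kernel_def V_def)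
  have N1: "sets (N \<omega>) = sets borel" "emeasure (N \<omega>) {0<..T} < \<infinity>" if "\<omega> \<in> space M" for \<omega>
    using N that by (auto simp: predictable_kernel_def)
  have Vfin: "emeasure (N \<omega>) {a<..b} < \<infinity>" if "\<omega> \<in> space M" "0 \<le> a" "b \<le> T" for \<omega> a b
  proof -
    have "{a<..b} \<subseteq> {0<..T}" using that by auto
    then show ?thesis
      using le_less_trans[OF emeasure_mono N1(2)[OF that(1)], of "{a<..b}"] N1(1)[OF that(1)] by simp
  qed
  have Int: "Int_stable G"
  proof (rule Int_stableI)
    have emp: "{} \<in> G" unfolding G_def by (rule UnI1) (auto intro!: exI[of _ "{}"])
    fix a b assume "a \<in> G" "b \<in> G"
    then consider (1) S S' where "a = {0} \<times> S" "b = {0} \<times> S'" "S \<in> sets (F 0)" "S' \<in> sets (F 0)"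
      | (2) "a \<inter> b = {}"
      | (3) s t S s' t' S' where "a = {s<..t} \<times> S" "b = {s'<..t'} \<times> S'"
        "0 \<le> s" "t \<le> T" "S \<in> sets (F s)" "0 \<le> s'" "t' \<le> T" "S' \<in> sets (F s')"
      unfolding G_def by fastforce
    then show "a \<inter> b \<in> G"
    proof cases
      case 1
      then have "a \<inter> b = {0} \<times> (S \<inter> S')" by auto
      moreover have "S \<inter> S' \<in> sets (F 0)" using 1 by auto
      ultimately show ?thesis unfolding G_def by blast
    next
      case 2 then show ?thesis using emp by simp
    next
      case 3
      have eq: "a \<inter> b = {max s s'<..min t t'} \<times> (S \<inter> S')" using 3 by auto
      have S: "S \<inter> S' \<in> sets (F (max s s'))"
        using 3 sets_F_mono[of s "max s s'"] sets_F_mono[of s' "max s s'"] by auto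
      show ?thesis
      proof (cases "max s s' < min t t'")
        case True
        then show ?thesis unfolding eq G_def using S 3
          by (intro UnI2 CollectI exI[of _ "max s s'"] exI[of _ "min t t'"] exI[of _ "S \<inter> S'"]) auto
      next
        case False
        then have "a \<inter> b = {}" unfolding eq by auto
        then show ?thesis using emp by simp
      qed
    qed
  qed
  have D': "D \<in> sigma_sets ({0..T} \<times> space M) G" using D unfolding sets_Pr G_def .
  have GPow: "G \<subseteq> Pow ({0..T} \<times> space M)" using Pr_generators_Pow unfolding G_def .
  show ?thesis
    using Int GPow D'
  proof (induct D rule: sigma_sets_induct_disjoint)
    case (basic A)
    then consider (1) S where "A = {0} \<times> S" | (2) s r S where "A = {s<..r} \<times> S" "0 \<le> s" "s < r" "r \<le> T" "S \<in> sets (F s)"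
      unfolding G_def by blast
    then show ?case
    proof cases
      case 1
      have "(\<integral>\<^sup>+s\<in>{0<..t}. indicator A (s, \<omega>) \<partial>N \<omega>) = 0" for t \<omega>
        unfolding 1 by (subst nn_integral_cong[where v="\<lambda>_. 0"]) (auto simp: indicator_def)
      then show ?thesis by simp
    next
      case 2
      have r: "r \<in> {0..T}" "s \<in> {0..T}" using 2 by auto
      have Vr: "(\<lambda>\<omega>. V (q, \<omega>)) \<in> borel_measurable (F q)" if "q \<in> {0..T}" for q
        by (rule measurable_compose[OF measurable_Pr_section[OF that] V])
      have m1: "(\<lambda>(t, \<omega>). V (r, \<omega>) * indicator {r<..T} t) \<in> borel_measurable Pr"
        by (rule delayed_measurable_Pr[OF Vr[OF r(1)]]) (use r in simp)
      have m2: "(\<lambda>(t, \<omega>). V (s, \<omega>) * indicator {s<..T} t) \<in> borel_measurable Pr"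
        by (rule delayed_measurable_Pr[OF Vr[OF r(2)]]) (use r in simp)
      have S1: "{s<..T} \<times> S \<in> sets Pr" by (rule Pr_Ioc) (use 2 in auto)
      have S2: "{s<..r} \<times> space M \<in> sets Pr" using Pr_Ioc[of s r "space M"] 2 sets.top[of "F s"] by simp
      \<comment> \<open>The distribution function stopped at r is written as V on ]s, r] plus its
        value at r frozen after r, so that each summand is visibly predictable; the value at s is
        subtracted.\<close>
      define R where "R x = indicator ({s<..T} \<times> S) x *
          ((V x * indicator ({s<..r} \<times> space M) x + (\<lambda>(t, \<omega>). V (r, \<omega>) * indicator {r<..T} t) x)
            - (\<lambda>(t, \<omega>). V (s, \<omega>) * indicator {s<..T} t) x)" for x
      have "R \<in> borel_measurable Pr"
        unfolding R_def using V m1 m2 S1 S2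
        by (intro borel_measurable_times_ennreal borel_measurable_minus_ennreal borel_measurable_add borel_measurable_indicator)
      also have "R \<in> borel_measurable Pr \<longleftrightarrow> (\<lambda>(t, \<omega>). \<integral>\<^sup>+s\<in>{0<..t}. indicator A (s, \<omega>) \<partial>N \<omega>) \<in> borel_measurable Pr"
      proof (rule measurable_cong)
        fix x assume "x \<in> space Pr"
        then obtain t \<omega> where x: "x = (t, \<omega>)" "t \<in> {0..T}" "\<omega> \<in> space M" by auto
        have sN [measurable_cong]: "sets (N \<omega>) = sets borel" using N1(1) x by simp
        have "(\<integral>\<^sup>+s\<in>{0<..t}. indicator A (s, \<omega>) \<partial>N \<omega>) = (\<integral>\<^sup>+q. indicator S \<omega> * indicator {s<..min t r} q \<partial>N \<omega>)"
          by (rule nn_integral_cong) (use 2 in \<open>auto simp: indicator_def\<close>)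
        also have "\<dots> = indicator S \<omega> * emeasure (N \<omega>) {s<..min t r}"
          by (simp add: nn_integral_cmult_indicator sN)
        also have "\<dots> = R x"
        proof (cases "s < t")
          case False
          then show ?thesis using 2 x by (auto simp: R_def)
        next
          case True
          have "emeasure (N \<omega>) {s<..min t r} = emeasure (N \<omega>) ({0<..min t r} - {0<..s})"
            using 2 True by (intro arg_cong2[where f=emeasure] refl) auto
          also have "\<dots> = emeasure (N \<omega>) {0<..min t r} - emeasure (N \<omega>) {0<..s}"
            using 2 True Vfin[of \<omega> 0 s] x by (intro emeasure_Diff) (auto simp: sN)
          finally show ?thesis using 2 x True
            by (auto simp: R_def V_def indicator_def min_def)
        qed
        finally show "R x = (\<lambda>(t, \<omega>). \<integral>\<^sup>+s\<in>{0<..t}. indicator A (s, \<omega>) \<partial>N \<omega>) x"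
          by (simp add: x)
      qed
      finally show ?thesis .
    qed
  next
    case empty
    show ?case by simp
  next
    case (compl A)
    have A: "A \<in> sets Pr" using compl unfolding sets_Pr G_def by blast
    have "(\<lambda>x. V x - (\<lambda>(t, \<omega>). \<integral>\<^sup>+s\<in>{0<..t}. indicator A (s, \<omega>) \<partial>N \<omega>) x) \<in> borel_measurable Pr"
      using compl V by (intro borel_measurable_minus_ennreal)
    also have "?this \<longleftrightarrow> (\<lambda>(t, \<omega>). \<integral>\<^sup>+s\<in>{0<..t}. indicator ({0..T} \<times> space M - A) (s, \<omega>) \<partial>N \<omega>) \<in> borel_measurable Pr"
    proof (rule measurable_cong)
      fix x assume "x \<in> space Pr"
      then obtain t \<omega> where x: "x = (t, \<omega>)" "t \<in> {0..T}" "\<omega> \<in> space M" by auto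
      have sN [measurable_cong]: "sets (N \<omega>) = sets borel" using N1(1) x by simp
      have m: "(\<lambda>q. indicator A (q, \<omega>) * indicator {0<..t} q :: ennreal) \<in> borel_measurable (N \<omega>)"
        using path_indicator_borel[OF borel_measurable_indicator[OF A], of \<omega> t] x
        by (simp cong: measurable_cong_sets)
      have m': "(\<lambda>q. indicator ({0..T} \<times> space M - A) (q, \<omega>) * indicator {0<..t} q :: ennreal) \<in> borel_measurable (N \<omega>)"
        using path_indicator_borel[OF borel_measurable_indicator[OF sets.compl_sets[OF A]], of \<omega> t] x
        by (simp cong: measurable_cong_sets)
      have le: "(\<integral>\<^sup>+s\<in>{0<..t}. indicator A (s, \<omega>) \<partial>N \<omega>) \<le> emeasure (N \<omega>) {0<..t}"
      proof -
        have "(\<integral>\<^sup>+s\<in>{0<..t}. indicator A (s, \<omega>) \<partial>N \<omega>) \<le> (\<integral>\<^sup>+s. indicator {0<..t} s \<partial>N \<omega>)"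
          by (rule nn_integral_mono) (auto simp: indicator_def)
        then show ?thesis by (simp add: sN)
      qed
      have "emeasure (N \<omega>) {0<..t} = (\<integral>\<^sup>+q. indicator {0<..t} q \<partial>N \<omega>)" by (simp add: sN)
      also have "\<dots> = (\<integral>\<^sup>+q. indicator A (q, \<omega>) * indicator {0<..t} q + indicator ({0..T} \<times> space M - A) (q, \<omega>) * indicator {0<..t} q \<partial>N \<omega>)"
        by (rule nn_integral_cong) (use x in \<open>auto simp: indicator_def\<close>)
      also have "\<dots> = (\<integral>\<^sup>+s\<in>{0<..t}. indicator A (s, \<omega>) \<partial>N \<omega>) + (\<integral>\<^sup>+s\<in>{0<..t}. indicator ({0..T} \<times> space M - A) (s, \<omega>) \<partial>N \<omega>)"
        by (rule nn_integral_add[OF m m'])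
      finally have "emeasure (N \<omega>) {0<..t} = \<dots>" .
      \<comment> \<open>In \<open>ennreal\<close> a sum determines the other summand by subtraction
        only if the subtracted one is finite.\<close>
      moreover have "(\<integral>\<^sup>+s\<in>{0<..t}. indicator A (s, \<omega>) \<partial>N \<omega>) \<noteq> \<top>"
        using le Vfin[of \<omega> 0 t] x by (auto simp: top_unique)
      ultimately show "V x - (\<lambda>(t, \<omega>). \<integral>\<^sup>+s\<in>{0<..t}. indicator A (s, \<omega>) \<partial>N \<omega>) x =
          (\<lambda>(t, \<omega>). \<integral>\<^sup>+s\<in>{0<..t}. indicator ({0..T} \<times> space M - A) (s, \<omega>) \<partial>N \<omega>) x"
        by (simp add: x V_def)
    qed
    finally show ?case .
  next
    case (union A)
    have A: "A i \<in> sets Pr" for i using union(2) unfolding sets_Pr G_def by blast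
    have "(\<lambda>x. \<Sum>i. (\<lambda>(t, \<omega>). \<integral>\<^sup>+s\<in>{0<..t}. indicator (A i) (s, \<omega>) \<partial>N \<omega>) x) \<in> borel_measurable Pr"
      using union by (intro borel_measurable_suminf_order)
    also have "?this \<longleftrightarrow> (\<lambda>(t, \<omega>). \<integral>\<^sup>+s\<in>{0<..t}. indicator (\<Union>i. A i) (s, \<omega>) \<partial>N \<omega>) \<in> borel_measurable Pr"
    proof (rule measurable_cong)
      fix x assume "x \<in> space Pr"
      then obtain t \<omega> where x: "x = (t, \<omega>)" "t \<in> {0..T}" "\<omega> \<in> space M" by auto
      have sN [measurable_cong]: "sets (N \<omega>) = sets borel" using N1(1) x by simp
      have m: "(\<lambda>q. indicator (A i) (q, \<omega>) * indicator {0<..t} q :: ennreal) \<in> borel_measurable (N \<omega>)" for i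
        using path_indicator_borel[OF borel_measurable_indicator[OF A[of i]], of \<omega> t] x
        by (simp cong: measurable_cong_sets)
      have "(\<integral>\<^sup>+s\<in>{0<..t}. indicator (\<Union>i. A i) (s, \<omega>) \<partial>N \<omega>) = (\<integral>\<^sup>+q. (\<Sum>i. indicator (A i) (q, \<omega>) * indicator {0<..t} q) \<partial>N \<omega>)"
      proof (rule nn_integral_cong)
        fix q
        have "(\<Sum>i. indicator (A i) (q, \<omega>) :: ennreal) = indicator (\<Union>i. A i) (q, \<omega>)"
          by (rule suminf_indicator[OF union(1)])
        then show "indicator (\<Union>i. A i) (q, \<omega>) * indicator {0<..t} q = (\<Sum>i. indicator (A i) (q, \<omega>) * indicator {0<..t} q :: ennreal)"
          by (auto simp: indicator_def[of "{0<..t}"])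
      qed
      also have "\<dots> = (\<Sum>i. \<integral>\<^sup>+q. indicator (A i) (q, \<omega>) * indicator {0<..t} q \<partial>N \<omega>)"
        by (rule nn_integral_suminf[OF m])
      finally show "(\<Sum>i. (\<lambda>(t, \<omega>). \<integral>\<^sup>+s\<in>{0<..t}. indicator (A i) (s, \<omega>) \<partial>N \<omega>) x) =
          (\<lambda>(t, \<omega>). \<integral>\<^sup>+s\<in>{0<..t}. indicator (\<Union>i. A i) (s, \<omega>) \<partial>N \<omega>) x"
        by (simp add: x)
    qed
    finally show ?case .
  qed
qed

text \<open>Predictability in t, beyond measurability at T, matters: the defect whose zeros form the
  random interval J is such an integral.\<close>

lemma kernel_integral_predictable:
  fixes h :: "real \<times> 'a \<Rightarrow> ennreal"
  assumes N: "predictable_kernel N" and h: "h \<in> borel_measurable Pr"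
  shows "(\<lambda>(t, \<omega>). \<integral>\<^sup>+s\<in>{0<..t}. h (s, \<omega>) \<partial>N \<omega>) \<in> borel_measurable Pr"
  using h
proof (induct rule: borel_measurable_induct)
  case (cong f g)
  have "(\<lambda>(t, \<omega>). \<integral>\<^sup>+s\<in>{0<..t}. f (s, \<omega>) \<partial>N \<omega>) \<in> borel_measurable Pr \<longleftrightarrow>
     (\<lambda>(t, \<omega>). \<integral>\<^sup>+s\<in>{0<..t}. g (s, \<omega>) \<partial>N \<omega>) \<in> borel_measurable Pr"
    by (rule measurable_cong) (auto intro!: nn_integral_cong simp: cong(3) indicator_def)
  then show ?case using cong by simp
next
  case (set A)
  then show ?case by (rule kernel_integral_indicator[OF N])
next
  case (mult u c)
  have "(\<lambda>x. c * (\<lambda>(t, \<omega>). \<integral>\<^sup>+s\<in>{0<..t}. u (s, \<omega>) \<partial>N \<omega>) x) \<in> borel_measurable Pr"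
    using mult by (intro borel_measurable_times_ennreal borel_measurable_const)
  also have "?this \<longleftrightarrow> (\<lambda>(t, \<omega>). \<integral>\<^sup>+s\<in>{0<..t}. c * u (s, \<omega>) \<partial>N \<omega>) \<in> borel_measurable Pr"
  proof (rule measurable_cong)
    fix x assume "x \<in> space Pr"
    then obtain t \<omega> where x: "x = (t, \<omega>)" "t \<in> {0..T}" "\<omega> \<in> space M" by auto
    have sN: "sets (N \<omega>) = sets borel" using N x by (simp add: predictable_kernel_def)
    have "(\<lambda>s. u (s, \<omega>) * indicator {0<..t} s) \<in> borel_measurable (N \<omega>)"
      using path_indicator_borel[OF mult(2), of \<omega> t] x by (simp add: sN cong: measurable_cong_sets)
    from nn_integral_cmult[OF this, of c]
    show "c * (\<lambda>(t, \<omega>). \<integral>\<^sup>+s\<in>{0<..t}. u (s, \<omega>) \<partial>N \<omega>) x = (\<lambda>(t, \<omega>). \<integral>\<^sup>+s\<in>{0<..t}. c * u (s, \<omega>) \<partial>N \<omega>) x"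
      by (simp add: x mult.assoc)
  qed
  finally show ?case .
next
  case (add u v)
  have "(\<lambda>x. (\<lambda>(t, \<omega>). \<integral>\<^sup>+s\<in>{0<..t}. v (s, \<omega>) \<partial>N \<omega>) x + (\<lambda>(t, \<omega>). \<integral>\<^sup>+s\<in>{0<..t}. u (s, \<omega>) \<partial>N \<omega>) x) \<in> borel_measurable Pr"
    using add by (intro borel_measurable_add)
  also have "?this \<longleftrightarrow> (\<lambda>(t, \<omega>). \<integral>\<^sup>+s\<in>{0<..t}. v (s, \<omega>) + u (s, \<omega>) \<partial>N \<omega>) \<in> borel_measurable Pr"
  proof (rule measurable_cong)
    fix x assume "x \<in> space Pr"
    then obtain t \<omega> where x: "x = (t, \<omega>)" "t \<in> {0..T}" "\<omega> \<in> space M" by auto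
    have sN: "sets (N \<omega>) = sets borel" using N x by (simp add: predictable_kernel_def)
    have "(\<lambda>s. u (s, \<omega>) * indicator {0<..t} s) \<in> borel_measurable (N \<omega>)" "(\<lambda>s. v (s, \<omega>) * indicator {0<..t} s) \<in> borel_measurable (N \<omega>)"
      using path_indicator_borel[OF add(1), of \<omega> t] path_indicator_borel[OF add(4), of \<omega> t] x by (simp_all add: sN cong: measurable_cong_sets)
    from nn_integral_add[OF this(2,1)]
    show "(\<lambda>(t, \<omega>). \<integral>\<^sup>+s\<in>{0<..t}. v (s, \<omega>) \<partial>N \<omega>) x + (\<lambda>(t, \<omega>). \<integral>\<^sup>+s\<in>{0<..t}. u (s, \<omega>) \<partial>N \<omega>) x = (\<lambda>(t, \<omega>). \<integral>\<^sup>+s\<in>{0<..t}. v (s, \<omega>) + u (s, \<omega>) \<partial>N \<omega>) x"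
      by (simp add: x distrib_right)
  qed
  finally show ?case .
next
  case (seq U)
  have "(\<lambda>x. SUP i. (\<lambda>(t, \<omega>). \<integral>\<^sup>+s\<in>{0<..t}. U i (s, \<omega>) \<partial>N \<omega>) x) \<in> borel_measurable Pr"
    using seq by (intro borel_measurable_SUP) auto
  also have "?this \<longleftrightarrow> (\<lambda>(t, \<omega>). \<integral>\<^sup>+s\<in>{0<..t}. (SUP i. U i) (s, \<omega>) \<partial>N \<omega>) \<in> borel_measurable Pr"
  proof (rule measurable_cong)
    fix x assume "x \<in> space Pr"
    then obtain t \<omega> where x: "x = (t, \<omega>)" "t \<in> {0..T}" "\<omega> \<in> space M" by auto
    have sN: "sets (N \<omega>) = sets borel" using N x by (simp add: predictable_kernel_def)
    have m: "(\<lambda>s. U i (s, \<omega>) * indicator {0<..t} s) \<in> borel_measurable (N \<omega>)" for i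
      using path_indicator_borel[OF seq(1), of \<omega> t i] x by (simp add: sN cong: measurable_cong_sets)
    have inc: "incseq (\<lambda>i s. U i (s, \<omega>) * indicator {0<..t} s)"
      using seq(4) by (auto simp: incseq_def le_fun_def intro!: mult_right_mono)
    have "(\<integral>\<^sup>+s\<in>{0<..t}. (SUP i. U i) (s, \<omega>) \<partial>N \<omega>) = (\<integral>\<^sup>+s. (SUP i. U i (s, \<omega>) * indicator {0<..t} s) \<partial>N \<omega>)"
      by (rule nn_integral_cong) (simp add: SUP_mult_right_ennreal image_comp)
    also have "\<dots> = (SUP i. \<integral>\<^sup>+s\<in>{0<..t}. U i (s, \<omega>) \<partial>N \<omega>)"
      by (rule nn_integral_monotone_convergence_SUP[OF inc m])
    finally show "(SUP i. (\<lambda>(t, \<omega>). \<integral>\<^sup>+s\<in>{0<..t}. U i (s, \<omega>) \<partial>N \<omega>) x) = (\<lambda>(t, \<omega>). \<integral>\<^sup>+s\<in>{0<..t}. (SUP i. U i) (s, \<omega>) \<partial>N \<omega>) x"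
      by (simp add: x)
  qed
  finally show ?case .
qed

lemma kernel_integral_T_measurable:
  fixes h :: "real \<times> 'a \<Rightarrow> ennreal"
  assumes N: "predictable_kernel N" and h: "h \<in> borel_measurable Pr"
  shows "(\<lambda>\<omega>. \<integral>\<^sup>+s\<in>{0<..T}. h (s, \<omega>) \<partial>N \<omega>) \<in> borel_measurable Mc"
  using measurable_F_Mc[OF order_refl measurable_compose[OF measurable_Pr_section[of T] kernel_integral_predictable[OF assms]]] T_pos
  by simp

end

section \<open>Continuous versions of Brownian martingales\<close>

context brownian_setting
begin

interpretation Mc: prob_space Mc by (rule prob_space_Mc)

lemma bounded_integrable_Mc:
  fixes X :: "'a \<Rightarrow> real"
  assumes "X \<in> borel_measurable Mc" "\<And>\<omega>. \<omega> \<in> space M \<Longrightarrow> \<bar>X \<omega>\<bar> \<le> C"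
  shows "integrable Mc X"
  by (rule Mc.integrable_const_bound[where B=C]) (use assms in \<open>auto intro!: AE_I2\<close>)

lemma set_bounded_integrable_Mc:
  fixes X :: "'a \<Rightarrow> real"
  assumes "X \<in> borel_measurable Mc" "\<And>\<omega>. \<omega> \<in> space M \<Longrightarrow> \<bar>X \<omega>\<bar> \<le> C" "S \<in> sets Mc"
  shows "integrable Mc (\<lambda>\<omega>. indicator S \<omega> * X \<omega>)"
  using integrable_real_mult_indicator[OF assms(3) bounded_integrable_Mc[OF assms(1,2)]]
  by (simp add: mult.commute)

text \<open>An elementary form of \<open>Q t = E[\<xi> | F t]\<close>, with the defining identity
  tested on the sets of \<open>F t\<close>. Continuity and the bound are demanded at every sample
  point, which the null sets in \<open>F 0\<close> make attainable.\<close>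

definition martingale_version :: "('a \<Rightarrow> real) \<Rightarrow> (real \<Rightarrow> 'a \<Rightarrow> real) \<Rightarrow> real \<Rightarrow> bool" where
  "martingale_version \<xi> Q C \<longleftrightarrow>
     (\<forall>t\<in>{0..T}. Q t \<in> borel_measurable (F t)) \<and>
     (\<forall>\<omega>\<in>space M. continuous_on {0..T} (\<lambda>t. Q t \<omega>)) \<and>
     (\<forall>t\<in>{0..T}. \<forall>\<omega>\<in>space M. \<bar>Q t \<omega>\<bar> \<le> C) \<and>
     (\<forall>t\<in>{0..T}. \<forall>S\<in>sets (F t). (\<integral>\<omega>. indicator S \<omega> * Q t \<omega> \<partial>Mc) = (\<integral>\<omega>. indicator S \<omega> * \<xi> \<omega> \<partial>Mc))"

lemma martingale_versionD:
  assumes "martingale_version \<xi> Q C"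
  shows "t \<in> {0..T} \<Longrightarrow> Q t \<in> borel_measurable (F t)"
    and "\<omega> \<in> space M \<Longrightarrow> continuous_on {0..T} (\<lambda>t. Q t \<omega>)"
    and "t \<in> {0..T} \<Longrightarrow> \<omega> \<in> space M \<Longrightarrow> \<bar>Q t \<omega>\<bar> \<le> C"
    and "t \<in> {0..T} \<Longrightarrow> S \<in> sets (F t) \<Longrightarrow> (\<integral>\<omega>. indicator S \<omega> * Q t \<omega> \<partial>Mc) = (\<integral>\<omega>. indicator S \<omega> * \<xi> \<omega> \<partial>Mc)"
    and "t \<in> {0..T} \<Longrightarrow> Q t \<in> borel_measurable Mc"
proof -
  show *: "t \<in> {0..T} \<Longrightarrow> Q t \<in> borel_measurable (F t)"
    using assms unfolding martingale_version_def by blast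
  show "\<omega> \<in> space M \<Longrightarrow> continuous_on {0..T} (\<lambda>t. Q t \<omega>)"
    using assms unfolding martingale_version_def by blast
  show "t \<in> {0..T} \<Longrightarrow> \<omega> \<in> space M \<Longrightarrow> \<bar>Q t \<omega>\<bar> \<le> C"
    using assms unfolding martingale_version_def by blast
  show "t \<in> {0..T} \<Longrightarrow> S \<in> sets (F t) \<Longrightarrow> (\<integral>\<omega>. indicator S \<omega> * Q t \<omega> \<partial>Mc) = (\<integral>\<omega>. indicator S \<omega> * \<xi> \<omega> \<partial>Mc)"
    using assms unfolding martingale_version_def by blast
  show "Q t \<in> borel_measurable Mc" if t: "t \<in> {0..T}"
    by (rule measurable_F_Mc[OF _ *[OF t]]) (use t in simp)
qed

lemma martingale_version_lin:
  assumes 1: "martingale_version \<xi>1 Q1 C1" and 2: "martingale_version \<xi>2 Q2 C2"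
    and \<xi>: "\<xi>1 \<in> borel_measurable Mc" "\<xi>2 \<in> borel_measurable Mc"
      "\<And>\<omega>. \<omega> \<in> space M \<Longrightarrow> \<bar>\<xi>1 \<omega>\<bar> \<le> D" "\<And>\<omega>. \<omega> \<in> space M \<Longrightarrow> \<bar>\<xi>2 \<omega>\<bar> \<le> D'"
  shows "martingale_version (\<lambda>\<omega>. a * \<xi>1 \<omega> + b * \<xi>2 \<omega>) (\<lambda>t \<omega>. a * Q1 t \<omega> + b * Q2 t \<omega>) (\<bar>a\<bar> * C1 + \<bar>b\<bar> * C2)"
  unfolding martingale_version_def
proof (intro conjI ballI)
  fix t assume t: "t \<in> {0..T}"
  show "(\<lambda>\<omega>. a * Q1 t \<omega> + b * Q2 t \<omega>) \<in> borel_measurable (F t)"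
    using martingale_versionD(1)[OF 1 t] martingale_versionD(1)[OF 2 t] by measurable
  show "\<bar>a * Q1 t \<omega> + b * Q2 t \<omega>\<bar> \<le> \<bar>a\<bar> * C1 + \<bar>b\<bar> * C2" if "\<omega> \<in> space M" for \<omega>
  proof -
    have "\<bar>a * Q1 t \<omega> + b * Q2 t \<omega>\<bar> \<le> \<bar>a * Q1 t \<omega>\<bar> + \<bar>b * Q2 t \<omega>\<bar>" by (rule abs_triangle_ineq)
    also have "\<dots> \<le> \<bar>a\<bar> * C1 + \<bar>b\<bar> * C2"
      unfolding abs_mult using martingale_versionD(3)[OF 1 t that] martingale_versionD(3)[OF 2 t that]
      by (intro add_mono mult_left_mono) auto
    finally show ?thesis .
  qed
  fix S assume S: "S \<in> sets (F t)"
  then have S': "S \<in> sets Mc" using sets_F_Mc[of t] t by auto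
  note i1 = set_bounded_integrable_Mc[OF martingale_versionD(5)[OF 1 t] martingale_versionD(3)[OF 1 t] S']
  note i2 = set_bounded_integrable_Mc[OF martingale_versionD(5)[OF 2 t] martingale_versionD(3)[OF 2 t] S']
  note i3 = set_bounded_integrable_Mc[OF \<xi>(1,3) S']
  note i4 = set_bounded_integrable_Mc[OF \<xi>(2,4) S']
  have "(\<integral>\<omega>. indicator S \<omega> * (a * Q1 t \<omega> + b * Q2 t \<omega>) \<partial>Mc) =
      (\<integral>\<omega>. a * (indicator S \<omega> * Q1 t \<omega>) + b * (indicator S \<omega> * Q2 t \<omega>) \<partial>Mc)"
    by (simp add: algebra_simps)
  also have "\<dots> = a * (\<integral>\<omega>. indicator S \<omega> * Q1 t \<omega> \<partial>Mc) + b * (\<integral>\<omega>. indicator S \<omega> * Q2 t \<omega> \<partial>Mc)"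
    using i1 i2 by simp
  also have "\<dots> = a * (\<integral>\<omega>. indicator S \<omega> * \<xi>1 \<omega> \<partial>Mc) + b * (\<integral>\<omega>. indicator S \<omega> * \<xi>2 \<omega> \<partial>Mc)"
    by (simp only: martingale_versionD(4)[OF 1 t S] martingale_versionD(4)[OF 2 t S])
  also have "\<dots> = (\<integral>\<omega>. a * (indicator S \<omega> * \<xi>1 \<omega>) + b * (indicator S \<omega> * \<xi>2 \<omega>) \<partial>Mc)"
    using i3 i4 by simp
  also have "\<dots> = (\<integral>\<omega>. indicator S \<omega> * (a * \<xi>1 \<omega> + b * \<xi>2 \<omega>) \<partial>Mc)"
    by (simp add: algebra_simps)
  finally show "(\<integral>\<omega>. indicator S \<omega> * (a * Q1 t \<omega> + b * Q2 t \<omega>) \<partial>Mc) =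
      (\<integral>\<omega>. indicator S \<omega> * (a * \<xi>1 \<omega> + b * \<xi>2 \<omega>) \<partial>Mc)" .
next
  fix \<omega> assume "\<omega> \<in> space M"
  then show "continuous_on {0..T} (\<lambda>t. a * Q1 t \<omega> + b * Q2 t \<omega>)"
    using martingale_versionD(2)[OF 1] martingale_versionD(2)[OF 2] by (intro continuous_intros) auto
qed

section \<open>Doob's maximal inequality for continuous bounded martingales\<close>

definition rat_times :: "real set" where "rat_times = {0<..<T} \<inter> \<rat>"

lemma rat_times: "countable rat_times" "rat_times \<noteq> {}" "rat_times \<subseteq> {0..T}"
proof -
  show "countable rat_times" unfolding rat_times_def using countable_rat by (rule countable_Int2)
  obtain q where "q \<in> \<rat>" "0 < q" "q < T" using Rats_dense_in_real[OF T_pos] by auto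
  then show "rat_times \<noteq> {}" unfolding rat_times_def by auto
  show "rat_times \<subseteq> {0..T}" unfolding rat_times_def by auto
qed

lemma closure_rat_times: "closure rat_times = {0..T}"
proof -
  have "closure ({0<..<T} \<inter> \<rat>) = closure {0<..<T}"
    by (rule closure_open_Int_superset) (auto simp: Rats_closure_real)
  then show ?thesis unfolding rat_times_def using T_pos by simp
qed

lemma rat_times_le:
  fixes f :: "real \<Rightarrow> real"
  assumes "continuous_on {0..T} f" "\<And>q. q \<in> rat_times \<Longrightarrow> f q \<le> c" "t \<in> {0..T}"
  shows "f t \<le> c"
  using continuous_le_on_closure[of rat_times f t c] assms closure_rat_times by auto

text \<open>Jensen's inequality for the absolute value, obtained by splitting A according to the
  sign of \<open>R t\<close>: both pieces belong to \<open>F t\<close>, so \<zeta> may replace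
  \<open>R t\<close> in the integral over each.\<close>

lemma abs_martingale_le:
  assumes R: "martingale_version \<zeta> R C" and \<zeta>: "\<zeta> \<in> borel_measurable Mc" "\<And>\<omega>. \<omega> \<in> space M \<Longrightarrow> \<bar>\<zeta> \<omega>\<bar> \<le> D"
    and t: "t \<in> {0..T}" and A: "A \<in> sets (F t)"
  shows "(\<integral>\<omega>. indicator A \<omega> * \<bar>R t \<omega>\<bar> \<partial>Mc) \<le> (\<integral>\<omega>. indicator A \<omega> * \<bar>\<zeta> \<omega>\<bar> \<partial>Mc)"
proof -
  have Rt: "R t \<in> borel_measurable (F t)" by (rule martingale_versionD(1)[OF R t])
  define P where "P = A \<inter> {\<omega> \<in> space (F t). 0 \<le> R t \<omega>}"
  define N where "N = A \<inter> {\<omega> \<in> space (F t). R t \<omega> < 0}"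
  have PN: "P \<in> sets (F t)" "N \<in> sets (F t)" unfolding P_def N_def using A Rt by measurable
  have M: "A \<in> sets Mc" "P \<in> sets Mc" "N \<in> sets Mc" using A PN sets_F_Mc[of t] t by auto
  have As: "A \<subseteq> space M" using sets.sets_into_space[OF A] by simp
  note iR = set_bounded_integrable_Mc[OF martingale_versionD(5)[OF R t] martingale_versionD(3)[OF R t]]
  note iz = set_bounded_integrable_Mc[OF \<zeta>]
  have iza: "integrable Mc (\<lambda>\<omega>. indicator A \<omega> * \<bar>\<zeta> \<omega>\<bar>)"
    by (rule set_bounded_integrable_Mc[where C=D]) (use \<zeta> M in auto)
  have "(\<integral>\<omega>. indicator A \<omega> * \<bar>R t \<omega>\<bar> \<partial>Mc) = (\<integral>\<omega>. indicator P \<omega> * R t \<omega> - indicator N \<omega> * R t \<omega> \<partial>Mc)"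
    by (rule Bochner_Integration.integral_cong) (auto simp: P_def N_def indicator_def)
  also have "\<dots> = (\<integral>\<omega>. indicator P \<omega> * R t \<omega> \<partial>Mc) - (\<integral>\<omega>. indicator N \<omega> * R t \<omega> \<partial>Mc)"
    using iR M by (intro Bochner_Integration.integral_diff) auto
  also have "\<dots> = (\<integral>\<omega>. indicator P \<omega> * \<zeta> \<omega> \<partial>Mc) - (\<integral>\<omega>. indicator N \<omega> * \<zeta> \<omega> \<partial>Mc)"
    by (simp only: martingale_versionD(4)[OF R t PN(1)] martingale_versionD(4)[OF R t PN(2)])
  also have "\<dots> = (\<integral>\<omega>. indicator P \<omega> * \<zeta> \<omega> - indicator N \<omega> * \<zeta> \<omega> \<partial>Mc)"
    using iz M by (intro Bochner_Integration.integral_diff[symmetric]) auto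
  also have "\<dots> \<le> (\<integral>\<omega>. indicator A \<omega> * \<bar>\<zeta> \<omega>\<bar> \<partial>Mc)"
  proof (rule integral_mono)
    show "integrable Mc (\<lambda>\<omega>. indicator P \<omega> * \<zeta> \<omega> - indicator N \<omega> * \<zeta> \<omega>)"
      using iz M by (intro Bochner_Integration.integrable_diff) auto
  qed (use iza in \<open>auto simp: P_def N_def indicator_def\<close>)
  finally show ?thesis .
qed

text \<open>Decompose by the first time t of G at which the level is exceeded. That event belongs to
  \<open>F t\<close>, so on it the level is charged to the terminal variable, and the events are
  disjoint.\<close>

lemma Doob_maximal_finite:
  assumes R: "martingale_version \<zeta> R C" and \<zeta>: "\<zeta> \<in> borel_measurable Mc" "\<And>\<omega>. \<omega> \<in> space M \<Longrightarrow> \<bar>\<zeta> \<omega>\<bar> \<le> D"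
    and c: "0 < c" and G: "finite G" "G \<subseteq> {0..T}"
  shows "c * measure Mc {\<omega> \<in> space M. \<exists>t\<in>G. c < \<bar>R t \<omega>\<bar>} \<le> (\<integral>\<omega>. \<bar>\<zeta> \<omega>\<bar> \<partial>Mc)"
proof -
  define A where "A t = {\<omega> \<in> space M. c < \<bar>R t \<omega>\<bar> \<and> (\<forall>s\<in>G. s < t \<longrightarrow> \<bar>R s \<omega>\<bar> \<le> c)}" for t
  have AF: "A t \<in> sets (F t)" if t: "t \<in> G" for t
  proof -
    have t': "t \<in> {0..T}" using t G by auto
    have "{\<omega> \<in> space (F t). c < \<bar>R t \<omega>\<bar>} \<in> sets (F t)"
      using martingale_versionD(1)[OF R t'] by measurable
    moreover have "{\<omega> \<in> space (F t). \<forall>s\<in>{s\<in>G. s < t}. \<bar>R s \<omega>\<bar> \<le> c} \<in> sets (F t)"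
    proof (rule sets.sets_Collect_finite_All)
      fix s assume "s \<in> {s\<in>G. s < t}"
      then have "R s \<in> borel_measurable (F t)"
        using G martingale_versionD(1)[OF R, of s] by (intro measurable_F_mono[of s t]) auto
      then show "{\<omega> \<in> space (F t). \<bar>R s \<omega>\<bar> \<le> c} \<in> sets (F t)" by measurable
    qed (use G in auto)
    moreover have "A t = {\<omega> \<in> space (F t). c < \<bar>R t \<omega>\<bar>} \<inter> {\<omega> \<in> space (F t). \<forall>s\<in>{s\<in>G. s < t}. \<bar>R s \<omega>\<bar> \<le> c}"
      by (auto simp: A_def)
    ultimately show ?thesis by auto
  qed
  have AM: "A t \<in> sets Mc" if "t \<in> G" for t
  proof -
    have "t \<le> T" using that G by auto
    then show ?thesis using AF[OF that] sets_F_Mc by blast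
  qed
  have disj: "disjoint_family_on A G"
    unfolding disjoint_family_on_def
  proof (intro ballI impI)
    fix s t assume st: "s \<in> G" "t \<in> G" "s \<noteq> t"
    then consider "s < t" | "t < s" by linarith
    then show "A s \<inter> A t = {}" using st by cases (auto simp: A_def)
  qed
  have un: "{\<omega> \<in> space M. \<exists>t\<in>G. c < \<bar>R t \<omega>\<bar>} = (\<Union>t\<in>G. A t)"
  proof (intro set_eqI iffI)
    fix \<omega> assume "\<omega> \<in> {\<omega> \<in> space M. \<exists>t\<in>G. c < \<bar>R t \<omega>\<bar>}"
    then have \<omega>: "\<omega> \<in> space M" and ne: "{t\<in>G. c < \<bar>R t \<omega>\<bar>} \<noteq> {}" by auto
    let ?m = "Min {t\<in>G. c < \<bar>R t \<omega>\<bar>}"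
    have m: "?m \<in> {t\<in>G. c < \<bar>R t \<omega>\<bar>}" using G(1) ne by (intro Min_in) auto
    have "\<bar>R s \<omega>\<bar> \<le> c" if "s \<in> G" "s < ?m" for s
    proof (rule ccontr)
      assume "\<not> \<bar>R s \<omega>\<bar> \<le> c"
      then have "?m \<le> s" using G(1) that(1) by (intro Min_le) auto
      then show False using that(2) by simp
    qed
    then show "\<omega> \<in> (\<Union>t\<in>G. A t)" using m \<omega> unfolding A_def by blast
  qed (auto simp: A_def)
  have mult: "c * measure Mc (A t) \<le> (\<integral>\<omega>. indicator (A t) \<omega> * \<bar>\<zeta> \<omega>\<bar> \<partial>Mc)" if t: "t \<in> G" for t
  proof -
    have t': "t \<in> {0..T}" using t G by auto
    have "c * measure Mc (A t) = (\<integral>\<omega>. c * indicator (A t) \<omega> \<partial>Mc)"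
      using AM[OF t] sets.sets_into_space[OF AM[OF t]] by (simp add: Int_absorb2)
    also have "\<dots> \<le> (\<integral>\<omega>. indicator (A t) \<omega> * \<bar>R t \<omega>\<bar> \<partial>Mc)"
    proof (rule integral_mono)
      show "integrable Mc (\<lambda>\<omega>. c * indicator (A t) \<omega>)"
        by (rule bounded_integrable_Mc[where C=c]) (use AM[OF t] c in \<open>auto simp: indicator_def\<close>)
      show "integrable Mc (\<lambda>\<omega>. indicator (A t) \<omega> * \<bar>R t \<omega>\<bar>)"
        using martingale_versionD(3)[OF R t'] martingale_versionD(5)[OF R t'] AM[OF t]
        by (intro set_bounded_integrable_Mc[where C=C]) auto
    qed (auto simp: A_def indicator_def)
    also have "\<dots> \<le> (\<integral>\<omega>. indicator (A t) \<omega> * \<bar>\<zeta> \<omega>\<bar> \<partial>Mc)"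
      by (rule abs_martingale_le[OF R \<zeta> t' AF[OF t]])
    finally show ?thesis .
  qed
  have "measure Mc (\<Union>t\<in>G. A t) = (\<Sum>t\<in>G. measure Mc (A t))"
    using AM disj by (intro Mc.finite_measure_finite_Union G(1)) auto
  then have "c * measure Mc {\<omega> \<in> space M. \<exists>t\<in>G. c < \<bar>R t \<omega>\<bar>} = (\<Sum>t\<in>G. c * measure Mc (A t))"
    unfolding un by (simp add: sum_distrib_left)
  also have "\<dots> \<le> (\<Sum>t\<in>G. (\<integral>\<omega>. indicator (A t) \<omega> * \<bar>\<zeta> \<omega>\<bar> \<partial>Mc))"
    by (rule sum_mono) (rule mult)
  also have "\<dots> = (\<integral>\<omega>. (\<Sum>t\<in>G. indicator (A t) \<omega> * \<bar>\<zeta> \<omega>\<bar>) \<partial>Mc)"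
    by (rule Bochner_Integration.integral_sum[symmetric])
      (rule set_bounded_integrable_Mc[where C=D], use \<zeta> AM in auto)
  also have "\<dots> \<le> (\<integral>\<omega>. \<bar>\<zeta> \<omega>\<bar> \<partial>Mc)"
  proof (rule integral_mono)
    show "integrable Mc (\<lambda>\<omega>. \<Sum>t\<in>G. indicator (A t) \<omega> * \<bar>\<zeta> \<omega>\<bar>)"
      by (rule Bochner_Integration.integrable_sum) (rule set_bounded_integrable_Mc[where C=D], use \<zeta> AM in auto)
    show "integrable Mc (\<lambda>\<omega>. \<bar>\<zeta> \<omega>\<bar>)"
      by (rule bounded_integrable_Mc[where C=D]) (use \<zeta> in auto)
    fix \<omega>
    have "(\<Sum>t\<in>G. indicator (A t) \<omega> :: real) = indicator (\<Union>t\<in>G. A t) \<omega>"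
      by (rule indicator_UN_disjoint[symmetric, OF G(1) disj])
    then have "(\<Sum>t\<in>G. indicator (A t) \<omega> * \<bar>\<zeta> \<omega>\<bar>) = indicator (\<Union>t\<in>G. A t) \<omega> * \<bar>\<zeta> \<omega>\<bar>"
      by (simp add: sum_distrib_right[symmetric])
    then show "(\<Sum>t\<in>G. indicator (A t) \<omega> * \<bar>\<zeta> \<omega>\<bar>) \<le> \<bar>\<zeta> \<omega>\<bar>"
      by (simp add: indicator_def)
  qed
  finally show ?thesis .
qed

text \<open>The finite case for growing sets of rational times. The strict inequality makes
  exceedance an open condition along a continuous path, so an exceedance at some time entails one at
  a rational time.\<close>

lemma Doob_maximal:
  assumes R: "martingale_version \<zeta> R C" and \<zeta>: "\<zeta> \<in> borel_measurable Mc" "\<And>\<omega>. \<omega> \<in> space M \<Longrightarrow> \<bar>\<zeta> \<omega>\<bar> \<le> D"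
    and c: "0 < c"
  defines "E \<equiv> {\<omega> \<in> space M. \<exists>t\<in>{0..T}. c < \<bar>R t \<omega>\<bar>}"
  shows "E \<in> sets Mc" "c * measure Mc E \<le> (\<integral>\<omega>. \<bar>\<zeta> \<omega>\<bar> \<partial>Mc)"
proof -
  define q where "q = from_nat_into rat_times"
  have q: "range q = rat_times" unfolding q_def using rat_times by (simp add: range_from_nat_into)
  define A where "A n = {\<omega> \<in> space M. \<exists>t\<in>q ` {..<n}. c < \<bar>R t \<omega>\<bar>}" for n :: nat
  have qT: "q n \<in> {0..T}" for n
  proof -
    have "q n \<in> range q" by simp
    then show ?thesis using q rat_times(3) by auto
  qed
  have A_sets: "A n \<in> sets Mc" for n
  proof -
    have "{\<omega> \<in> space Mc. \<exists>t\<in>q ` {..<n}. c < \<bar>R t \<omega>\<bar>} \<in> sets Mc"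
    proof (rule sets.sets_Collect_finite_Ex)
      fix t assume "t \<in> q ` {..<n}"
      then have "R t \<in> borel_measurable Mc" using qT by (intro martingale_versionD(5)[OF R]) auto
      then show "{\<omega> \<in> space Mc. c < \<bar>R t \<omega>\<bar>} \<in> sets Mc" by measurable
    qed simp
    then show ?thesis by (simp add: A_def)
  qed
  have E: "E = (\<Union>n. A n)"
  proof (intro set_eqI iffI)
    fix \<omega> assume \<omega>: "\<omega> \<in> E"
    then obtain t where t: "t \<in> {0..T}" "c < \<bar>R t \<omega>\<bar>" "\<omega> \<in> space M" by (auto simp: E_def)
    have "continuous_on {0..T} (\<lambda>t. \<bar>R t \<omega>\<bar>)"
      using martingale_versionD(2)[OF R t(3)] by (intro continuous_intros)
    from rat_times_le[OF this _ t(1), of c] t(2) have "\<exists>r\<in>rat_times. c < \<bar>R r \<omega>\<bar>" by force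
    then obtain n where "c < \<bar>R (q n) \<omega>\<bar>" using q by (metis imageE)
    then have "\<omega> \<in> A (Suc n)" unfolding A_def using t(3) by auto
    then show "\<omega> \<in> (\<Union>n. A n)" by blast
  qed (use qT in \<open>auto simp: E_def A_def\<close>)
  show "E \<in> sets Mc" unfolding E using A_sets by auto
  have "incseq A" unfolding incseq_def A_def by force
  then have "(\<lambda>n. measure Mc (A n)) \<longlonglongrightarrow> measure Mc E"
    unfolding E using A_sets by (intro Mc.finite_Lim_measure_incseq) auto
  then have "(\<lambda>n. c * measure Mc (A n)) \<longlonglongrightarrow> c * measure Mc E" by (rule tendsto_mult_left)
  then show "c * measure Mc E \<le> (\<integral>\<omega>. \<bar>\<zeta> \<omega>\<bar> \<partial>Mc)"
  proof (rule LIMSEQ_le_const2, intro exI[of _ 0] allI impI)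
    fix n
    show "c * measure Mc (A n) \<le> (\<integral>\<omega>. \<bar>\<zeta> \<omega>\<bar> \<partial>Mc)"
      unfolding A_def by (rule Doob_maximal_finite[OF R \<zeta> c]) (use qT in auto)
  qed
qed

section \<open>Modifications and limits of continuous martingales\<close>

lemma martingale_version_modify:
  assumes Q: "martingale_version \<xi> Q C"
    and N: "N \<in> null_sets Mc"
    and eq: "\<And>\<omega> t. \<omega> \<in> space M - N \<Longrightarrow> t \<in> {0..T} \<Longrightarrow> Q' t \<omega> = Q t \<omega>"
    and cont: "\<And>\<omega>. \<omega> \<in> space M \<Longrightarrow> continuous_on {0..T} (\<lambda>t. Q' t \<omega>)"
    and bd: "\<And>\<omega> t. \<omega> \<in> space M \<Longrightarrow> t \<in> {0..T} \<Longrightarrow> \<bar>Q' t \<omega>\<bar> \<le> C'"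
    and \<xi>: "AE \<omega> in Mc. \<xi>' \<omega> = \<xi> \<omega>" "\<xi> \<in> borel_measurable Mc" "\<xi>' \<in> borel_measurable Mc"
  shows "martingale_version \<xi>' Q' C'"
  unfolding martingale_version_def
proof (intro conjI ballI)
  fix t assume t: "t \<in> {0..T}"
  show Q': "Q' t \<in> borel_measurable (F t)"
    by (rule measurable_F_null_cong[OF martingale_versionD(1)[OF Q t] N]) (rule eq, use t in auto)
  fix S assume S: "S \<in> sets (F t)"
  then have S': "S \<in> sets Mc" using sets_F_Mc[of t] t by auto
  have ae: "AE \<omega> in Mc. \<omega> \<notin> N" using N by (rule AE_not_in)
  have ae2: "AE \<omega> in Mc. indicator S \<omega> * Q' t \<omega> = indicator S \<omega> * Q t \<omega>"
    using ae AE_space by eventually_elim (use eq t in auto)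
  have "(\<integral>\<omega>. indicator S \<omega> * Q' t \<omega> \<partial>Mc) = (\<integral>\<omega>. indicator S \<omega> * Q t \<omega> \<partial>Mc)"
    using S' measurable_F_Mc[OF _ Q'] martingale_versionD(5)[OF Q t] t ae2
    by (intro integral_cong_AE) auto
  also have "\<dots> = (\<integral>\<omega>. indicator S \<omega> * \<xi> \<omega> \<partial>Mc)" by (rule martingale_versionD(4)[OF Q t S])
  also have "\<dots> = (\<integral>\<omega>. indicator S \<omega> * \<xi>' \<omega> \<partial>Mc)"
    using S' \<xi> by (intro integral_cong_AE) auto
  finally show "(\<integral>\<omega>. indicator S \<omega> * Q' t \<omega> \<partial>Mc) = (\<integral>\<omega>. indicator S \<omega> * \<xi>' \<omega> \<partial>Mc)" .
qed (use cont bd in auto)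

text \<open>Testing against the set where \<open>Q t\<close> is negative, which lies in
  \<open>F t\<close>, settles each fixed t; continuity extends the result from the rational times to
  all times simultaneously.\<close>

lemma martingale_nonneg:
  assumes Q: "martingale_version \<xi> Q C" and \<xi>: "\<xi> \<in> borel_measurable Mc" "\<And>\<omega>. \<omega> \<in> space M \<Longrightarrow> 0 \<le> \<xi> \<omega>"
  shows "AE \<omega> in Mc. \<forall>t\<in>{0..T}. 0 \<le> Q t \<omega>"
proof -
  have "AE \<omega> in Mc. 0 \<le> Q t \<omega>" if t: "t \<in> {0..T}" for t
  proof -
    define S where "S = {\<omega> \<in> space (F t). Q t \<omega> < 0}"
    have S: "S \<in> sets (F t)" unfolding S_def using martingale_versionD(1)[OF Q t] by measurable
    then have S': "S \<in> sets Mc" using sets_F_Mc[of t] t by auto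
    have i: "integrable Mc (\<lambda>\<omega>. indicator S \<omega> * Q t \<omega>)"
      by (rule set_bounded_integrable_Mc[OF martingale_versionD(5)[OF Q t] martingale_versionD(3)[OF Q t] S'])
    have "0 \<le> (\<integral>\<omega>. indicator S \<omega> * \<xi> \<omega> \<partial>Mc)" using \<xi> by (intro Bochner_Integration.integral_nonneg_AE AE_I2) auto
    then have "0 \<le> (\<integral>\<omega>. indicator S \<omega> * Q t \<omega> \<partial>Mc)" using martingale_versionD(4)[OF Q t S] by simp
    then have "(\<integral>\<omega>. - (indicator S \<omega> * Q t \<omega>) \<partial>Mc) \<le> 0" by simp
    moreover have nn: "AE \<omega> in Mc. 0 \<le> - (indicator S \<omega> * Q t \<omega>)"
      by (rule AE_I2) (auto simp: S_def indicator_def)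
    ultimately have "(\<integral>\<omega>. - (indicator S \<omega> * Q t \<omega>) \<partial>Mc) = 0"
      using Bochner_Integration.integral_nonneg_AE[OF nn] by linarith
    then have "AE \<omega> in Mc. - (indicator S \<omega> * Q t \<omega>) = 0"
      using integral_nonneg_eq_0_iff_AE[OF _ nn] i by simp
    then show ?thesis using AE_space
      by eventually_elim (auto simp: S_def indicator_def split: if_splits)
  qed
  then have "AE \<omega> in Mc. \<forall>t\<in>rat_times. 0 \<le> Q t \<omega>"
    by (intro AE_ball_countable') (use rat_times in auto)
  then show ?thesis using AE_space
  proof eventually_elim
    case (elim \<omega>)
    have "continuous_on {0..T} (\<lambda>t. - Q t \<omega>)"
      using martingale_versionD(2)[OF Q] elim by (intro continuous_intros) auto
    then have "- Q t \<omega> \<le> 0" if "t \<in> {0..T}" for t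
      by (rule rat_times_le[OF _ _ that]) (use elim in auto)
    then show ?case by auto
  qed
qed

lemma martingale_version_const: "martingale_version (\<lambda>_. c) (\<lambda>_ _. c) \<bar>c\<bar>"
  by (auto simp: martingale_version_def)

definition has_martingale :: "('a \<Rightarrow> real) \<Rightarrow> bool" where
  "has_martingale \<xi> \<longleftrightarrow> (\<exists>Q C. martingale_version \<xi> Q C)"

text \<open>Q and 1 - Q are nonnegative off a null set, where clipping changes nothing; on the null
  set clipping enforces the range. All members of an approximating sequence then share one
  bound.\<close>

lemma martingale_clip:
  assumes Q: "has_martingale \<xi>" and \<xi>: "\<xi> \<in> borel_measurable Mc" "\<And>\<omega>. \<omega> \<in> space M \<Longrightarrow> \<xi> \<omega> \<in> {0..1}"
  obtains Q where "martingale_version \<xi> Q 1" "\<And>t \<omega>. Q t \<omega> \<in> {0..1}"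
proof -
  obtain Q C where Q: "martingale_version \<xi> Q C" using Q by (auto simp: has_martingale_def)
  have "martingale_version (\<lambda>\<omega>. 1 * (\<lambda>_. 1) \<omega> + (-1) * \<xi> \<omega>) (\<lambda>t \<omega>. 1 * (\<lambda>_ _. 1) t \<omega> + (-1) * Q t \<omega>) (\<bar>1\<bar> * \<bar>1\<bar> + \<bar>-1\<bar> * C)"
    by (rule martingale_version_lin[OF martingale_version_const Q, where D=1 and D'=1]) (use \<xi> in \<open>auto simp: abs_le_iff\<close>)
  then have Q2: "martingale_version (\<lambda>\<omega>. 1 - \<xi> \<omega>) (\<lambda>t \<omega>. 1 - Q t \<omega>) (1 + C)" by simp
  have "AE \<omega> in Mc. \<forall>t\<in>{0..T}. 0 \<le> Q t \<omega>" by (rule martingale_nonneg[OF Q]) (use \<xi> in auto)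
  moreover have "AE \<omega> in Mc. \<forall>t\<in>{0..T}. 0 \<le> 1 - Q t \<omega>" by (rule martingale_nonneg[OF Q2]) (use \<xi> in auto)
  ultimately have "AE \<omega> in Mc. \<forall>t\<in>{0..T}. Q t \<omega> \<in> {0..1}" by eventually_elim auto
  from AE_null_set_ex[OF this] obtain N where N: "N \<in> null_sets Mc" "\<And>\<omega>. \<omega> \<in> space M - N \<Longrightarrow> \<forall>t\<in>{0..T}. Q t \<omega> \<in> {0..1}"
    by blast
  show ?thesis
  proof (rule that)
    show "martingale_version \<xi> (\<lambda>t \<omega>. max 0 (min 1 (Q t \<omega>))) 1"
    proof (rule martingale_version_modify[OF Q N(1)])
      show "max 0 (min 1 (Q t \<omega>)) = Q t \<omega>" if "\<omega> \<in> space M - N" "t \<in> {0..T}" for \<omega> t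
        using N(2)[OF that(1)] that(2) by auto
      show "continuous_on {0..T} (\<lambda>t. max 0 (min 1 (Q t \<omega>)))" if "\<omega> \<in> space M" for \<omega>
        using martingale_versionD(2)[OF Q that] by (intro continuous_intros)
    qed (use \<xi> in auto)
  qed auto
qed

text \<open>Doob's inequality converts closeness in L1 of the terminal variables into uniform
  closeness of the paths. Along a fast subsequence Borel-Cantelli makes successive differences
  uniformly summable, so the limit is continuous.\<close>

lemma has_martingale_limit:
  assumes hm: "\<And>n::nat. has_martingale (\<xi>n n)"
    and \<xi>n: "\<And>n. \<xi>n n \<in> borel_measurable Mc" "\<And>n \<omega>. \<omega> \<in> space M \<Longrightarrow> \<xi>n n \<omega> \<in> {0..1}"
    and \<xi>: "\<xi> \<in> borel_measurable Mc" "\<And>\<omega>. \<omega> \<in> space M \<Longrightarrow> \<xi> \<omega> \<in> {0..1}"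
    and lim: "(\<lambda>n. \<integral>\<omega>. \<bar>\<xi>n n \<omega> - \<xi> \<omega>\<bar> \<partial>Mc) \<longlonglongrightarrow> 0"
  shows "has_martingale \<xi>"
proof -
  \<comment> \<open>The rate 4^-k is set against the level 2^-k in Doob's inequality below: the
    exceedance probabilities are then at most 2 * 2^-k, hence summable.\<close>
  have "\<exists>n. (\<integral>\<omega>. \<bar>\<xi>n n \<omega> - \<xi> \<omega>\<bar> \<partial>Mc) < (1/4) ^ k" for k :: nat
    using order_tendstoD(2)[OF lim, of "(1/4)^k"] by (auto simp: eventually_sequentially)
  then obtain r where r: "\<And>k::nat. (\<integral>\<omega>. \<bar>\<xi>n (r k) \<omega> - \<xi> \<omega>\<bar> \<partial>Mc) < (1/4) ^ k" by metis
  have "\<exists>Q. martingale_version (\<xi>n (r k)) Q 1 \<and> (\<forall>t \<omega>. Q t \<omega> \<in> {0..1})" for k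
    using martingale_clip[OF hm \<xi>n] by metis
  then obtain Q where Q: "\<And>k. martingale_version (\<xi>n (r k)) (Q k) 1" "\<And>k t \<omega>. Q k t \<omega> \<in> {0..1}" by metis
  define R where "R k t \<omega> = Q (Suc k) t \<omega> - Q k t \<omega>" for k t \<omega>
  define \<zeta> where "\<zeta> k \<omega> = \<xi>n (r (Suc k)) \<omega> - \<xi>n (r k) \<omega>" for k \<omega>
  have R: "martingale_version (\<zeta> k) (R k) 2" for k
  proof -
    have "martingale_version (\<lambda>\<omega>. 1 * \<xi>n (r (Suc k)) \<omega> + (-1) * \<xi>n (r k) \<omega>) (\<lambda>t \<omega>. 1 * Q (Suc k) t \<omega> + (-1) * Q k t \<omega>) (\<bar>1\<bar> * 1 + \<bar>-1\<bar> * 1)"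
      by (rule martingale_version_lin[OF Q(1) Q(1), where D=1 and D'=1]) (use \<xi>n in \<open>auto simp: abs_le_iff intro: order_trans[of _ 0]\<close>)
    then show ?thesis unfolding R_def \<zeta>_def by simp
  qed
  have \<zeta>m: "\<zeta> k \<in> borel_measurable Mc" for k unfolding \<zeta>_def using \<xi>n by measurable
  have \<zeta>b: "\<bar>\<zeta> k \<omega>\<bar> \<le> 1" if "\<omega> \<in> space M" for k \<omega>
    using \<xi>n(2)[OF that, of "r k"] \<xi>n(2)[OF that, of "r (Suc k)"] unfolding \<zeta>_def by auto
  have d: "\<bar>\<xi>n n \<omega> - \<xi> \<omega>\<bar> \<le> 1" if "\<omega> \<in> space M" for n \<omega>
    using \<xi>n(2)[OF that, of n] \<xi>(2)[OF that] by auto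
  have id: "integrable Mc (\<lambda>\<omega>. \<bar>\<xi>n n \<omega> - \<xi> \<omega>\<bar>)" for n
    by (rule bounded_integrable_Mc[where C=1]) (use d \<xi>n \<xi> in auto)
  have \<zeta>i: "(\<integral>\<omega>. \<bar>\<zeta> k \<omega>\<bar> \<partial>Mc) \<le> 2 * (1/4) ^ k" for k
  proof -
    have "(\<integral>\<omega>. \<bar>\<zeta> k \<omega>\<bar> \<partial>Mc) \<le> (\<integral>\<omega>. \<bar>\<xi>n (r (Suc k)) \<omega> - \<xi> \<omega>\<bar> + \<bar>\<xi>n (r k) \<omega> - \<xi> \<omega>\<bar> \<partial>Mc)"
    proof (rule integral_mono)
      show "integrable Mc (\<lambda>\<omega>. \<bar>\<zeta> k \<omega>\<bar>)"
        by (rule bounded_integrable_Mc[where C=1]) (use \<zeta>b \<zeta>m in auto)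
    qed (use id in \<open>auto simp: \<zeta>_def\<close>)
    also have "\<dots> \<le> (1/4) ^ Suc k + (1/4) ^ k"
      using r[of k] r[of "Suc k"] id by (subst Bochner_Integration.integral_add) auto
    also have "\<dots> \<le> 2 * (1/4) ^ k" by simp
    finally show ?thesis .
  qed
  define E where "E k = {\<omega> \<in> space M. \<exists>t\<in>{0..T}. (1/2) ^ k < \<bar>R k t \<omega>\<bar>}" for k
  have E: "E k \<in> sets Mc" "measure Mc (E k) \<le> 2 * (1/2) ^ k" for k
  proof -
    have p: "0 < (1/2 :: real) ^ k" by simp
    show "E k \<in> sets Mc" unfolding E_def by (rule Doob_maximal(1)[OF R \<zeta>m \<zeta>b p])
    have "(1/2) ^ k * measure Mc (E k) \<le> 2 * (1/4) ^ k"
      using Doob_maximal(2)[OF R \<zeta>m \<zeta>b p] \<zeta>i[of k] unfolding E_def by (rule order_trans)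
    also have "(2::real) * (1/4) ^ k = (1/2) ^ k * (2 * (1/2) ^ k)"
      by (simp add: power_mult_distrib[symmetric])
    finally show "measure Mc (E k) \<le> 2 * (1/2) ^ k" by simp
  qed
  have "AE \<omega> in Mc. eventually (\<lambda>k. \<omega> \<in> space Mc - E k) sequentially"
  proof (rule borel_cantelli_AE1)
    show "summable (\<lambda>k. measure Mc (E k))"
      by (rule summable_comparison_test'[where g="\<lambda>k. 2 * (1/2) ^ k"]) (use E in \<open>auto intro!: summable_mult summable_geometric\<close>)
  qed (use E in \<open>auto simp: less_top[symmetric]\<close>)
  from AE_null_set_ex[OF this] obtain N where N: "N \<in> null_sets Mc" "\<And>\<omega>. \<omega> \<in> space M - N \<Longrightarrow> eventually (\<lambda>k. \<omega> \<in> space Mc - E k) sequentially"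
    by blast
  \<comment> \<open>On N the value 0 keeps the path continuous; off N the telescoping series is the
    uniform limit of the \<open>Q n\<close>.\<close>
  define Q' where "Q' t \<omega> = (if \<omega> \<in> N then 0 else Q 0 t \<omega> + (\<Sum>k. R k t \<omega>))" for t \<omega>
  have unif: "uniform_limit {0..T} (\<lambda>n t. Q n t \<omega>) (\<lambda>t. Q' t \<omega>) sequentially" if \<omega>: "\<omega> \<in> space M - N" for \<omega>
  proof -
    have "uniform_limit {0..T} (\<lambda>n t. \<Sum>k<n. R k t \<omega>) (\<lambda>t. \<Sum>k. R k t \<omega>) sequentially"
    proof (rule Weierstrass_m_test_ev)
      show "\<forall>\<^sub>F k in sequentially. \<forall>t\<in>{0..T}. norm (R k t \<omega>) \<le> (1/2) ^ k"
        using N(2)[OF \<omega>] by eventually_elim (use \<omega> in \<open>auto simp: E_def not_less\<close>)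
    qed (simp add: summable_geometric)
    then have "uniform_limit {0..T} (\<lambda>n t. Q 0 t \<omega> + (\<Sum>k<n. R k t \<omega>)) (\<lambda>t. Q 0 t \<omega> + (\<Sum>k. R k t \<omega>)) sequentially"
      by (intro uniform_limit_intros)
    moreover have "(\<Sum>k<n. R k t \<omega>) = Q n t \<omega> - Q 0 t \<omega>" for n t
      unfolding R_def by (rule sum_lessThan_telescope)
    ultimately show ?thesis using \<omega> by (simp add: Q'_def)
  qed
  have lim': "(\<lambda>n. Q n t \<omega>) \<longlonglongrightarrow> Q' t \<omega>" if "\<omega> \<in> space M - N" "t \<in> {0..T}" for t \<omega>
    using tendsto_uniform_limitI[OF unif[OF that(1)] that(2)] .
  have "martingale_version \<xi> Q' 1"
    unfolding martingale_version_def
  proof (intro conjI ballI)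
    fix \<omega> assume \<omega>: "\<omega> \<in> space M"
    show "continuous_on {0..T} (\<lambda>t. Q' t \<omega>)"
    proof (cases "\<omega> \<in> N")
      case False
      show ?thesis
        by (rule uniform_limit_theorem[OF _ unif]) (use False \<omega> martingale_versionD(2)[OF Q(1)] in \<open>auto intro!: always_eventually\<close>)
    qed (simp add: Q'_def)
  next
    fix t assume t: "t \<in> {0..T}"
    show b: "\<bar>Q' t \<omega>\<bar> \<le> 1" if \<omega>: "\<omega> \<in> space M" for \<omega>
    proof (cases "\<omega> \<in> N")
      case False
      have "Q' t \<omega> \<le> 1" "0 \<le> Q' t \<omega>"
        using LIMSEQ_le_const2[OF lim', of \<omega> t 1] LIMSEQ_le_const[OF lim', of \<omega> t 0] Q(2) False \<omega> t by auto
      then show ?thesis by simp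
    qed (simp add: Q'_def)
    show m: "Q' t \<in> borel_measurable (F t)"
    proof (rule borel_measurable_LIMSEQ_real)
      show "(\<lambda>n. if \<omega> \<in> N then 0 else Q n t \<omega>) \<longlonglongrightarrow> Q' t \<omega>" if "\<omega> \<in> space (F t)" for \<omega>
        using lim'[of \<omega> t] that t by (cases "\<omega> \<in> N") (auto simp: Q'_def)
      show "(\<lambda>\<omega>. if \<omega> \<in> N then 0 else Q n t \<omega>) \<in> borel_measurable (F t)" for n
        by (rule measurable_F_null_cong[OF martingale_versionD(1)[OF Q(1) t] N(1)]) auto
    qed
    fix S assume S: "S \<in> sets (F t)"
    then have S': "S \<in> sets Mc" using sets_F_Mc[of t] t by auto
    have "(\<lambda>n. \<integral>\<omega>. indicator S \<omega> * Q n t \<omega> \<partial>Mc) \<longlonglongrightarrow> (\<integral>\<omega>. indicator S \<omega> * Q' t \<omega> \<partial>Mc)"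
    proof (rule integral_dominated_convergence[where w="\<lambda>_. 1"])
      show "(\<lambda>\<omega>. indicator S \<omega> * Q' t \<omega>) \<in> borel_measurable Mc"
        using measurable_F_Mc[OF _ m] t S' by auto
      show "(\<lambda>\<omega>. indicator S \<omega> * Q n t \<omega>) \<in> borel_measurable Mc" for n
        using martingale_versionD(5)[OF Q(1) t] S' by auto
      show "AE \<omega> in Mc. (\<lambda>n. indicator S \<omega> * Q n t \<omega>) \<longlonglongrightarrow> indicator S \<omega> * Q' t \<omega>"
        using AE_not_in[OF N(1)] AE_space by eventually_elim (use t in \<open>auto intro!: tendsto_mult_left lim'\<close>)
      show "AE \<omega> in Mc. norm (indicator S \<omega> * Q n t \<omega>) \<le> 1" for n
        using Q(2)[of n t] by (intro AE_I2) (auto simp: indicator_def abs_le_iff intro: order_trans[of _ 0])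
    qed auto
    \<comment> \<open>The integrals of \<open>Q n t\<close> over S are those of the terminal
      variables, whose L1 distance to \<xi> is below 4^-n.\<close>
    moreover have "(\<lambda>n. \<integral>\<omega>. indicator S \<omega> * Q n t \<omega> \<partial>Mc) \<longlonglongrightarrow> (\<integral>\<omega>. indicator S \<omega> * \<xi> \<omega> \<partial>Mc)"
    proof (rule LIM_zero_cancel, rule Lim_null_comparison[where g="\<lambda>n. (1/4) ^ n"], intro always_eventually allI)
      fix n
      have i1: "integrable Mc (\<lambda>\<omega>. indicator S \<omega> * \<xi>n (r n) \<omega>)" "integrable Mc (\<lambda>\<omega>. indicator S \<omega> * \<xi> \<omega>)"
        by (rule set_bounded_integrable_Mc[where C=1], use \<xi>n \<xi> S' in \<open>auto simp: abs_le_iff intro: order_trans[of _ 0]\<close>)+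
      have "(\<integral>\<omega>. indicator S \<omega> * Q n t \<omega> \<partial>Mc) - (\<integral>\<omega>. indicator S \<omega> * \<xi> \<omega> \<partial>Mc) =
        (\<integral>\<omega>. indicator S \<omega> * \<xi>n (r n) \<omega> - indicator S \<omega> * \<xi> \<omega> \<partial>Mc)"
        unfolding martingale_versionD(4)[OF Q(1) t S] using i1 by simp
      also have "\<bar>\<dots>\<bar> \<le> (\<integral>\<omega>. \<bar>indicator S \<omega> * \<xi>n (r n) \<omega> - indicator S \<omega> * \<xi> \<omega>\<bar> \<partial>Mc)"
        by (rule integral_abs_bound)
      also have "\<dots> \<le> (\<integral>\<omega>. \<bar>\<xi>n (r n) \<omega> - \<xi> \<omega>\<bar> \<partial>Mc)"
        by (rule integral_mono) (use i1 id in \<open>auto simp: indicator_def\<close>)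
      also have "\<dots> \<le> (1/4) ^ n" using r[of n] by simp
      finally show "norm ((\<integral>\<omega>. indicator S \<omega> * Q n t \<omega> \<partial>Mc) - (\<integral>\<omega>. indicator S \<omega> * \<xi> \<omega> \<partial>Mc)) \<le> (1/4) ^ n"
        by simp
    qed (simp add: LIMSEQ_realpow_zero)
    ultimately show "(\<integral>\<omega>. indicator S \<omega> * Q' t \<omega> \<partial>Mc) = (\<integral>\<omega>. indicator S \<omega> * \<xi> \<omega> \<partial>Mc)"
      by (rule LIMSEQ_unique)
  qed
  then show ?thesis by (auto simp: has_martingale_def)
qed

section \<open>Independence of the past and of later increments\<close>

definition irregular :: "'a set" where
  "irregular = (SOME N. N \<in> null_sets Mc \<and>
     (\<forall>\<omega>\<in>space M - N. continuous_on {0..T} (\<lambda>t. B t \<omega>) \<and> B 0 \<omega> = 0))"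

text \<open>Setting B to 0 on one fixed null set gives a process that starts at 0 and is continuous
  at every point of the sample space.\<close>

definition Bc :: "real \<Rightarrow> 'a \<Rightarrow> real ^ 'd" where
  "Bc t \<omega> = (if \<omega> \<in> irregular then 0 else B t \<omega>)"

lemma irregular:
  "irregular \<in> null_sets Mc"
  "\<And>\<omega>. \<omega> \<in> space M - irregular \<Longrightarrow> continuous_on {0..T} (\<lambda>t. B t \<omega>)"
  "\<And>\<omega>. \<omega> \<in> space M - irregular \<Longrightarrow> B 0 \<omega> = 0"
proof -
  have "AE \<omega> in M. B 0 \<omega> = 0" "AE \<omega> in M. continuous_on {0..T} (\<lambda>t. B t \<omega>)"
    using brownian by (auto simp: brownian_motion_def)
  then have "AE \<omega> in M. continuous_on {0..T} (\<lambda>t. B t \<omega>) \<and> B 0 \<omega> = 0" by eventually_elim simp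
  then have "AE \<omega> in Mc. continuous_on {0..T} (\<lambda>t. B t \<omega>) \<and> B 0 \<omega> = 0" by (simp add: AE_completion_iff)
  from AE_null_set_ex[OF this]
  have "\<exists>N. N \<in> null_sets Mc \<and> (\<forall>\<omega>\<in>space M - N. continuous_on {0..T} (\<lambda>t. B t \<omega>) \<and> B 0 \<omega> = 0)" by blast
  from someI_ex[OF this, folded irregular_def]
  show "irregular \<in> null_sets Mc"
    "\<And>\<omega>. \<omega> \<in> space M - irregular \<Longrightarrow> continuous_on {0..T} (\<lambda>t. B t \<omega>)"
    "\<And>\<omega>. \<omega> \<in> space M - irregular \<Longrightarrow> B 0 \<omega> = 0"
    by blast+
qed

lemma Bc_measurable_F: "s \<in> {0..t} \<Longrightarrow> Bc s \<in> borel_measurable (F t)"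
  by (rule measurable_F_null_cong[OF B_measurable_F irregular(1)]) (auto simp: Bc_def)

lemma Bc_measurable: "s \<in> {0..T} \<Longrightarrow> Bc s \<in> borel_measurable Mc"
  using measurable_F_Mc[OF order_refl Bc_measurable_F[of s T]] .

lemma Bc_continuous: "\<omega> \<in> space M \<Longrightarrow> continuous_on {0..T} (\<lambda>t. Bc t \<omega>)"
  using irregular(2)[of \<omega>] by (cases "\<omega> \<in> irregular") (auto simp: Bc_def)

lemma AE_Bc: "AE \<omega> in Mc. \<omega> \<notin> irregular"
  by (rule AE_not_in[OF irregular(1)])

text \<open>All times involved are sorted into one grid. Values up to t are sums of grid increments
  before t, increments from t on are sums of grid increments after t, and disjoint blocks of
  increments are independent.\<close>

lemma cylinder_increments_indep:
  assumes t: "t \<in> {0..T}" and R: "finite R" "R \<subseteq> {0..t}" and I: "finite I" "I \<subseteq> {t..T}"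
    and C: "\<And>r. r \<in> R \<Longrightarrow> C r \<in> sets borel" and D: "D \<in> sets (PiM I (\<lambda>_. borel))"
  defines "E1 \<equiv> {\<omega> \<in> space M. \<forall>r\<in>R. Bc r \<omega> \<in> C r}"
    and "E2 \<equiv> (\<lambda>\<omega>. \<lambda>i\<in>I. Bc i \<omega> - Bc t \<omega>) -` D \<inter> space M"
  shows "measure Mc (E1 \<inter> E2) = measure Mc E1 * measure Mc E2"
proof -
  \<comment> \<open>0 is included because values are recovered by summing increments from
    \<open>B 0 = 0\<close>, and t so that no grid increment straddles it.\<close>
  define S where "S = insert 0 (insert t (R \<union> I))"
  have S: "finite S" "S \<subseteq> {0..T}" "S \<noteq> {}" using R I t by (auto simp: S_def)
  define xs where "xs = sorted_list_of_set S"
  have xs: "set xs = S" "sorted_wrt (<) xs" "xs \<noteq> []"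
    using S by (auto simp: xs_def)
  define n where "n = length xs - 1"
  have len: "length xs = Suc n" using xs(3) by (simp add: n_def)
  define \<tau> where "\<tau> i = xs ! i" for i
  have less: "\<tau> i < \<tau> j" if "i < j" "j \<le> n" for i j
    unfolding \<tau>_def using sorted_wrt_nth_less[OF xs(2) that(1)] that(2) len by simp
  have "\<exists>k. k \<le> n \<and> \<tau> k = r" if "r \<in> S" for r
    using that xs(1) len unfolding \<tau>_def by (metis in_set_conv_nth less_Suc_eq_le)
  then obtain idx where idx: "\<And>r. r \<in> S \<Longrightarrow> idx r \<le> n" "\<And>r. r \<in> S \<Longrightarrow> \<tau> (idx r) = r" by metis
  have idx_mono: "idx r \<le> idx s" if "r \<in> S" "s \<in> S" "r \<le> s" for r s
    using less[of "idx s" "idx r"] idx[OF that(1)] idx[OF that(2)] that(3) by (metis not_le)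
  have mem: "0 \<in> S" "t \<in> S" "\<And>r. r \<in> R \<Longrightarrow> r \<in> S" "\<And>i. i \<in> I \<Longrightarrow> i \<in> S" by (auto simp: S_def)
  have \<tau>S: "\<tau> i \<in> S" if "i \<le> n" for i using that xs(1) len by (auto simp: \<tau>_def)
  have idx0: "idx 0 = 0"
  proof (rule ccontr)
    assume "idx 0 \<noteq> 0"
    then have "\<tau> 0 < \<tau> (idx 0)" using less[of 0 "idx 0"] idx(1)[OF mem(1)] by simp
    then show False using \<tau>S[of 0] S(2) idx(2)[OF mem(1)] by auto
  qed
  then have \<tau>0: "\<tau> 0 = 0" using idx(2)[OF mem(1)] by simp
  define k where "k = idx t"
  have k: "k \<le> n" "\<tau> k = t" using idx[OF mem(2)] by (auto simp: k_def)
  have kR: "idx r \<le> k" if "r \<in> R" for r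
    unfolding k_def by (rule idx_mono) (use that R mem in auto)
  have kI: "k \<le> idx i" if "i \<in> I" for i
    unfolding k_def by (rule idx_mono) (use that I mem in auto)
  define X where "X i \<omega> = B (\<tau> (Suc i)) \<omega> - B (\<tau> i) \<omega>" for i \<omega>
  have "mono_on {..n} \<tau>"
    by (rule mono_onI) (metis less le_less atMost_iff order_refl)
  moreover have "\<tau> ` {..n} \<subseteq> {0..T}" using \<tau>S S(2) by auto
  ultimately have ind: "indep_vars (\<lambda>_. borel) X {..<n}"
    using brownian unfolding brownian_motion_def X_def by blast
  let ?PA = "PiM {..<k} (\<lambda>_. borel :: (real ^ 'd) measure)" and ?PB = "PiM {k..<n} (\<lambda>_. borel :: (real ^ 'd) measure)"
  let ?XA = "\<lambda>\<omega>. restrict (\<lambda>i. X i \<omega>) {..<k}" and ?XB = "\<lambda>\<omega>. restrict (\<lambda>i. X i \<omega>) {k..<n}"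
  have iv: "indep_var ?PA ?XA ?PB ?XB"
    by (rule indep_var_restrict[OF ind]) (use k in auto)
  \<comment> \<open>\<open>GA\<close> and \<open>GB\<close> express the two events through the
    blocks of grid increments; their preimages agree with \<open>E1\<close> and \<open>E2\<close>
    off \<open>irregular\<close>.\<close>
  define GA where "GA = {x \<in> space ?PA. \<forall>r\<in>R. (\<Sum>i<idx r. x i) \<in> C r}"
  define GB where "GB = (\<lambda>x. \<lambda>i\<in>I. \<Sum>j\<in>{k..<idx i}. x j) -` D \<inter> space ?PB"
  have GA: "GA \<in> sets ?PA"
    unfolding GA_def
  proof (rule sets.sets_Collect_finite_All[OF _ R(1)])
    fix r assume r: "r \<in> R"
    have "(\<lambda>x. \<Sum>i<idx r. x i) \<in> borel_measurable ?PA"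
      using kR[OF r] by (intro borel_measurable_sum measurable_component_singleton) auto
    from measurable_sets[OF this C[OF r]]
    show "{x \<in> space ?PA. (\<Sum>i<idx r. x i) \<in> C r} \<in> sets ?PA"
      by (simp add: vimage_def Int_def conj_commute)
  qed
  have GB: "GB \<in> sets ?PB"
    unfolding GB_def
  proof (rule measurable_sets[OF _ D], rule measurable_restrict)
    fix i assume i: "i \<in> I"
    show "(\<lambda>x. \<Sum>j\<in>{k..<idx i}. x j) \<in> borel_measurable ?PB"
      using idx(1)[OF mem(4)[OF i]] by (intro borel_measurable_sum measurable_component_singleton) auto
  qed
  let ?A = "?XA -` GA \<inter> space M" and ?B = "?XB -` GB \<inter> space M"
  have AB: "?A \<in> sets M" "?B \<in> sets M"
    using measurable_sets[OF indep_var_rv1[OF iv] GA] measurable_sets[OF indep_var_rv2[OF iv] GB] .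
  have prod: "prob (?A \<inter> ?B) = prob ?A * prob ?B"
  proof -
    have "(\<lambda>\<omega>. (?XA \<omega>, ?XB \<omega>)) -` (GA \<times> GB) \<inter> space M = ?A \<inter> ?B" by auto
    then show ?thesis using indep_varD[OF iv GA GB] by simp
  qed
  have eqA: "\<omega> \<in> E1 \<longleftrightarrow> \<omega> \<in> ?A" if \<omega>: "\<omega> \<in> space M - irregular" for \<omega>
  proof -
    have "(\<Sum>i<idx r. ?XA \<omega> i) = Bc r \<omega>" if r: "r \<in> R" for r
    proof -
      have "(\<Sum>i<idx r. ?XA \<omega> i) = (\<Sum>i<idx r. X i \<omega>)"
        by (rule sum.cong) (use kR[OF r] in auto)
      also have "\<dots> = B (\<tau> (idx r)) \<omega> - B (\<tau> 0) \<omega>"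
        unfolding X_def by (rule sum_lessThan_telescope)
      also have "\<dots> = Bc r \<omega>" using idx(2)[OF mem(3)[OF r]] \<tau>0 irregular(3)[OF \<omega>] \<omega> by (simp add: Bc_def)
      finally show ?thesis .
    qed
    then show ?thesis using \<omega> by (auto simp: E1_def GA_def space_PiM)
  qed
  have eqB: "\<omega> \<in> E2 \<longleftrightarrow> \<omega> \<in> ?B" if \<omega>: "\<omega> \<in> space M - irregular" for \<omega>
  proof -
    have "(\<lambda>i\<in>I. \<Sum>j\<in>{k..<idx i}. ?XB \<omega> j) = (\<lambda>i\<in>I. Bc i \<omega> - Bc t \<omega>)"
    proof (rule restrict_ext)
      fix i assume i: "i \<in> I"
      have "(\<Sum>j\<in>{k..<idx i}. ?XB \<omega> j) = (\<Sum>j\<in>{k..<idx i}. X j \<omega>)"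
        by (rule sum.cong) (use idx(1)[OF mem(4)[OF i]] in auto)
      also have "\<dots> = B (\<tau> (idx i)) \<omega> - B (\<tau> k) \<omega>"
        unfolding X_def by (rule sum_Suc_diff'[OF kI[OF i]])
      also have "\<dots> = Bc i \<omega> - Bc t \<omega>" using idx(2)[OF mem(4)[OF i]] k \<omega> by (simp add: Bc_def)
      finally show "(\<Sum>j\<in>{k..<idx i}. ?XB \<omega> j) = Bc i \<omega> - Bc t \<omega>" .
    qed
    then show ?thesis using \<omega> by (auto simp: E2_def GB_def space_PiM)
  qed
  have E1: "E1 \<in> sets Mc"
  proof -
    have "{\<omega> \<in> space Mc. \<forall>r\<in>R. Bc r \<omega> \<in> C r} \<in> sets Mc"
    proof (rule sets.sets_Collect_finite_All[OF _ R(1)])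
      fix r assume r: "r \<in> R"
      have "Bc r \<in> borel_measurable Mc" using r R t by (intro Bc_measurable) auto
      from measurable_sets[OF this C[OF r]] show "{\<omega> \<in> space Mc. Bc r \<omega> \<in> C r} \<in> sets Mc"
        by (simp add: vimage_def Int_def conj_commute)
    qed
    then show ?thesis by (simp add: E1_def)
  qed
  have "(\<lambda>\<omega>. \<lambda>i\<in>I. Bc i \<omega> - Bc t \<omega>) \<in> measurable Mc (PiM I (\<lambda>_. borel))"
  proof (rule measurable_restrict)
    fix i assume "i \<in> I"
    then have "i \<in> {0..T}" using I t by auto
    then show "(\<lambda>\<omega>. Bc i \<omega> - Bc t \<omega>) \<in> borel_measurable Mc"
      using Bc_measurable[of i] Bc_measurable[OF t] by (intro borel_measurable_diff) auto
  qed
  from measurable_sets[OF this D] have E2: "E2 \<in> sets Mc" by (simp add: E2_def)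
  have "measure Mc (E1 \<inter> E2) = measure Mc (?A \<inter> ?B)"
    by (rule measure_eq_AE) (use AE_Bc AE_space E1 E2 AB in \<open>auto elim!: eventually_elim2 simp: eqA eqB simp del: vimage_Int\<close>)
  moreover have "measure Mc E1 = measure Mc ?A"
    by (rule measure_eq_AE) (use AE_Bc AE_space E1 E2 AB in \<open>auto elim!: eventually_elim2 simp: eqA\<close>)
  moreover have "measure Mc E2 = measure Mc ?B"
    by (rule measure_eq_AE) (use AE_Bc AE_space E1 E2 AB in \<open>auto elim!: eventually_elim2 simp: eqB\<close>)
  moreover have "measure Mc (?A \<inter> ?B) = prob (?A \<inter> ?B)" "measure Mc ?A = prob ?A" "measure Mc ?B = prob ?B"
    using AB by (auto intro!: measure_completion)
  ultimately show ?thesis using prod by simp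
qed

text \<open>Finite-dimensional cylinders up to null sets. Describing A only almost everywhere admits
  the null sets themselves and lets \<open>Bc\<close> replace B; closed constraints are those whose
  indicators are limits of continuous functions.\<close>

definition Cyl :: "real \<Rightarrow> 'a set set" where
  "Cyl t = {A \<in> sets Mc. \<exists>R C. finite R \<and> R \<subseteq> {0..t} \<and> (\<forall>r. closed (C r)) \<and>
     (AE \<omega> in Mc. \<omega> \<in> A \<longleftrightarrow> (\<forall>r\<in>R. Bc r \<omega> \<in> C r))}"

lemma CylD:
  "A \<in> Cyl t \<Longrightarrow> A \<in> sets Mc"
  "A \<in> Cyl t \<Longrightarrow> \<exists>R C. finite R \<and> R \<subseteq> {0..t} \<and> (\<forall>r. closed (C r)) \<and>
     (AE \<omega> in Mc. \<omega> \<in> A \<longleftrightarrow> (\<forall>r\<in>R. Bc r \<omega> \<in> C r))"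
  by (simp_all add: Cyl_def)

lemma Int_stable_Cyl: "Int_stable (Cyl t)"
proof (rule Int_stableI)
  fix A A' assume A: "A \<in> Cyl t" and A': "A' \<in> Cyl t"
  from CylD(2)[OF A] obtain R C where 1: "finite R" "R \<subseteq> {0..t}" "\<forall>r. closed (C r)" "AE \<omega> in Mc. \<omega> \<in> A \<longleftrightarrow> (\<forall>r\<in>R. Bc r \<omega> \<in> C r)"
    by blast
  note m15 = CylD(1)[OF A]
  from CylD(2)[OF A'] obtain R' C' where 2: "finite R'" "R' \<subseteq> {0..t}" "\<forall>r. closed (C' r)" "AE \<omega> in Mc. \<omega> \<in> A' \<longleftrightarrow> (\<forall>r\<in>R'. Bc r \<omega> \<in> C' r)"
    by blast
  note m25 = CylD(1)[OF A']
  define C'' where "C'' r = (if r \<in> R then C r else UNIV) \<inter> (if r \<in> R' then C' r else UNIV)" for r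
  have "AE \<omega> in Mc. \<omega> \<in> A \<inter> A' \<longleftrightarrow> (\<forall>r\<in>R \<union> R'. Bc r \<omega> \<in> C'' r)"
    using 1(4) 2(4) by eventually_elim (auto simp: C''_def)
  moreover have "closed (C'' r)" for r using 1(3) 2(3) by (auto simp: C''_def)
  ultimately show "A \<inter> A' \<in> Cyl t"
    unfolding Cyl_def using 1 2 m15 m25
    by (intro CollectI conjI exI[of _ "R \<union> R'"] exI[of _ C'']) auto
qed

lemma sets_F_subset_Cyl:
  assumes t: "t \<in> {0..T}"
  shows "sets (F t) \<subseteq> sigma_sets (space M) (Cyl t)"
  unfolding sets_F
proof (rule sigma_sets_mono, rule Un_least, safe)
  have CP: "Cyl t \<subseteq> Pow (space M)" using sets.sets_into_space[of _ Mc] by (auto simp: Cyl_def)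
  fix s and A :: "(real ^ 'd) set" assume s: "s \<in> {0..t}" and A: "A \<in> sets borel"
  have "B s \<in> measurable (sigma (space M) (Cyl t)) (sigma UNIV (Collect closed))"
  proof (rule measurable_measure_of)
    fix K :: "(real ^ 'd) set" assume "K \<in> Collect closed"
    then have K: "closed K" by simp
    have "B s -` K \<inter> space M \<in> Cyl t"
    proof -
      have "B s -` K \<inter> space M \<in> sets Mc"
        using measurable_sets[OF B_measurable[of s], of K] K s t by auto
      moreover have "AE \<omega> in Mc. \<omega> \<in> B s -` K \<inter> space M \<longleftrightarrow> (\<forall>r\<in>{s}. Bc r \<omega> \<in> K)"
        using AE_Bc AE_space by eventually_elim (auto simp: Bc_def)
      ultimately show ?thesis unfolding Cyl_def using s K
        by (intro CollectI conjI exI[of _ "{s}"] exI[of _ "\<lambda>_. K"]) auto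
    qed
    then show "B s -` K \<inter> space (sigma (space M) (Cyl t)) \<in> sets (sigma (space M) (Cyl t))"
      using CP by (simp add: space_measure_of_conv sets_measure_of sigma_sets.Basic)
  qed auto
  then have "B s \<in> borel_measurable (sigma (space M) (Cyl t))" by (simp add: borel_eq_closed)
  from measurable_sets[OF this A] show "B s -` A \<inter> space M \<in> sigma_sets (space M) (Cyl t)"
    using CP by (simp add: space_measure_of_conv sets_measure_of)
next
  fix N assume N: "N \<in> null_sets Mc"
  \<comment> \<open>A null set is almost everywhere the cylinder with the impossible constraint
    \<open>Bc 0 \<omega> \<in> {}\<close>.\<close>
  have "AE \<omega> in Mc. \<omega> \<in> N \<longleftrightarrow> (\<forall>r\<in>{0}. Bc r \<omega> \<in> {})"
    using AE_not_in[OF N] by eventually_elim auto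
  then have "N \<in> Cyl t" unfolding Cyl_def using N t
    by (intro CollectI conjI exI[of _ "{0}"] exI[of _ "\<lambda>_. {}"]) auto
  then show "N \<in> sigma_sets (space M) (Cyl t)" by (rule sigma_sets.Basic)
qed

lemma Cyl_indep:
  assumes t: "t \<in> {0..T}" and I: "finite I" "I \<subseteq> {t..T}" and A: "A \<in> Cyl t" and D: "D \<in> sets (PiM I (\<lambda>_. borel))"
  defines "E2 \<equiv> (\<lambda>\<omega>. \<lambda>i\<in>I. Bc i \<omega> - Bc t \<omega>) -` D \<inter> space M"
  assumes E2: "E2 \<in> sets Mc"
  shows "measure Mc (A \<inter> E2) = measure Mc A * measure Mc E2"
proof -
  from CylD(2)[OF A] obtain R C where 1: "finite R" "R \<subseteq> {0..t}" "\<forall>r. closed (C r)" "AE \<omega> in Mc. \<omega> \<in> A \<longleftrightarrow> (\<forall>r\<in>R. Bc r \<omega> \<in> C r)"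
    by blast
  note m15 = CylD(1)[OF A]
  define E1 where "E1 = {\<omega> \<in> space M. \<forall>r\<in>R. Bc r \<omega> \<in> C r}"
  have ae: "AE \<omega> in Mc. \<omega> \<in> A \<longleftrightarrow> \<omega> \<in> E1"
    using 1(4) AE_space by eventually_elim (auto simp: E1_def)
  have E1: "E1 \<in> sets Mc"
    unfolding E1_def
  proof -
    have "{\<omega> \<in> space Mc. \<forall>r\<in>R. Bc r \<omega> \<in> C r} \<in> sets Mc"
    proof (rule sets.sets_Collect_finite_All[OF _ 1(1)])
      fix r assume r: "r \<in> R"
      have "Bc r \<in> borel_measurable Mc" using r 1 t by (intro Bc_measurable) auto
      from measurable_sets[OF this, of "C r"] 1(3) show "{\<omega> \<in> space Mc. Bc r \<omega> \<in> C r} \<in> sets Mc"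
        by (simp add: vimage_def Int_def conj_commute)
    qed
    then show "{\<omega> \<in> space M. \<forall>r\<in>R. Bc r \<omega> \<in> C r} \<in> sets Mc" by simp
  qed
  have "AE \<omega> in Mc. \<omega> \<in> A \<inter> E2 \<longleftrightarrow> \<omega> \<in> E1 \<inter> E2" using ae by eventually_elim auto
  then have "measure Mc (A \<inter> E2) = measure Mc (E1 \<inter> E2)"
    using E1 E2 m15 by (intro measure_eq_AE) auto
  moreover have "measure Mc A = measure Mc E1" using ae E1 m15 by (intro measure_eq_AE) auto
  moreover have "measure Mc (E1 \<inter> E2) = measure Mc E1 * measure Mc E2"
    unfolding E1_def E2_def by (rule cylinder_increments_indep[OF t 1(1,2) I _ D]) (use 1(3) in auto)
  ultimately show ?thesis by simp
qed

lemma increments_measurable: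
  assumes t: "t \<in> {0..T}" and I: "I \<subseteq> {t..T}"
  shows "(\<lambda>\<omega>. \<lambda>i\<in>I. Bc i \<omega> - Bc t \<omega>) \<in> measurable Mc (PiM I (\<lambda>_. borel))"
proof (rule measurable_restrict)
  fix i assume "i \<in> I"
  then have "i \<in> {0..T}" using I t by auto
  then show "(\<lambda>\<omega>. Bc i \<omega> - Bc t \<omega>) \<in> borel_measurable Mc"
    using Bc_measurable[of i] Bc_measurable[OF t] by (intro borel_measurable_diff) auto
qed

lemma id_measurable_F:
  assumes "t \<le> T" shows "(\<lambda>\<omega>. \<omega>) \<in> measurable Mc (F t)"
proof (rule measurableI)
  fix A assume A: "A \<in> sets (F t)"
  have "(\<lambda>\<omega>. \<omega>) -` A \<inter> space Mc = A" using sets.sets_into_space[OF A] by auto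
  then show "(\<lambda>\<omega>. \<omega>) -` A \<inter> space Mc \<in> sets Mc" using A sets_F_Mc[OF assms] by auto
qed simp

text \<open>Taking the identity as a random element with values in \<open>F t\<close> turns
  independence of the past and the increments into a product law, so that Fubini applies to
  integrands depending on the whole past.\<close>

lemma indep_F_increments:
  assumes t: "t \<in> {0..T}" and I: "finite I" "I \<subseteq> {t..T}"
  shows "distr Mc (F t) (\<lambda>\<omega>. \<omega>) \<Otimes>\<^sub>M distr Mc (PiM I (\<lambda>_. borel)) (\<lambda>\<omega>. \<lambda>i\<in>I. Bc i \<omega> - Bc t \<omega>) =
    distr Mc (F t \<Otimes>\<^sub>M PiM I (\<lambda>_. borel)) (\<lambda>\<omega>. (\<omega>, \<lambda>i\<in>I. Bc i \<omega> - Bc t \<omega>))"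
proof -
  let ?W = "\<lambda>\<omega>. \<lambda>i\<in>I. Bc i \<omega> - Bc t \<omega>"
  let ?P = "PiM I (\<lambda>_. borel :: (real ^ 'd) measure)"
  note W = increments_measurable[OF t I(2)]
  have idm: "(\<lambda>\<omega>. \<omega>) \<in> measurable Mc (F t)" using t by (intro id_measurable_F) simp
  let ?G = "{?W -` D \<inter> space Mc | D. D \<in> sets ?P}"
  have GM: "?G \<subseteq> sets Mc" using measurable_sets[OF W] by auto
  have ind: "Mc.indep_set (Cyl t) ?G"
    unfolding Mc.indep_sets2_eq
  proof (intro conjI ballI)
    show "Cyl t \<subseteq> sets Mc" by (auto simp: Cyl_def)
    show "?G \<subseteq> sets Mc" by (rule GM)
    fix A E assume A: "A \<in> Cyl t" and "E \<in> ?G"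
    then obtain D where D: "D \<in> sets ?P" "E = ?W -` D \<inter> space M" by auto
    show "measure Mc (A \<inter> E) = measure Mc A * measure Mc E"
      unfolding D(2) by (rule Cyl_indep[OF t I A D(1)]) (use measurable_sets[OF W D(1)] in simp)
  qed
  have Gst: "Int_stable ?G"
  proof (rule Int_stableI)
    fix a b assume "a \<in> ?G" "b \<in> ?G"
    then obtain D D' where "a = ?W -` D \<inter> space Mc" "b = ?W -` D' \<inter> space Mc" "D \<in> sets ?P" "D' \<in> sets ?P" by auto
    then show "a \<inter> b \<in> ?G" by (intro CollectI exI[of _ "D \<inter> D'"]) auto
  qed
  have big: "Mc.indep_set (sigma_sets (space Mc) (Cyl t)) (sigma_sets (space Mc) ?G)"
    by (rule Mc.indep_set_sigma_sets[OF ind Int_stable_Cyl Gst])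
  interpret P1: prob_space "distr Mc (F t) (\<lambda>\<omega>. \<omega>)" by (rule Mc.prob_space_distr[OF idm])
  interpret P2: prob_space "distr Mc ?P ?W" by (rule Mc.prob_space_distr[OF W])
  have pairm: "(\<lambda>\<omega>. (\<omega>, ?W \<omega>)) \<in> measurable Mc (F t \<Otimes>\<^sub>M ?P)"
    by (rule measurable_Pair[OF idm W])
  show ?thesis
  proof (rule pair_measure_eqI)
    fix A D assume "A \<in> sets (distr Mc (F t) (\<lambda>\<omega>. \<omega>))" "D \<in> sets (distr Mc ?P ?W)"
    then have A: "A \<in> sets (F t)" and D: "D \<in> sets ?P" by simp_all
    let ?E = "?W -` D \<inter> space Mc"
    have "A \<in> sigma_sets (space Mc) (Cyl t)" using sets_F_subset_Cyl[OF t] A by auto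
    moreover have "?E \<in> sigma_sets (space Mc) ?G" using D by (intro sigma_sets.Basic) blast
    ultimately have "measure Mc (A \<inter> ?E) = measure Mc A * measure Mc ?E"
      by (rule Mc.indep_setD[OF big])
    moreover have "emeasure (distr Mc (F t) (\<lambda>\<omega>. \<omega>)) A = ennreal (measure Mc A)"
      using A sets.sets_into_space[OF A] by (simp add: emeasure_distr[OF idm] Int_absorb2 Mc.emeasure_eq_measure)
    moreover have "emeasure (distr Mc ?P ?W) D = ennreal (measure Mc ?E)"
      using D by (simp add: emeasure_distr[OF W] Mc.emeasure_eq_measure)
    moreover have "emeasure (distr Mc (F t \<Otimes>\<^sub>M ?P) (\<lambda>\<omega>. (\<omega>, ?W \<omega>))) (A \<times> D) = ennreal (measure Mc (A \<inter> ?E))"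
    proof -
      have "(\<lambda>\<omega>. (\<omega>, ?W \<omega>)) -` (A \<times> D) \<inter> space Mc = A \<inter> ?E"
        using sets.sets_into_space[OF A] by auto
      then show ?thesis using A D by (subst emeasure_distr[OF pairm]) (auto simp: Mc.emeasure_eq_measure)
    qed
    ultimately show "emeasure (distr Mc (F t) (\<lambda>\<omega>. \<omega>)) A * emeasure (distr Mc ?P ?W) D =
        emeasure (distr Mc (F t \<Otimes>\<^sub>M ?P) (\<lambda>\<omega>. (\<omega>, ?W \<omega>))) (A \<times> D)"
      by (simp add: ennreal_mult[symmetric])
  qed (simp_all add: P1.sigma_finite_measure_axioms P2.sigma_finite_measure_axioms cong: sets_pair_measure_cong)
qed

text \<open>Conditioning on \<open>F\<^sub>t\<close> amounts to replacing the increments after \<open>t\<close> by those of an independent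
  copy of \<open>B\<close> and integrating over the copy; the result is visibly continuous in \<open>t\<close>.\<close>

lemma has_martingale_prod:
  assumes S: "finite S" "S \<subseteq> {0..T}"
    and \<phi>: "\<And>s. continuous_on UNIV (\<phi> s)" "\<And>s x. \<phi> s x \<in> {0..1::real}"
  shows "has_martingale (\<lambda>\<omega>. \<Prod>s\<in>S. \<phi> s (Bc s \<omega>))"
proof -
  \<comment> \<open>One formula for both sides of t: if s \<le> t the bracket vanishes and the
    argument is \<open>Bc s \<omega>\<close>; if s > t it is \<open>Bc t \<omega>\<close> plus the
    increment of the copy \<open>\<omega>'\<close> over ]t, s].\<close>
  define p where "p t \<omega> \<omega>' = (\<Prod>s\<in>S. \<phi> s (Bc (min t s) \<omega> + (Bc (max t s) \<omega>' - Bc t \<omega>')))" for t \<omega> \<omega>'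
  define Q where "Q t \<omega> = (\<integral>\<omega>'. p t \<omega> \<omega>' \<partial>Mc)" for t \<omega>
  have prod01: "(\<Prod>s\<in>S. \<phi> s (x s)) \<in> {0..1}" for x
    using \<phi>(2) by (auto intro!: prod_nonneg prod_le_1)
  have p01: "p t \<omega> \<omega>' \<in> {0..1}" for t \<omega> \<omega>' unfolding p_def by (rule prod01)
  have \<phi>m: "\<phi> s \<in> borel_measurable borel" for s by (rule borel_measurable_continuous_onI[OF \<phi>(1)])
  have mm: "min t s \<in> {0..t}" "max t s \<in> {t..T}" "max t s \<in> {0..T}" if "s \<in> S" "t \<in> {0..T}" for s t
    using that S by auto
  have pm: "(\<lambda>(\<omega>, \<omega>'). p t \<omega> \<omega>') \<in> borel_measurable (F t \<Otimes>\<^sub>M Mc)" if t: "t \<in> {0..T}" for t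
    unfolding p_def split_beta'
  proof (rule borel_measurable_prod, rule measurable_compose[OF _ \<phi>m])
    fix s assume s: "s \<in> S"
    note [measurable] = Bc_measurable_F[OF mm(1)[OF s t]] Bc_measurable[OF mm(3)[OF s t]] Bc_measurable[OF t]
    show "(\<lambda>x. Bc (min t s) (fst x) + (Bc (max t s) (snd x) - Bc t (snd x))) \<in> borel_measurable (F t \<Otimes>\<^sub>M Mc)"
      by measurable
  qed
  have pm1: "(\<lambda>\<omega>'. p t \<omega> \<omega>') \<in> borel_measurable Mc" if "t \<in> {0..T}" "\<omega> \<in> space M" for t \<omega>
    using measurable_Pair2[OF pm[OF that(1)], of \<omega>] that(2) by simp
  have "martingale_version (\<lambda>\<omega>. \<Prod>s\<in>S. \<phi> s (Bc s \<omega>)) Q 1"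
    unfolding martingale_version_def
  proof (intro conjI ballI)
    fix t assume t: "t \<in> {0..T}"
    show Qm: "Q t \<in> borel_measurable (F t)"
      unfolding Q_def using Mc.borel_measurable_lebesgue_integral[OF pm[OF t]] by simp
    show "\<bar>Q t \<omega>\<bar> \<le> 1" if "\<omega> \<in> space M" for \<omega>
    proof -
      have "(\<integral>\<omega>'. p t \<omega> \<omega>' \<partial>Mc) \<le> (\<integral>\<omega>'. 1 \<partial>Mc)"
        using p01[of t \<omega>] pm1[OF t that] by (intro integral_mono bounded_integrable_Mc[where C=1]) (auto simp: abs_le_iff intro: order_trans[of _ 0])
      moreover have "0 \<le> (\<integral>\<omega>'. p t \<omega> \<omega>' \<partial>Mc)"
        using p01[of t \<omega>] by (intro Bochner_Integration.integral_nonneg_AE AE_I2) auto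
      ultimately show ?thesis by (simp add: Q_def prob_space)
    qed
    fix A assume A: "A \<in> sets (F t)"
    let ?I = "max t ` S" and ?W = "\<lambda>\<omega>. \<lambda>i\<in>max t ` S. Bc i \<omega> - Bc t \<omega>"
    let ?P = "PiM ?I (\<lambda>_. borel :: (real ^ 'd) measure)"
    have I: "finite ?I" "?I \<subseteq> {t..T}" using S t by auto
    have rv: "(\<lambda>\<omega>. \<omega>) \<in> measurable Mc (F t)" "?W \<in> measurable Mc ?P"
      using id_measurable_F[of t] increments_measurable[OF t I(2)] t by auto
    \<comment> \<open>The same integrand with the increments as a separate argument w. Coordinates
      are indexed by \<open>max t s\<close>, so all s \<le> t share the coordinate t, whose
      increment is 0.\<close>
    define h where "h x w = indicator A x * (\<Prod>s\<in>S. \<phi> s (Bc (min t s) x + w (max t s)))" for x and w :: "real \<Rightarrow> real ^ 'd"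
    have hm: "(\<lambda>(x, w). h x w) \<in> borel_measurable (F t \<Otimes>\<^sub>M ?P)"
      unfolding h_def split_beta'
    proof (rule borel_measurable_times)
      show "(\<lambda>x. indicator A (fst x) :: real) \<in> borel_measurable (F t \<Otimes>\<^sub>M ?P)"
        using A by measurable
      show "(\<lambda>x. \<Prod>s\<in>S. \<phi> s (Bc (min t s) (fst x) + snd x (max t s))) \<in> borel_measurable (F t \<Otimes>\<^sub>M ?P)"
      proof (rule borel_measurable_prod, rule measurable_compose[OF _ \<phi>m], rule borel_measurable_add)
        fix s assume s: "s \<in> S"
        show "(\<lambda>x. Bc (min t s) (fst x)) \<in> borel_measurable (F t \<Otimes>\<^sub>M ?P)"
          by (rule measurable_compose[OF measurable_fst Bc_measurable_F[OF mm(1)[OF s t]]])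
        show "(\<lambda>x. snd x (max t s)) \<in> borel_measurable (F t \<Otimes>\<^sub>M ?P)"
          by (rule measurable_compose[OF measurable_snd measurable_component_singleton]) (use s in auto)
      qed
    qed
    have hb: "norm (h x w) \<le> 1" for x w
      using prod01[of "\<lambda>s. Bc (min t s) x + w (max t s)"] by (auto simp: h_def indicator_def abs_le_iff intro: order_trans[of _ 0])
    interpret P1: prob_space "distr Mc (F t) (\<lambda>\<omega>. \<omega>)" by (rule Mc.prob_space_distr[OF rv(1)])
    interpret P2: prob_space "distr Mc ?P ?W" by (rule Mc.prob_space_distr[OF rv(2)])
    interpret PP: pair_prob_space "distr Mc (F t) (\<lambda>\<omega>. \<omega>)" "distr Mc ?P ?W" ..
    have dist: "distr Mc (F t) (\<lambda>\<omega>. \<omega>) \<Otimes>\<^sub>M distr Mc ?P ?W = distr Mc (F t \<Otimes>\<^sub>M ?P) (\<lambda>\<omega>. (\<omega>, ?W \<omega>))"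
      by (rule indep_F_increments[OF t I])
    have pairm: "(\<lambda>\<omega>. (\<omega>, ?W \<omega>)) \<in> measurable Mc (F t \<Otimes>\<^sub>M ?P)" using rv by measurable
    have "(\<integral>\<omega>. indicator A \<omega> * (\<Prod>s\<in>S. \<phi> s (Bc s \<omega>)) \<partial>Mc) = (\<integral>\<omega>. h \<omega> (?W \<omega>) \<partial>Mc)"
    proof (rule Bochner_Integration.integral_cong)
      fix \<omega>
      have "Bc (min t s) \<omega> + ?W \<omega> (max t s) = Bc s \<omega>" if "s \<in> S" for s
        using that by (auto simp: min_def max_def)
      then show "indicator A \<omega> * (\<Prod>s\<in>S. \<phi> s (Bc s \<omega>)) = h \<omega> (?W \<omega>)"
        unfolding h_def by (metis (mono_tags, lifting) prod.cong)
    qed simp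
    also have "\<dots> = (\<integral>x. (\<lambda>(x, w). h x w) x \<partial>distr Mc (F t \<Otimes>\<^sub>M ?P) (\<lambda>\<omega>. (\<omega>, ?W \<omega>)))"
      by (subst integral_distr[OF pairm hm]) simp
    also have "\<dots> = (\<integral>x. (\<lambda>(x, w). h x w) x \<partial>(distr Mc (F t) (\<lambda>\<omega>. \<omega>) \<Otimes>\<^sub>M distr Mc ?P ?W))"
      by (simp only: dist)
    also have "\<dots> = (\<integral>x. (\<integral>w. h x w \<partial>distr Mc ?P ?W) \<partial>distr Mc (F t) (\<lambda>\<omega>. \<omega>))"
    proof (subst PP.integral_fst'[symmetric])
      show "integrable (distr Mc (F t) (\<lambda>\<omega>. \<omega>) \<Otimes>\<^sub>M distr Mc ?P ?W) (\<lambda>(x, w). h x w)"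
        by (rule PP.integrable_const_bound[where B=1]) (use hb hm in \<open>auto intro!: AE_I2\<close>)
    qed simp
    also have "\<dots> = (\<integral>\<omega>. (\<integral>w. h \<omega> w \<partial>distr Mc ?P ?W) \<partial>Mc)"
    proof (rule integral_distr[OF rv(1)])
      have "(\<lambda>x. \<integral>w. h x w \<partial>distr Mc ?P ?W) \<in> borel_measurable (F t)"
        by (rule P2.borel_measurable_lebesgue_integral) (use hm in simp)
      then show "(\<lambda>x. \<integral>w. h x w \<partial>distr Mc ?P ?W) \<in> borel_measurable (F t)" .
    qed
    also have "\<dots> = (\<integral>\<omega>. indicator A \<omega> * Q t \<omega> \<partial>Mc)"
    proof (rule Bochner_Integration.integral_cong)
      fix \<omega> assume \<omega>: "\<omega> \<in> space Mc"
      have "(\<integral>w. h \<omega> w \<partial>distr Mc ?P ?W) = (\<integral>\<omega>'. h \<omega> (?W \<omega>') \<partial>Mc)"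
        by (rule integral_distr[OF rv(2)]) (use measurable_Pair2[OF hm, of \<omega>] \<omega> in simp)
      also have "\<dots> = (\<integral>\<omega>'. indicator A \<omega> * p t \<omega> \<omega>' \<partial>Mc)"
        unfolding h_def p_def by (intro Bochner_Integration.integral_cong arg_cong2[where f="(*)"] prod.cong refl) auto
      also have "\<dots> = indicator A \<omega> * Q t \<omega>" by (simp add: Q_def)
      finally show "(\<integral>w. h \<omega> w \<partial>distr Mc ?P ?W) = indicator A \<omega> * Q t \<omega>" .
    qed simp
    finally show "(\<integral>\<omega>. indicator A \<omega> * Q t \<omega> \<partial>Mc) = (\<integral>\<omega>. indicator A \<omega> * (\<Prod>s\<in>S. \<phi> s (Bc s \<omega>)) \<partial>Mc)" ..
  next
    fix \<omega> assume \<omega>: "\<omega> \<in> space M"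
    show "continuous_on {0..T} (\<lambda>t. Q t \<omega>)"
      \<comment> \<open>Continuity is checked along sequences, so that dominated convergence with
        bound 1 can pass to the limit under the integral.\<close>
      unfolding continuous_on_sequentially comp_def Q_def
    proof (intro allI ballI impI)
      fix x :: "nat \<Rightarrow> real" and a assume a: "a \<in> {0..T}" and x: "(\<forall>n. x n \<in> {0..T}) \<and> x \<longlonglongrightarrow> a"
      show "(\<lambda>n. \<integral>\<omega>'. p (x n) \<omega> \<omega>' \<partial>Mc) \<longlonglongrightarrow> (\<integral>\<omega>'. p a \<omega> \<omega>' \<partial>Mc)"
      proof (rule integral_dominated_convergence[where w="\<lambda>_. 1"])
        show "(\<lambda>\<omega>'. p a \<omega> \<omega>') \<in> borel_measurable Mc" by (rule pm1[OF a \<omega>])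
        show "(\<lambda>\<omega>'. p (x n) \<omega> \<omega>') \<in> borel_measurable Mc" for n using x by (intro pm1 \<omega>) auto
        show "AE \<omega>' in Mc. norm (p (x n) \<omega> \<omega>') \<le> 1" for n
          using p01[of "x n" \<omega>] by (auto simp: abs_le_iff intro: order_trans[of _ 0])
        show "AE \<omega>' in Mc. (\<lambda>n. p (x n) \<omega> \<omega>') \<longlonglongrightarrow> p a \<omega> \<omega>'"
        proof (rule AE_I2)
          fix \<omega>' assume "\<omega>' \<in> space Mc"
          then have \<omega>': "\<omega>' \<in> space M" by simp
          have Bl: "(\<lambda>n. Bc (y n) z) \<longlonglongrightarrow> Bc b z"
            if z: "z \<in> space M" and y: "y \<longlonglongrightarrow> b" "b \<in> {0..T}" "\<And>n. y n \<in> {0..T}" for y :: "nat \<Rightarrow> real" and b z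
            by (rule continuous_on_tendsto_compose[OF Bc_continuous[OF z] y(1,2)]) (use y(3) in auto)
          have xT: "x \<longlonglongrightarrow> a" "\<And>n. x n \<in> {0..T}" using x by auto
          show "(\<lambda>n. p (x n) \<omega> \<omega>') \<longlonglongrightarrow> p a \<omega> \<omega>'"
            unfolding p_def
          proof (rule tendsto_prod)
            fix s assume s: "s \<in> S"
            show "(\<lambda>n. \<phi> s (Bc (min (x n) s) \<omega> + (Bc (max (x n) s) \<omega>' - Bc (x n) \<omega>'))) \<longlonglongrightarrow>
              \<phi> s (Bc (min a s) \<omega> + (Bc (max a s) \<omega>' - Bc a \<omega>'))"
            proof (rule continuous_on_tendsto_compose[OF \<phi>(1)])
              show "(\<lambda>n. Bc (min (x n) s) \<omega> + (Bc (max (x n) s) \<omega>' - Bc (x n) \<omega>')) \<longlonglongrightarrow>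
                Bc (min a s) \<omega> + (Bc (max a s) \<omega>' - Bc a \<omega>')"
              proof (intro tendsto_add tendsto_diff)
                have sT: "s \<in> {0..T}" using s S by auto
                have mmT: "min u s \<in> {0..T}" "max u s \<in> {0..T}" if "u \<in> {0..T}" for u using that sT by auto
                show "(\<lambda>n. Bc (min (x n) s) \<omega>) \<longlonglongrightarrow> Bc (min a s) \<omega>"
                  by (rule Bl[OF \<omega> tendsto_min[OF xT(1) tendsto_const] mmT(1)[OF a] mmT(1)[OF xT(2)]])
                show "(\<lambda>n. Bc (max (x n) s) \<omega>') \<longlonglongrightarrow> Bc (max a s) \<omega>'"
                  by (rule Bl[OF \<omega>' tendsto_max[OF xT(1) tendsto_const] mmT(2)[OF a] mmT(2)[OF xT(2)]])
                show "(\<lambda>n. Bc (x n) \<omega>') \<longlonglongrightarrow> Bc a \<omega>'"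
                  by (rule Bl[OF \<omega>' xT(1) a xT(2)])
              qed
            qed auto
          qed
        qed
      qed simp
    qed
  qed
  then show ?thesis by (auto simp: has_martingale_def)
qed

section \<open>From products to arbitrary terminal variables in [0, 1]\<close>

lemma has_martingale_cong:
  assumes "has_martingale \<xi>" "AE \<omega> in Mc. \<xi>' \<omega> = \<xi> \<omega>" "\<xi> \<in> borel_measurable Mc" "\<xi>' \<in> borel_measurable Mc"
  shows "has_martingale \<xi>'"
proof -
  obtain Q C where Q: "martingale_version \<xi> Q C" using assms(1) by (auto simp: has_martingale_def)
  have "martingale_version \<xi>' Q C"
    by (rule martingale_version_modify[OF Q, of "{}"])
      (use assms martingale_versionD(2,3)[OF Q] in auto)
  then show ?thesis by (auto simp: has_martingale_def)
qed

lemma has_martingale_sum: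
  assumes "finite J" "\<And>j. j \<in> J \<Longrightarrow> has_martingale (X j)" "\<And>j. j \<in> J \<Longrightarrow> X j \<in> borel_measurable Mc"
    "\<And>j \<omega>. j \<in> J \<Longrightarrow> \<omega> \<in> space M \<Longrightarrow> \<bar>X j \<omega>\<bar> \<le> 1"
  shows "has_martingale (\<lambda>\<omega>. \<Sum>j\<in>J. c * X j \<omega>)"
  using assms
proof (induction J rule: finite_induct)
  case empty
  then show ?case using martingale_version_const[of 0] by (auto simp: has_martingale_def)
next
  case (insert j J)
  have "has_martingale (\<lambda>\<omega>. \<Sum>j\<in>J. c * X j \<omega>)" using insert by auto
  then obtain Q1 C1 where 1: "martingale_version (\<lambda>\<omega>. \<Sum>j\<in>J. c * X j \<omega>) Q1 C1" by (auto simp: has_martingale_def)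
  obtain Q2 C2 where 2: "martingale_version (X j) Q2 C2" using insert(4)[of j] by (auto simp: has_martingale_def)
  have "martingale_version (\<lambda>\<omega>. c * X j \<omega> + 1 * (\<Sum>j\<in>J. c * X j \<omega>)) (\<lambda>t \<omega>. c * Q2 t \<omega> + 1 * Q1 t \<omega>) (\<bar>c\<bar> * C2 + \<bar>1\<bar> * C1)"
  proof (rule martingale_version_lin[OF 2 1, where D=1 and D'="\<Sum>j\<in>J. \<bar>c\<bar>"])
    show "X j \<in> borel_measurable Mc" using insert by simp
    show "(\<lambda>\<omega>. \<Sum>j\<in>J. c * X j \<omega>) \<in> borel_measurable Mc"
      using insert by (intro borel_measurable_sum borel_measurable_times borel_measurable_const) auto
    fix \<omega> assume \<omega>: "\<omega> \<in> space M"
    show "\<bar>X j \<omega>\<bar> \<le> 1" using insert \<omega> by simp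
    have "\<bar>\<Sum>j\<in>J. c * X j \<omega>\<bar> \<le> (\<Sum>j\<in>J. \<bar>c * X j \<omega>\<bar>)" by (rule sum_abs)
    also have "\<dots> \<le> (\<Sum>j\<in>J. \<bar>c\<bar>)"
      using insert \<omega> by (intro sum_mono) (auto simp: abs_mult intro!: mult_left_le)
    finally show "\<bar>\<Sum>j\<in>J. c * X j \<omega>\<bar> \<le> (\<Sum>j\<in>J. \<bar>c\<bar>)" .
  qed
  then show ?case using insert(1,2) by (auto simp: has_martingale_def)
qed

lemma has_martingale_dominated:
  assumes hm: "\<And>n::nat. has_martingale (\<xi>n n)"
    and \<xi>n: "\<And>n. \<xi>n n \<in> borel_measurable Mc" "\<And>n \<omega>. \<omega> \<in> space M \<Longrightarrow> \<xi>n n \<omega> \<in> {0..1}"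
    and \<xi>: "\<xi> \<in> borel_measurable Mc" "\<And>\<omega>. \<omega> \<in> space M \<Longrightarrow> \<xi> \<omega> \<in> {0..1}"
    and lim: "AE \<omega> in Mc. (\<lambda>n. \<xi>n n \<omega>) \<longlonglongrightarrow> \<xi> \<omega>"
  shows "has_martingale \<xi>"
proof (rule has_martingale_limit[OF hm \<xi>n \<xi>])
  have "(\<lambda>n. \<integral>\<omega>. \<bar>\<xi>n n \<omega> - \<xi> \<omega>\<bar> \<partial>Mc) \<longlonglongrightarrow> (\<integral>\<omega>. 0 \<partial>Mc)"
  proof (rule integral_dominated_convergence[where w="\<lambda>_. 1"])
    show "(\<lambda>\<omega>. \<bar>\<xi>n n \<omega> - \<xi> \<omega>\<bar>) \<in> borel_measurable Mc" for n using \<xi>n \<xi> by measurable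
    show "AE \<omega> in Mc. (\<lambda>n. \<bar>\<xi>n n \<omega> - \<xi> \<omega>\<bar>) \<longlonglongrightarrow> 0"
      using lim by eventually_elim (auto intro!: tendsto_rabs_zero simp: LIM_zero)
    show "AE \<omega> in Mc. norm \<bar>\<xi>n n \<omega> - \<xi> \<omega>\<bar> \<le> 1" for n
    proof (rule AE_I2)
      fix \<omega> assume "\<omega> \<in> space Mc"
      then show "norm \<bar>\<xi>n n \<omega> - \<xi> \<omega>\<bar> \<le> 1" using \<xi>n(2)[of \<omega> n] \<xi>(2)[of \<omega>] by auto
    qed
  qed auto
  then show "(\<lambda>n. \<integral>\<omega>. \<bar>\<xi>n n \<omega> - \<xi> \<omega>\<bar> \<partial>Mc) \<longlonglongrightarrow> 0" by simp
qed

text \<open>The indicator of a nonempty closed set C is the limit of the continuous functions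
  \<open>max 0 (1 - n * infdist x C)\<close>, which brings cylinders within reach of
  \<open>has_martingale_prod\<close>.\<close>

lemma has_martingale_Cyl:
  assumes A: "A \<in> Cyl T" shows "has_martingale (indicator A)"
proof -
  from CylD(2)[OF A] obtain R C where 1: "finite R" "R \<subseteq> {0..T}" "\<forall>r. closed (C r)"
    "AE \<omega> in Mc. \<omega> \<in> A \<longleftrightarrow> (\<forall>r\<in>R. Bc r \<omega> \<in> C r)"
    by blast
  \<comment> \<open>The empty set is treated apart because \<open>infdist x {}\<close> is 0 by
    convention, which would yield the constant 1.\<close>
  define \<phi> where "\<phi> n r x = (if C r = {} then 0 else max 0 (1 - real n * infdist x (C r)))" for n r and x :: "real ^ 'd"
  have \<phi>: "continuous_on UNIV (\<phi> n r)" "\<phi> n r x \<in> {0..1}" for n r x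
    unfolding \<phi>_def by (cases "C r = {}") (auto intro!: continuous_intros simp: infdist_nonneg)
  have \<phi>lim: "(\<lambda>n. \<phi> n r x) \<longlonglongrightarrow> indicator (C r) x" for r x
  proof (cases "C r = {} \<or> x \<in> C r")
    case True
    then show ?thesis by (cases "C r = {}") (auto simp: \<phi>_def)
  next
    case False
    then have pos: "0 < infdist x (C r)" using 1(3) in_closed_iff_infdist_zero[of "C r" x] infdist_nonneg[of x "C r"] by force
    obtain m :: nat where m: "1 / infdist x (C r) < real m" using reals_Archimedean2 by blast
    have "\<phi> n r x = 0" if "m \<le> n" for n
    proof -
      have "1 \<le> real m * infdist x (C r)" using m pos by (simp add: pos_divide_less_eq)
      also have "\<dots> \<le> real n * infdist x (C r)" using that pos by (intro mult_right_mono) auto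
      finally show ?thesis by (simp add: \<phi>_def)
    qed
    then have "eventually (\<lambda>n. \<phi> n r x = 0) sequentially" by (auto simp: eventually_sequentially)
    then show ?thesis using False by (auto intro: tendsto_eventually)
  qed
  show ?thesis
  proof (rule has_martingale_dominated[where \<xi>n="\<lambda>n \<omega>. \<Prod>r\<in>R. \<phi> n r (Bc r \<omega>)"])
    show "has_martingale (\<lambda>\<omega>. \<Prod>r\<in>R. \<phi> n r (Bc r \<omega>))" for n
      by (rule has_martingale_prod[OF 1(1,2) \<phi>])
    show "(\<lambda>\<omega>. \<Prod>r\<in>R. \<phi> n r (Bc r \<omega>)) \<in> borel_measurable Mc" for n
    proof (rule borel_measurable_prod)
      fix r assume "r \<in> R"
      then show "(\<lambda>\<omega>. \<phi> n r (Bc r \<omega>)) \<in> borel_measurable Mc"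
        using measurable_compose[OF Bc_measurable borel_measurable_continuous_onI[OF \<phi>(1)]] 1(2) by auto
    qed
    show "(\<Prod>r\<in>R. \<phi> n r (Bc r \<omega>)) \<in> {0..1}" for n \<omega>
      using \<phi>(2) by (auto intro!: prod_nonneg prod_le_1)
    show "indicator A \<in> borel_measurable Mc" using CylD(1)[OF A] by simp
    show "AE \<omega> in Mc. (\<lambda>n. \<Prod>r\<in>R. \<phi> n r (Bc r \<omega>)) \<longlonglongrightarrow> indicator A \<omega>"
      using 1(4)
    proof eventually_elim
      case (elim \<omega>)
      have "(\<lambda>n. \<Prod>r\<in>R. \<phi> n r (Bc r \<omega>)) \<longlonglongrightarrow> (\<Prod>r\<in>R. indicator (C r) (Bc r \<omega>))"
        by (intro tendsto_prod \<phi>lim)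
      also have "(\<Prod>r\<in>R. indicator (C r) (Bc r \<omega>)) = (indicator A \<omega> :: real)"
        using elim 1(1) by (auto simp: indicator_def prod_zero_iff)
      finally show ?case .
    qed
  qed (auto simp: indicator_def)
qed

text \<open>A Dynkin argument over the cylinders: complements use linearity, disjoint unions are
  dominated limits of finite sums.\<close>

lemma has_martingale_indicator:
  assumes A: "A \<in> sets (F T)" shows "has_martingale (indicator A)"
proof -
  have A': "A \<in> sigma_sets (space M) (Cyl T)" using sets_F_subset_Cyl[of T] T_pos A by auto
  have CP: "Cyl T \<subseteq> Pow (space M)" using CylD(1) sets.sets_into_space[of _ Mc] by fastforce
  have M: "B \<in> sets Mc" if "B \<in> sigma_sets (space M) (Cyl T)" for B
  proof -
    have "sigma_sets (space Mc) (Cyl T) \<subseteq> sets Mc" by (rule sets.sigma_sets_subset) (use CylD(1) in auto)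
    then show ?thesis using that by auto
  qed
  show ?thesis
    using Int_stable_Cyl CP A'
  proof (induct A rule: sigma_sets_induct_disjoint)
    case (basic A)
    then show ?case by (rule has_martingale_Cyl)
  next
    case empty
    show ?case using martingale_version_const[of 0] by (auto simp: has_martingale_def indicator_def)
  next
    case (compl A)
    obtain Q C where Q: "martingale_version (indicator A) Q C" using compl(2) by (auto simp: has_martingale_def)
    have "martingale_version (\<lambda>\<omega>. 1 * (\<lambda>_. 1) \<omega> + (-1) * indicator A \<omega>) (\<lambda>t \<omega>. 1 * (\<lambda>_ _. 1) t \<omega> + (-1) * Q t \<omega>) (\<bar>1\<bar> * \<bar>1\<bar> + \<bar>-1\<bar> * C)"
      by (rule martingale_version_lin[OF martingale_version_const Q, where D=1 and D'=1]) (use M[OF compl(1)] in \<open>auto simp: indicator_def\<close>)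
    then have "has_martingale (\<lambda>\<omega>. 1 - indicator A \<omega>)" by (auto simp: has_martingale_def)
    then show ?case
    proof (rule has_martingale_cong)
      show "AE \<omega> in Mc. indicator (space M - A) \<omega> = (1 - indicator A \<omega> :: real)"
        by (rule AE_I2) (auto simp: indicator_def)
      show "(\<lambda>\<omega>. 1 - indicator A \<omega> :: real) \<in> borel_measurable Mc"
        using M[OF compl(1)] by measurable
      show "(indicator (space M - A) :: 'a \<Rightarrow> real) \<in> borel_measurable Mc"
        using sets.compl_sets[OF M[OF compl(1)]] by (intro borel_measurable_indicator) simp
    qed
  next
    case (union A)
    have MA: "A i \<in> sets Mc" for i using M union(2) by auto
    show ?case
    proof (rule has_martingale_dominated[where \<xi>n="\<lambda>n. indicator (\<Union>i<n. A i)"])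
      fix n
      have eq: "(\<Sum>i<n. 1 * indicator (A i) \<omega>) = (indicator (\<Union>i<n. A i) \<omega> :: real)" for \<omega>
      proof -
        have dj: "disjoint_family_on A {..<n}" using union(1) by (simp add: disjoint_family_on_def)
        show ?thesis by (simp add: indicator_UN_disjoint[OF finite_lessThan dj])
      qed
      have "has_martingale (\<lambda>\<omega>. \<Sum>i<n. 1 * indicator (A i) \<omega>)"
        by (rule has_martingale_sum) (use union(3) MA in \<open>auto simp: indicator_def\<close>)
      then show "has_martingale (indicator (\<Union>i<n. A i))" unfolding eq .
    next
      show "AE \<omega> in Mc. (\<lambda>n. indicator (\<Union>i<n. A i) \<omega>) \<longlonglongrightarrow> (indicator (\<Union>i. A i) \<omega> :: real)"
        by (intro AE_I2 LIMSEQ_indicator_UN)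
    qed (use MA in \<open>auto simp: indicator_def\<close>)
  qed
qed

text \<open>Rounding \<xi> down to multiples of 1/(n+1) gives an average of indicators of level
  sets, which reduces the claim to indicators and a dominated limit.\<close>

lemma continuous_martingale:
  assumes \<xi>: "\<xi> \<in> borel_measurable (F T)" "\<And>\<omega>. \<omega> \<in> space M \<Longrightarrow> \<xi> \<omega> \<in> {0..1}"
  shows "\<exists>Q. martingale_version \<xi> Q 1 \<and> (\<forall>t \<omega>. Q t \<omega> \<in> {0..1})"
proof -
  have \<xi>M: "\<xi> \<in> borel_measurable Mc" by (rule measurable_F_Mc[OF order_refl \<xi>(1)])
  define A where "A n k = {\<omega> \<in> space (F T). real k / real (Suc n) \<le> \<xi> \<omega>}" for n k :: nat
  have A: "A n k \<in> sets (F T)" for n k unfolding A_def using \<xi>(1) by measurable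
  have AM: "A n k \<in> sets Mc" for n k using A sets_F_Mc[of T] by auto
  define \<xi>n where "\<xi>n n \<omega> = (\<Sum>k\<in>{1..Suc n}. (1 / real (Suc n)) * indicator (A n k) \<omega>)" for n \<omega>
  \<comment> \<open>The sum counts the levels k between 1 and (n+1) \<xi>; as \<xi> \<le> 1, none of
    these is cut off at n+1 and the count is the floor.\<close>
  have val: "\<xi>n n \<omega> = real_of_int \<lfloor>real (Suc n) * \<xi> \<omega>\<rfloor> / real (Suc n)" if \<omega>: "\<omega> \<in> space M" for n \<omega>
  proof -
    have x: "0 \<le> \<xi> \<omega>" "\<xi> \<omega> \<le> 1" using \<xi>(2)[OF \<omega>] by auto
    have le: "real (Suc n) * \<xi> \<omega> \<le> real (Suc n)" using mult_left_mono[OF x(2), of "real (Suc n)"] by simp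
    have nn: "0 \<le> real (Suc n) * \<xi> \<omega>" using x by simp
    have "(\<Sum>k\<in>{1..Suc n}. indicator (A n k) \<omega> :: real) = real (card {k \<in> {1..Suc n}. \<omega> \<in> A n k})"
      unfolding indicator_def by (subst sum_of_bool_eq) (auto simp: Int_def simp del: sum.cl_ivl_Suc)
    also have "{k \<in> {1..Suc n}. \<omega> \<in> A n k} = {1..nat \<lfloor>real (Suc n) * \<xi> \<omega>\<rfloor>}"
    proof (intro set_eqI iffI)
      fix k assume "k \<in> {k \<in> {1..Suc n}. \<omega> \<in> A n k}"
      then have k: "1 \<le> k" "real k / real (Suc n) \<le> \<xi> \<omega>" by (auto simp: A_def)
      then have "real k \<le> real (Suc n) * \<xi> \<omega>" by (simp add: pos_divide_le_eq mult.commute del: of_nat_Suc)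
      then have "int k \<le> \<lfloor>real (Suc n) * \<xi> \<omega>\<rfloor>" by linarith
      then show "k \<in> {1..nat \<lfloor>real (Suc n) * \<xi> \<omega>\<rfloor>}" using k(1) by auto
    next
      fix k assume k: "k \<in> {1..nat \<lfloor>real (Suc n) * \<xi> \<omega>\<rfloor>}"
      then have "int k \<le> \<lfloor>real (Suc n) * \<xi> \<omega>\<rfloor>" by auto
      then have 1: "real k \<le> real (Suc n) * \<xi> \<omega>" by linarith
      then have "real k / real (Suc n) \<le> \<xi> \<omega>" by (simp add: pos_divide_le_eq mult.commute del: of_nat_Suc)
      moreover have "real k \<le> real (Suc n)" using 1 le by linarith
      ultimately show "k \<in> {k \<in> {1..Suc n}. \<omega> \<in> A n k}" using k \<omega> by (auto simp: A_def)
    qed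
    also have "real (card {1..nat \<lfloor>real (Suc n) * \<xi> \<omega>\<rfloor>}) = real_of_int \<lfloor>real (Suc n) * \<xi> \<omega>\<rfloor>"
      using nn by simp
    finally show ?thesis unfolding \<xi>n_def sum_distrib_left[symmetric] by simp
  qed
  have bd: "\<xi>n n \<omega> \<le> \<xi> \<omega>" "\<xi> \<omega> - 1 / real (Suc n) \<le> \<xi>n n \<omega>" if \<omega>: "\<omega> \<in> space M" for n \<omega>
  proof -
    have "real_of_int \<lfloor>real (Suc n) * \<xi> \<omega>\<rfloor> / real (Suc n) \<le> real (Suc n) * \<xi> \<omega> / real (Suc n)"
      by (rule divide_right_mono) auto
    then show "\<xi>n n \<omega> \<le> \<xi> \<omega>" unfolding val[OF \<omega>] by (simp del: of_nat_Suc)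
    have "(real (Suc n) * \<xi> \<omega> - 1) / real (Suc n) \<le> real_of_int \<lfloor>real (Suc n) * \<xi> \<omega>\<rfloor> / real (Suc n)"
      by (rule divide_right_mono) (linarith, simp)
    then show "\<xi> \<omega> - 1 / real (Suc n) \<le> \<xi>n n \<omega>" unfolding val[OF \<omega>] by (simp add: diff_divide_distrib del: of_nat_Suc)
  qed
  have hm: "has_martingale \<xi>"
  proof (rule has_martingale_dominated[where \<xi>n=\<xi>n])
    show "has_martingale (\<xi>n n)" for n
      unfolding \<xi>n_def by (rule has_martingale_sum) (use has_martingale_indicator[OF A] AM in \<open>auto split: split_indicator\<close>)
    show "\<xi>n n \<in> borel_measurable Mc" for n
      unfolding \<xi>n_def using AM by measurable
    show "\<xi>n n \<omega> \<in> {0..1}" if "\<omega> \<in> space M" for n \<omega>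
    proof -
      have "0 \<le> \<xi>n n \<omega>" unfolding \<xi>n_def by (intro sum_nonneg) auto
      then show ?thesis using bd(1)[OF that, of n] \<xi>(2)[OF that] by auto
    qed
    show "AE \<omega> in Mc. (\<lambda>n. \<xi>n n \<omega>) \<longlonglongrightarrow> \<xi> \<omega>"
    proof (rule AE_I2)
      fix \<omega> assume "\<omega> \<in> space Mc"
      then have \<omega>: "\<omega> \<in> space M" by simp
      show "(\<lambda>n. \<xi>n n \<omega>) \<longlonglongrightarrow> \<xi> \<omega>"
      proof (rule tendsto_sandwich)
        show "\<forall>\<^sub>F n in sequentially. \<xi> \<omega> - 1 / real (Suc n) \<le> \<xi>n n \<omega>" using bd(2)[OF \<omega>] by simp
        show "\<forall>\<^sub>F n in sequentially. \<xi>n n \<omega> \<le> \<xi> \<omega>" using bd(1)[OF \<omega>] by simp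
        show "(\<lambda>n. \<xi> \<omega> - 1 / real (Suc n)) \<longlonglongrightarrow> \<xi> \<omega>"
          using tendsto_diff[OF tendsto_const LIMSEQ_Suc[OF lim_inverse_n], of "\<xi> \<omega>"] by (simp add: inverse_eq_divide)
      qed auto
    qed
  qed (use \<xi>M \<xi> in auto)
  show ?thesis
  proof (rule martingale_clip[OF hm \<xi>M \<xi>(2)])
    fix Q assume "martingale_version \<xi> Q 1" and Q: "\<And>t \<omega>. Q t \<omega> \<in> {0..1}"
    moreover have "\<forall>t \<omega>. Q t \<omega> \<in> {0..1}" using Q by blast
    ultimately show "\<exists>Q. martingale_version \<xi> Q 1 \<and> (\<forall>t \<omega>. Q t \<omega> \<in> {0..1})"
      by (intro exI[of _ Q] conjI)
  qed
qed

end

section \<open>Optional times\<close>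

context brownian_setting
begin

interpretation Mc: prob_space Mc by (rule prob_space_Mc)

text \<open>The strict inequality is the form that rational times deliver, without recourse to right
  continuity of the filtration. The minimum with T respects that B is controlled only on
  [0, T].\<close>

definition optional_time :: "('a \<Rightarrow> real) \<Rightarrow> bool" where
  "optional_time \<rho> \<longleftrightarrow> (\<forall>\<omega>\<in>space M. \<rho> \<omega> \<in> {0..T}) \<and>
     (\<forall>u>0. {\<omega> \<in> space M. \<rho> \<omega> < u} \<in> sets (F (min u T)))"

lemma optional_time_measurable:
  assumes "optional_time \<rho>"
  shows "\<rho> \<in> borel_measurable (F T)"
proof (rule borel_measurableI_less)
  fix u :: real
  show "{\<omega> \<in> space (F T). \<rho> \<omega> < u} \<in> sets (F T)"
  proof (cases "0 < u")
    case True
    then have "{\<omega> \<in> space M. \<rho> \<omega> < u} \<in> sets (F (min u T))" using assms by (simp add: optional_time_def)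
    then show ?thesis using sets_F_mono[of "min u T" T] by auto
  next
    case False
    then have "{\<omega> \<in> space (F T). \<rho> \<omega> < u} = {}" using assms by (force simp: optional_time_def)
    then show ?thesis by (simp only: sets.empty_sets)
  qed
qed

text \<open>Intersect the sets \<open>\<rho> < v\<close> over v decreasing to s; each v is at most
  u, so nothing later than u is consulted.\<close>

lemma optional_time_le:
  assumes \<rho>: "optional_time \<rho>" and s: "0 \<le> s" "s < u"
  shows "{\<omega> \<in> space M. \<rho> \<omega> \<le> s} \<in> sets (F (min u T))"
proof -
  define v where "v m = s + (u - s) / real (Suc m)" for m :: nat
  have v: "s < v m" "v m \<le> u" for m
  proof -
    show "s < v m" using s by (simp add: v_def)
    have "(u - s) / real (Suc m) \<le> (u - s) / 1" using s by (intro divide_left_mono) auto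
    then show "v m \<le> u" by (simp add: v_def)
  qed
  have vlim: "v \<longlonglongrightarrow> s"
    using tendsto_add[OF tendsto_const LIMSEQ_Suc[OF lim_const_over_n], of s "u - s"] unfolding v_def by simp
  have "{\<omega> \<in> space M. \<rho> \<omega> \<le> s} = (\<Inter>m. {\<omega> \<in> space M. \<rho> \<omega> < v m})"
  proof (intro set_eqI iffI)
    fix \<omega> assume "\<omega> \<in> (\<Inter>m. {\<omega> \<in> space M. \<rho> \<omega> < v m})"
    then have "\<omega> \<in> space M" "\<And>m. \<rho> \<omega> < v m" by auto
    moreover have "\<rho> \<omega> \<le> s" by (rule LIMSEQ_le_const[OF vlim]) (use calculation in \<open>auto intro: less_imp_le\<close>)
    ultimately show "\<omega> \<in> {\<omega> \<in> space M. \<rho> \<omega> \<le> s}" by simp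
  qed (use v in \<open>auto intro: le_less_trans\<close>)
  also have "\<dots> \<in> sets (F (min u T))"
  proof (rule sets.countable_INT)
    show "range (\<lambda>m. {\<omega> \<in> space M. \<rho> \<omega> < v m}) \<subseteq> sets (F (min u T))"
    proof safe
      fix m
      have "0 < v m" using v(1)[of m] s by linarith
      then have "{\<omega> \<in> space M. \<rho> \<omega> < v m} \<in> sets (F (min (v m) T))" using \<rho> by (simp add: optional_time_def)
      moreover have "min (v m) T \<le> min u T" using v(2)[of m] by auto
      ultimately show "{\<omega> \<in> space M. \<rho> \<omega> < v m} \<in> sets (F (min u T))" using sets_F_mono by blast
    qed
  qed simp
  finally show ?thesis .
qed

text \<open>For a rectangle ]s, t] x S with s < u the set S is already known at u, and complements
  are taken within \<open>\<rho> < u\<close>. Events of this form play the part of the events known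
  at \<rho>.\<close>

lemma optional_time_event:
  assumes \<rho>: "optional_time \<rho>" and D: "D \<in> sets Pr" and u: "0 < u"
  shows "{\<omega> \<in> space M. (\<rho> \<omega>, \<omega>) \<in> D \<and> \<rho> \<omega> < u} \<in> sets (F (min u T))"
proof -
  have lt: "{\<omega> \<in> space M. \<rho> \<omega> < u} \<in> sets (F (min u T))" using \<rho> u by (simp add: optional_time_def)
  have range: "\<rho> \<omega> \<in> {0..T}" if "\<omega> \<in> space M" for \<omega> using \<rho> that by (simp add: optional_time_def)
  show ?thesis
    using D unfolding sets_Pr
  proof (induct rule: sigma_sets.induct)
    case (Basic D)
    then consider (1) S where "D = {0} \<times> S" "S \<in> sets (F 0)"
      | (2) s t S where "D = {s<..t} \<times> S" "0 \<le> s" "s < t" "t \<le> T" "S \<in> sets (F s)"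
      by blast
    then show ?case
    proof cases
      case 1
      have "S \<in> sets (F (min u T))" using 1 sets_F_mono[of 0 "min u T"] u T_pos by auto
      moreover have "{\<omega> \<in> space M. \<rho> \<omega> \<le> 0} \<in> sets (F (min u T))" using optional_time_le[OF \<rho> order_refl u] .
      moreover have "{\<omega> \<in> space M. (\<rho> \<omega>, \<omega>) \<in> D \<and> \<rho> \<omega> < u} = S \<inter> {\<omega> \<in> space M. \<rho> \<omega> \<le> 0}"
        using 1 u range by (force intro: antisym)
      ultimately show ?thesis by auto
    next
      case 2
      show ?thesis
      proof (cases "s < u")
        case False
        then have "{\<omega> \<in> space M. (\<rho> \<omega>, \<omega>) \<in> D \<and> \<rho> \<omega> < u} = {}" using 2 by auto
        then show ?thesis by (simp only: sets.empty_sets)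
      next
        case True
        have S: "S \<in> sets (F (min u T))" using 2 True sets_F_mono[of s "min u T"] by auto
        have les: "{\<omega> \<in> space M. \<rho> \<omega> \<le> s} \<in> sets (F (min u T))" using optional_time_le[OF \<rho> 2(2) True] .
        have let': "{\<omega> \<in> space M. \<rho> \<omega> \<le> t \<and> \<rho> \<omega> < u} \<in> sets (F (min u T))"
        proof (cases "t < u")
          case True
          then have "{\<omega> \<in> space M. \<rho> \<omega> \<le> t \<and> \<rho> \<omega> < u} = {\<omega> \<in> space M. \<rho> \<omega> \<le> t}" by auto
          then show ?thesis using optional_time_le[OF \<rho> _ True] 2 by simp
        next
          case False
          then have "{\<omega> \<in> space M. \<rho> \<omega> \<le> t \<and> \<rho> \<omega> < u} = {\<omega> \<in> space M. \<rho> \<omega> < u}" by auto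
          then show ?thesis using lt by simp
        qed
        have "{\<omega> \<in> space M. (\<rho> \<omega>, \<omega>) \<in> D \<and> \<rho> \<omega> < u} =
            S \<inter> ({\<omega> \<in> space M. \<rho> \<omega> \<le> t \<and> \<rho> \<omega> < u} - {\<omega> \<in> space M. \<rho> \<omega> \<le> s})"
          using 2 by auto
        then show ?thesis using S les let' by (simp add: sets.Int sets.Diff)
      qed
    qed
  next
    case Empty
    show ?case by simp
  next
    case (Compl D)
    have "{\<omega> \<in> space M. (\<rho> \<omega>, \<omega>) \<in> {0..T} \<times> space M - D \<and> \<rho> \<omega> < u} =
        {\<omega> \<in> space M. \<rho> \<omega> < u} - {\<omega> \<in> space M. (\<rho> \<omega>, \<omega>) \<in> D \<and> \<rho> \<omega> < u}"
      using range by auto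
    then show ?case using lt Compl by (simp add: sets.Diff)
  next
    case (Union D)
    have "{\<omega> \<in> space M. (\<rho> \<omega>, \<omega>) \<in> (\<Union>i. D i) \<and> \<rho> \<omega> < u} = (\<Union>i. {\<omega> \<in> space M. (\<rho> \<omega>, \<omega>) \<in> D i \<and> \<rho> \<omega> < u})"
      by auto
    also have "\<dots> \<in> sets (F (min u T))" using Union by (intro sets.countable_UN) auto
    finally show ?case .
  qed
qed

lemma optional_time_event_T:
  assumes \<rho>: "optional_time \<rho>" and D: "D \<in> sets Pr"
  shows "{\<omega> \<in> space M. (\<rho> \<omega>, \<omega>) \<in> D} \<in> sets (F T)"
proof -
  \<comment> \<open>Any bound above T makes the constraint on \<rho> void, and the cut-off at T
    returns \<open>F T\<close>.\<close>
  have "{\<omega> \<in> space M. (\<rho> \<omega>, \<omega>) \<in> D \<and> \<rho> \<omega> < T + 1} \<in> sets (F (min (T + 1) T))"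
    using optional_time_event[OF assms, of "T + 1"] T_pos by simp
  moreover have "{\<omega> \<in> space M. (\<rho> \<omega>, \<omega>) \<in> D \<and> \<rho> \<omega> < T + 1} = {\<omega> \<in> space M. (\<rho> \<omega>, \<omega>) \<in> D}"
    using \<rho> by (force simp: optional_time_def)
  ultimately show ?thesis by simp
qed

lemma martingale_predictable:
  assumes "martingale_version \<xi> Q C"
  shows "predictable_process M T B Q"
proof (rule left_continuous_adapted_predictable)
  show "Q t \<in> borel_measurable (F t)" if "t \<in> {0..T}" for t
    by (rule martingale_versionD(1)[OF assms that])
  fix \<omega> t assume \<omega>: "\<omega> \<in> space M" and t: "t \<in> {0<..T}"
  have "((\<lambda>s. Q s \<omega>) \<longlongrightarrow> Q t \<omega>) (at t within {0..T})"
    using martingale_versionD(2)[OF assms \<omega>] t by (auto simp: continuous_on_def)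
  moreover have "at_left t = at t within {0..<t}"
    by (rule at_within_nhd[of t "{0<..}"]) (use t in auto)
  ultimately show "((\<lambda>s. Q s \<omega>) \<longlongrightarrow> Q t \<omega>) (at_left t)"
    using t by (auto elim!: tendsto_within_subset)
qed

text \<open>\<rho> is approximated strictly from the right by grid times. The piece of A on which
  the approximation takes a given value is known at that value, so the martingale identity applies
  piece by piece, and continuity of Q passes to the limit.\<close>

lemma optional_sampling:
  assumes Q: "martingale_version \<xi> Q C" and \<xi>: "\<xi> \<in> borel_measurable Mc" "\<And>\<omega>. \<omega> \<in> space M \<Longrightarrow> \<bar>\<xi> \<omega>\<bar> \<le> E"
    and \<rho>: "optional_time \<rho>" and D: "D \<in> sets Pr"
  defines "A \<equiv> {\<omega> \<in> space M. (\<rho> \<omega>, \<omega>) \<in> D}"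
  shows "(\<integral>\<omega>. indicator A \<omega> * Q (\<rho> \<omega>) \<omega> \<partial>Mc) = (\<integral>\<omega>. indicator A \<omega> * \<xi> \<omega> \<partial>Mc)"
proof -
  have AF: "A \<in> sets (F T)" unfolding A_def by (rule optional_time_event_T[OF \<rho> D])
  then have AM: "A \<in> sets Mc" using sets_F_Mc[of T] by auto
  have range: "\<rho> \<omega> \<in> {0..T}" if "\<omega> \<in> space M" for \<omega> using \<rho> that by (simp add: optional_time_def)
  \<comment> \<open>Floor plus one places the grid time strictly above \<rho> even when \<rho> is a
    grid point, which matches the strict inequality in \<open>optional_time\<close>.\<close>
  define \<kappa> where "\<kappa> n \<omega> = nat \<lfloor>real (Suc n) * \<rho> \<omega>\<rfloor> + 1" for n \<omega>
  define t where "t n k = min T (real k / real (Suc n))" for n k :: nat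
  define K where "K n = nat \<lfloor>real (Suc n) * T\<rfloor> + 1" for n
  have tT: "t n k \<in> {0..T}" for n k unfolding t_def using T_pos by auto
  have \<kappa>_iff: "\<kappa> n \<omega> = k \<longleftrightarrow> \<not> \<rho> \<omega> < (real k - 1) / real (Suc n) \<and> \<rho> \<omega> < real k / real (Suc n)"
    if \<omega>: "\<omega> \<in> space M" and k: "1 \<le> k" for n k \<omega>
  proof -
    have nn: "0 \<le> real (Suc n) * \<rho> \<omega>" using range[OF \<omega>] by simp
    have "\<kappa> n \<omega> = k \<longleftrightarrow> \<lfloor>real (Suc n) * \<rho> \<omega>\<rfloor> = int k - 1" unfolding \<kappa>_def using nn k by auto
    also have "\<dots> \<longleftrightarrow> real k - 1 \<le> real (Suc n) * \<rho> \<omega> \<and> real (Suc n) * \<rho> \<omega> < real k"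
      by (simp add: floor_eq_iff)
    also have "\<dots> \<longleftrightarrow> \<not> \<rho> \<omega> < (real k - 1) / real (Suc n) \<and> \<rho> \<omega> < real k / real (Suc n)"
      by (simp add: pos_less_divide_eq not_less mult.commute del: of_nat_Suc)
    finally show ?thesis .
  qed
  have \<kappa>_range: "\<kappa> n \<omega> \<in> {1..K n}" if \<omega>: "\<omega> \<in> space M" for n \<omega>
  proof -
    have "real (Suc n) * \<rho> \<omega> \<le> real (Suc n) * T" using range[OF \<omega>] by (intro mult_left_mono) auto
    then have "\<lfloor>real (Suc n) * \<rho> \<omega>\<rfloor> \<le> \<lfloor>real (Suc n) * T\<rfloor>" by (rule floor_mono)
    then show ?thesis unfolding \<kappa>_def K_def by auto
  qed
  define G where "G n k = {\<omega> \<in> A. \<kappa> n \<omega> = k}" for n k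
  have G: "G n k \<in> sets (F (t n k))" if k: "k \<in> {1..K n}" for n k
  proof -
    have kp: "0 < real k / real (Suc n)" using k by simp
    have eq: "G n k = {\<omega> \<in> space M. (\<rho> \<omega>, \<omega>) \<in> D \<and> \<rho> \<omega> < real k / real (Suc n)} - {\<omega> \<in> space M. \<rho> \<omega> < (real k - 1) / real (Suc n)}"
    proof (intro set_eqI)
      fix \<omega>
      show "\<omega> \<in> G n k \<longleftrightarrow> \<omega> \<in> {\<omega> \<in> space M. (\<rho> \<omega>, \<omega>) \<in> D \<and> \<rho> \<omega> < real k / real (Suc n)} - {\<omega> \<in> space M. \<rho> \<omega> < (real k - 1) / real (Suc n)}"
        using \<kappa>_iff[of \<omega> k n] k by (cases "\<omega> \<in> space M") (auto simp: G_def A_def)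
    qed
    have 1: "{\<omega> \<in> space M. (\<rho> \<omega>, \<omega>) \<in> D \<and> \<rho> \<omega> < real k / real (Suc n)} \<in> sets (F (t n k))"
      using optional_time_event[OF \<rho> D kp] by (simp add: t_def min.commute)
    have 2: "{\<omega> \<in> space M. \<rho> \<omega> < (real k - 1) / real (Suc n)} \<in> sets (F (t n k))"
    proof (cases "k = 1")
      case True
      then have "{\<omega> \<in> space M. \<rho> \<omega> < (real k - 1) / real (Suc n)} = {}" using range by force
      then show ?thesis by (simp only: sets.empty_sets)
    next
      case False
      then have "0 < (real k - 1) / real (Suc n)" using k by auto
      then have "{\<omega> \<in> space M. \<rho> \<omega> < (real k - 1) / real (Suc n)} \<in> sets (F (min ((real k - 1) / real (Suc n)) T))"
        using \<rho> by (simp add: optional_time_def)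
      moreover have "min ((real k - 1) / real (Suc n)) T \<le> t n k"
      proof -
        have "(real k - 1) / real (Suc n) \<le> real k / real (Suc n)" by (intro divide_right_mono) auto
        then show ?thesis unfolding t_def by auto
      qed
      ultimately show ?thesis using sets_F_mono by blast
    qed
    show ?thesis unfolding eq using 1 2 by (rule sets.Diff)
  qed
  have GM: "G n k \<in> sets Mc" if "k \<in> {1..K n}" for n k
    using G[OF that] sets_F_Mc[of "t n k"] tT[of n k] by auto
  have split: "indicator A \<omega> * X (\<kappa> n \<omega>) = (\<Sum>k\<in>{1..K n}. indicator (G n k) \<omega> * (X k :: real))"
    if \<omega>: "\<omega> \<in> space M" for X n \<omega>
  proof -
    have "(\<Sum>k\<in>{1..K n}. indicator (G n k) \<omega> * X k) = (\<Sum>k\<in>{1..K n}. if k = \<kappa> n \<omega> then indicator A \<omega> * X k else 0)"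
      by (rule sum.cong) (auto simp: G_def indicator_def)
    also have "\<dots> = indicator A \<omega> * X (\<kappa> n \<omega>)" using \<kappa>_range[OF \<omega>, of n] by (simp add: sum.delta)
    finally show ?thesis by simp
  qed
  have iG: "integrable Mc (\<lambda>\<omega>. indicator (G n k) \<omega> * Q (t n k) \<omega>)" "integrable Mc (\<lambda>\<omega>. indicator (G n k) \<omega> * \<xi> \<omega>)"
    if k: "k \<in> {1..K n}" for n k
  proof -
    show "integrable Mc (\<lambda>\<omega>. indicator (G n k) \<omega> * Q (t n k) \<omega>)"
      by (rule set_bounded_integrable_Mc[OF martingale_versionD(5)[OF Q tT] martingale_versionD(3)[OF Q tT] GM[OF k]])
    show "integrable Mc (\<lambda>\<omega>. indicator (G n k) \<omega> * \<xi> \<omega>)"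
      by (rule set_bounded_integrable_Mc[OF \<xi> GM[OF k]])
  qed
  have eqn: "(\<integral>\<omega>. indicator A \<omega> * Q (t n (\<kappa> n \<omega>)) \<omega> \<partial>Mc) = (\<integral>\<omega>. indicator A \<omega> * \<xi> \<omega> \<partial>Mc)" for n
  proof -
    have "(\<integral>\<omega>. indicator A \<omega> * Q (t n (\<kappa> n \<omega>)) \<omega> \<partial>Mc) = (\<integral>\<omega>. (\<Sum>k\<in>{1..K n}. indicator (G n k) \<omega> * Q (t n k) \<omega>) \<partial>Mc)"
    proof (rule Bochner_Integration.integral_cong)
      fix \<omega> assume "\<omega> \<in> space Mc"
      then show "indicator A \<omega> * Q (t n (\<kappa> n \<omega>)) \<omega> = (\<Sum>k\<in>{1..K n}. indicator (G n k) \<omega> * Q (t n k) \<omega>)"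
        using split[of \<omega> "\<lambda>k. Q (t n k) \<omega>" n] by simp
    qed simp
    also have "\<dots> = (\<Sum>k\<in>{1..K n}. \<integral>\<omega>. indicator (G n k) \<omega> * Q (t n k) \<omega> \<partial>Mc)"
      by (rule Bochner_Integration.integral_sum) (rule iG)
    also have "\<dots> = (\<Sum>k\<in>{1..K n}. \<integral>\<omega>. indicator (G n k) \<omega> * \<xi> \<omega> \<partial>Mc)"
      by (rule sum.cong[OF refl]) (rule martingale_versionD(4)[OF Q tT G])
    also have "\<dots> = (\<integral>\<omega>. (\<Sum>k\<in>{1..K n}. indicator (G n k) \<omega> * \<xi> \<omega>) \<partial>Mc)"
      by (rule Bochner_Integration.integral_sum[symmetric]) (rule iG)
    also have "\<dots> = (\<integral>\<omega>. indicator A \<omega> * \<xi> \<omega> \<partial>Mc)"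
    proof (rule Bochner_Integration.integral_cong)
      fix \<omega> assume "\<omega> \<in> space Mc"
      then have "\<omega> \<in> space M" by simp
      from split[OF this, of "\<lambda>k. \<xi> \<omega>" n]
      show "(\<Sum>k\<in>{1..K n}. indicator (G n k) \<omega> * \<xi> \<omega>) = indicator A \<omega> * \<xi> \<omega>" by (rule sym)
    qed simp
    finally show ?thesis .
  qed
  have \<rho>M: "\<rho> \<in> borel_measurable Mc" by (rule measurable_F_Mc[OF order_refl optional_time_measurable[OF \<rho>]])
  have Qm: "(\<lambda>(t, \<omega>). Q t \<omega>) \<in> borel_measurable Pr"
    using martingale_predictable[OF Q] by (simp add: predictable_process_def)
  have Q\<rho>: "(\<lambda>\<omega>. Q (\<rho> \<omega>) \<omega>) \<in> borel_measurable Mc"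
    using measurable_compose[OF measurable_Pr_graph[OF \<rho>M range] Qm] by simp
  have "(\<lambda>n. \<integral>\<omega>. indicator A \<omega> * Q (t n (\<kappa> n \<omega>)) \<omega> \<partial>Mc) \<longlonglongrightarrow> (\<integral>\<omega>. indicator A \<omega> * Q (\<rho> \<omega>) \<omega> \<partial>Mc)"
  proof (rule integral_dominated_convergence[where w="\<lambda>_. C"])
    show "(\<lambda>\<omega>. indicator A \<omega> * Q (\<rho> \<omega>) \<omega>) \<in> borel_measurable Mc" using AM Q\<rho> by measurable
    show "(\<lambda>\<omega>. indicator A \<omega> * Q (t n (\<kappa> n \<omega>)) \<omega>) \<in> borel_measurable Mc" for n
    proof -
      have "(\<lambda>\<omega>. t n (\<kappa> n \<omega>)) \<in> borel_measurable Mc" unfolding t_def \<kappa>_def using \<rho>M by measurable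
      from measurable_compose[OF measurable_Pr_graph[OF this tT] Qm] AM show ?thesis by simp
    qed
    show "AE \<omega> in Mc. norm (indicator A \<omega> * Q (t n (\<kappa> n \<omega>)) \<omega>) \<le> C" for n
    proof (rule AE_I2)
      fix \<omega> assume "\<omega> \<in> space Mc"
      then have "\<bar>Q (t n (\<kappa> n \<omega>)) \<omega>\<bar> \<le> C" by (intro martingale_versionD(3)[OF Q tT]) simp
      then show "norm (indicator A \<omega> * Q (t n (\<kappa> n \<omega>)) \<omega>) \<le> C" by (auto simp: indicator_def)
    qed
    show "AE \<omega> in Mc. (\<lambda>n. indicator A \<omega> * Q (t n (\<kappa> n \<omega>)) \<omega>) \<longlonglongrightarrow> indicator A \<omega> * Q (\<rho> \<omega>) \<omega>"
    proof (rule AE_I2, rule tendsto_mult_left)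
      fix \<omega> assume "\<omega> \<in> space Mc"
      then have \<omega>: "\<omega> \<in> space M" by simp
      show "(\<lambda>n. Q (t n (\<kappa> n \<omega>)) \<omega>) \<longlonglongrightarrow> Q (\<rho> \<omega>) \<omega>"
      proof (rule continuous_on_tendsto_compose[OF martingale_versionD(2)[OF Q \<omega>]])
        show "\<rho> \<omega> \<in> {0..T}" by (rule range[OF \<omega>])
        show "\<forall>\<^sub>F n in sequentially. t n (\<kappa> n \<omega>) \<in> {0..T}" using tT by simp
        show "(\<lambda>n. t n (\<kappa> n \<omega>)) \<longlonglongrightarrow> \<rho> \<omega>"
        proof (rule tendsto_sandwich)
          have b: "\<rho> \<omega> < real (\<kappa> n \<omega>) / real (Suc n)" "real (\<kappa> n \<omega>) / real (Suc n) \<le> \<rho> \<omega> + 1 / real (Suc n)" for n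
          proof -
            have "1 \<le> \<kappa> n \<omega>" by (simp add: \<kappa>_def)
            from \<kappa>_iff[OF \<omega> this, of n] have "(real (\<kappa> n \<omega>) - 1) / real (Suc n) \<le> \<rho> \<omega>" "\<rho> \<omega> < real (\<kappa> n \<omega>) / real (Suc n)"
              by auto
            then show "\<rho> \<omega> < real (\<kappa> n \<omega>) / real (Suc n)" "real (\<kappa> n \<omega>) / real (Suc n) \<le> \<rho> \<omega> + 1 / real (Suc n)"
              by (auto simp: diff_divide_distrib)
          qed
          show "\<forall>\<^sub>F n in sequentially. \<rho> \<omega> \<le> t n (\<kappa> n \<omega>)"
            using b(1) range[OF \<omega>] by (intro always_eventually allI) (auto simp: t_def intro: less_imp_le)
          show "\<forall>\<^sub>F n in sequentially. t n (\<kappa> n \<omega>) \<le> \<rho> \<omega> + 1 / real (Suc n)"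
            using b(2) by (intro always_eventually allI) (auto simp: t_def min_le_iff_disj)
          show "(\<lambda>n. \<rho> \<omega> + 1 / real (Suc n)) \<longlonglongrightarrow> \<rho> \<omega>"
            using tendsto_add[OF tendsto_const LIMSEQ_Suc[OF lim_inverse_n], of "\<rho> \<omega>"] by (simp add: inverse_eq_divide)
        qed simp
      qed
    qed
  qed simp
  then have "(\<lambda>n::nat. \<integral>\<omega>. indicator A \<omega> * \<xi> \<omega> \<partial>Mc) \<longlonglongrightarrow> (\<integral>\<omega>. indicator A \<omega> * Q (\<rho> \<omega>) \<omega> \<partial>Mc)"
    unfolding eqn .
  from LIMSEQ_unique[OF this tendsto_const] show ?thesis .
qed

section \<open>Optional times as first zeros, and processes with prescribed support\<close>

definition running_inf :: "(real \<Rightarrow> 'a \<Rightarrow> real) \<Rightarrow> real \<Rightarrow> 'a \<Rightarrow> real" where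
  "running_inf N t \<omega> = (INF r\<in>rat_times. N (min r t) \<omega>)"

text \<open>This is the infimum of N over [0, t], so its sign records whether N has reached 0 by
  time t. Writing the times as \<open>min r t\<close> keeps the index set independent of t, and
  uniform continuity of the path carries over to the infimum.\<close>

lemma running_inf:
  assumes N: "\<And>t. t \<in> {0..T} \<Longrightarrow> N t \<in> borel_measurable (F t)"
    and cont: "\<And>\<omega>. \<omega> \<in> space M \<Longrightarrow> continuous_on {0..T} (\<lambda>t. N t \<omega>)"
  shows "t \<in> {0..T} \<Longrightarrow> running_inf N t \<in> borel_measurable (F t)"
    and "\<omega> \<in> space M \<Longrightarrow> continuous_on {0..T} (\<lambda>t. running_inf N t \<omega>)"
    and "\<omega> \<in> space M \<Longrightarrow> t \<in> {0..T} \<Longrightarrow> 0 < running_inf N t \<omega> \<longleftrightarrow> (\<forall>s\<in>{0..t}. 0 < N s \<omega>)"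
proof -
  have bdd: "bdd_below ((\<lambda>r. N (min r t) \<omega>) ` rat_times)" if \<omega>: "\<omega> \<in> space M" and t: "t \<in> {0..T}" for \<omega> t
  proof -
    have "compact ((\<lambda>t. N t \<omega>) ` {0..T})" by (rule compact_continuous_image[OF cont[OF \<omega>]]) simp
    then have "bdd_below ((\<lambda>t. N t \<omega>) ` {0..T})" by (intro bounded_imp_bdd_below compact_imp_bounded)
    moreover have "(\<lambda>r. N (min r t) \<omega>) ` rat_times \<subseteq> (\<lambda>t. N t \<omega>) ` {0..T}"
    proof
      fix y assume "y \<in> (\<lambda>r. N (min r t) \<omega>) ` rat_times"
      then obtain r where r: "r \<in> rat_times" "y = N (min r t) \<omega>" by auto
      have "min r t \<in> {0..T}" using r(1) rat_times(3) t by (auto simp: min_def)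
      then show "y \<in> (\<lambda>t. N t \<omega>) ` {0..T}" using r(2) by blast
    qed
    ultimately show ?thesis by (rule bdd_below_mono)
  qed
  show "running_inf N t \<in> borel_measurable (F t)" if t: "t \<in> {0..T}"
    unfolding running_inf_def
  proof (rule borel_measurable_cINF)
    fix r assume r: "r \<in> rat_times"
    then have "r \<in> {0..T}" using rat_times by auto
    then show "N (min r t) \<in> borel_measurable (F t)"
      using t by (intro measurable_F_mono[of "min r t" t] N) auto
  qed (use rat_times bdd t in auto)
  show "continuous_on {0..T} (\<lambda>t. running_inf N t \<omega>)" if \<omega>: "\<omega> \<in> space M"
    unfolding continuous_on_iff
  proof (intro ballI allI impI)
    fix x e :: real assume x: "x \<in> {0..T}" and e: "0 < e"
    have "uniformly_continuous_on {0..T} (\<lambda>t. N t \<omega>)"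
      by (rule compact_uniformly_continuous[OF cont[OF \<omega>]]) simp
    then obtain d where d: "d > 0" "\<And>a b. a \<in> {0..T} \<Longrightarrow> b \<in> {0..T} \<Longrightarrow> dist b a < d \<Longrightarrow> dist (N b \<omega>) (N a \<omega>) < e / 2"
      unfolding uniformly_continuous_on_def using e by (metis half_gt_zero)
    have half: "running_inf N a \<omega> \<le> running_inf N b \<omega> + e / 2" if a: "a \<in> {0..T}" and b: "b \<in> {0..T}" and ab: "dist b a < d" for a b
    proof -
      have "running_inf N a \<omega> - e / 2 \<le> running_inf N b \<omega>"
        unfolding running_inf_def[of N b]
      proof (rule cINF_greatest[OF rat_times(2)])
        fix r assume r: "r \<in> rat_times"
        then have rT: "r \<in> {0..T}" using rat_times(3) by auto
        have "dist (N (min r b) \<omega>) (N (min r a) \<omega>) < e / 2"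
          by (rule d(2)) (use a b ab rT in \<open>auto simp: dist_real_def min_def\<close>)
        moreover have "running_inf N a \<omega> \<le> N (min r a) \<omega>"
          unfolding running_inf_def by (rule cINF_lower[OF bdd[OF \<omega> a] r])
        ultimately show "running_inf N a \<omega> - e / 2 \<le> N (min r b) \<omega>"
          unfolding dist_real_def abs_less_iff by linarith
      qed
      then show ?thesis by simp
    qed
    show "\<exists>d>0. \<forall>x'\<in>{0..T}. dist x' x < d \<longrightarrow> dist (running_inf N x' \<omega>) (running_inf N x \<omega>) < e"
    proof (intro exI[of _ d] conjI d(1) ballI impI)
      fix x' assume x': "x' \<in> {0..T}" "dist x' x < d"
      then show "dist (running_inf N x' \<omega>) (running_inf N x \<omega>) < e"
        using half[OF x x'(1)] half[OF x'(1) x] e by (auto simp: dist_real_def dist_commute abs_less_iff)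
    qed
  qed
  show "0 < running_inf N t \<omega> \<longleftrightarrow> (\<forall>s\<in>{0..t}. 0 < N s \<omega>)" if \<omega>: "\<omega> \<in> space M" and t: "t \<in> {0..T}"
  proof
    assume pos: "0 < running_inf N t \<omega>"
    show "\<forall>s\<in>{0..t}. 0 < N s \<omega>"
    proof
      fix s assume s: "s \<in> {0..t}"
      have c: "continuous_on {0..T} (\<lambda>r. - N (min r t) \<omega>)"
        by (intro continuous_intros continuous_on_compose2[OF cont[OF \<omega>]]) (use t in \<open>auto simp: min_def\<close>)
      have "- N (min s t) \<omega> \<le> - running_inf N t \<omega>"
      proof (rule rat_times_le[OF c])
        show "- N (min r t) \<omega> \<le> - running_inf N t \<omega>" if "r \<in> rat_times" for r
          unfolding running_inf_def using cINF_lower[OF bdd[OF \<omega> t] that] by simp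
      qed (use s t in auto)
      then show "0 < N s \<omega>" using pos s by simp
    qed
  next
    assume pos: "\<forall>s\<in>{0..t}. 0 < N s \<omega>"
    have "continuous_on {0..t} (\<lambda>t. N t \<omega>)" using cont[OF \<omega>] t by (auto intro: continuous_on_subset)
    then obtain s where s: "s \<in> {0..t}" "\<And>r. r \<in> {0..t} \<Longrightarrow> N s \<omega> \<le> N r \<omega>"
      using continuous_attains_inf[of "{0..t}" "\<lambda>t. N t \<omega>"] t by auto
    have "N s \<omega> \<le> running_inf N t \<omega>"
      unfolding running_inf_def
    proof (rule cINF_greatest[OF rat_times(2)])
      fix r assume "r \<in> rat_times"
      then have "min r t \<in> {0..t}" using rat_times(3) t by (auto simp: min_def)
      then show "N s \<omega> \<le> N (min r t) \<omega>" by (rule s(2))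
    qed
    then show "0 < running_inf N t \<omega>" using pos s(1) by force
  qed
qed

lemma integral_zero_AE:
  fixes X :: "'a \<Rightarrow> real"
  assumes X: "integrable Mc X" "AE \<omega> in Mc. 0 \<le> X \<omega>" "(\<integral>\<omega>. X \<omega> \<partial>Mc) \<le> 0"
  shows "AE \<omega> in Mc. X \<omega> = 0"
proof -
  have "(\<integral>\<omega>. X \<omega> \<partial>Mc) = 0" using Bochner_Integration.integral_nonneg_AE[OF X(2)] X(3) by linarith
  then show ?thesis using integral_nonneg_eq_0_iff_AE[OF X(1,2)] by simp
qed

lemma sampled_measurable:
  assumes Q: "martingale_version \<xi> Q C" and \<rho>: "optional_time \<rho>"
  shows "(\<lambda>\<omega>. Q (\<rho> \<omega>) \<omega>) \<in> borel_measurable Mc"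
    and "\<omega> \<in> space M \<Longrightarrow> \<bar>Q (\<rho> \<omega>) \<omega>\<bar> \<le> C"
proof -
  have \<rho>M: "\<rho> \<in> borel_measurable Mc" by (rule measurable_F_Mc[OF order_refl optional_time_measurable[OF \<rho>]])
  have range: "\<rho> \<omega> \<in> {0..T}" if "\<omega> \<in> space M" for \<omega> using \<rho> that by (simp add: optional_time_def)
  have "(\<lambda>(t, \<omega>). Q t \<omega>) \<in> borel_measurable Pr"
    using martingale_predictable[OF Q] by (simp add: predictable_process_def)
  from measurable_compose[OF measurable_Pr_graph[OF \<rho>M range] this]
  show "(\<lambda>\<omega>. Q (\<rho> \<omega>) \<omega>) \<in> borel_measurable Mc" by simp
  show "\<omega> \<in> space M \<Longrightarrow> \<bar>Q (\<rho> \<omega>) \<omega>\<bar> \<le> C" by (rule martingale_versionD(3)[OF Q range])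
qed

text \<open>By sampling, 1 - Q at \<rho> has integral 0 over the event and Q at \<rho> has integral
  0 over its complement; both are nonnegative and so vanish almost everywhere there.\<close>

lemma optional_sampling_indicator:
  assumes \<rho>: "optional_time \<rho>" and D: "D \<in> sets Pr"
    and Q: "martingale_version (indicator {\<omega> \<in> space M. (\<rho> \<omega>, \<omega>) \<in> D}) Q 1" "\<And>t \<omega>. Q t \<omega> \<in> {0..1}"
  shows "AE \<omega> in Mc. Q (\<rho> \<omega>) \<omega> = indicator D (\<rho> \<omega>, \<omega>)"
proof -
  let ?A = "{\<omega> \<in> space M. (\<rho> \<omega>, \<omega>) \<in> D}" and ?A' = "{\<omega> \<in> space M. (\<rho> \<omega>, \<omega>) \<in> space Pr - D}"
  have range: "\<rho> \<omega> \<in> {0..T}" if "\<omega> \<in> space M" for \<omega> using \<rho> that by (simp add: optional_time_def)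
  have AM: "?A \<in> sets Mc" "?A' \<in> sets Mc"
    using optional_time_event_T[OF \<rho> D] optional_time_event_T[OF \<rho> sets.compl_sets[OF D]] sets_F_Mc[of T] by blast+
  have bd: "\<bar>indicator ?A \<omega> :: real\<bar> \<le> 1" for \<omega> by (simp add: indicator_def)
  have im: "(indicator ?A :: 'a \<Rightarrow> real) \<in> borel_measurable Mc" using AM by simp
  note sm = sampled_measurable[OF Q(1) \<rho>]
  have i1: "integrable Mc (\<lambda>\<omega>. indicator ?A \<omega> * (indicator ?A \<omega> :: real))" by (rule set_bounded_integrable_Mc[OF im bd AM(1)])
  have i2: "integrable Mc (\<lambda>\<omega>. indicator ?A \<omega> * Q (\<rho> \<omega>) \<omega>)" by (rule set_bounded_integrable_Mc[OF sm AM(1)])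
  have i3: "integrable Mc (\<lambda>\<omega>. indicator ?A' \<omega> * Q (\<rho> \<omega>) \<omega>)" by (rule set_bounded_integrable_Mc[OF sm AM(2)])
  have "(\<integral>\<omega>. indicator ?A \<omega> * indicator ?A \<omega> - indicator ?A \<omega> * Q (\<rho> \<omega>) \<omega> \<partial>Mc) =
     (\<integral>\<omega>. indicator ?A \<omega> * (indicator ?A \<omega> :: real) \<partial>Mc) - (\<integral>\<omega>. indicator ?A \<omega> * Q (\<rho> \<omega>) \<omega> \<partial>Mc)"
    by (rule Bochner_Integration.integral_diff[OF i1 i2])
  also have "\<dots> = 0" using optional_sampling[OF Q(1) im bd \<rho> D] by simp
  finally have z1: "(\<integral>\<omega>. indicator ?A \<omega> * indicator ?A \<omega> - indicator ?A \<omega> * Q (\<rho> \<omega>) \<omega> \<partial>Mc) = 0" .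
  have 1: "AE \<omega> in Mc. indicator ?A \<omega> * indicator ?A \<omega> - indicator ?A \<omega> * Q (\<rho> \<omega>) \<omega> = 0"
  proof (rule integral_zero_AE)
    show "AE \<omega> in Mc. 0 \<le> indicator ?A \<omega> * indicator ?A \<omega> - indicator ?A \<omega> * Q (\<rho> \<omega>) \<omega>"
      using Q(2) by (intro AE_I2) (auto simp: indicator_def)
  qed (use i1 i2 z1 in auto)
  have z2: "(\<integral>\<omega>. indicator ?A' \<omega> * Q (\<rho> \<omega>) \<omega> \<partial>Mc) = 0"
  proof -
    have "(\<integral>\<omega>. indicator ?A' \<omega> * Q (\<rho> \<omega>) \<omega> \<partial>Mc) = (\<integral>\<omega>. indicator ?A' \<omega> * (indicator ?A \<omega> :: real) \<partial>Mc)"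
      by (rule optional_sampling[OF Q(1) im bd \<rho> sets.compl_sets[OF D]])
    also have "\<dots> = (\<integral>\<omega>. 0 \<partial>Mc)"
      by (rule Bochner_Integration.integral_cong) (auto simp: indicator_def)
    finally show ?thesis by simp
  qed
  have 2: "AE \<omega> in Mc. indicator ?A' \<omega> * Q (\<rho> \<omega>) \<omega> = 0"
  proof (rule integral_zero_AE[OF i3])
    show "AE \<omega> in Mc. 0 \<le> indicator ?A' \<omega> * Q (\<rho> \<omega>) \<omega>"
      using Q(2) by (intro AE_I2) (auto simp: indicator_def)
  qed (use z2 in simp)
  show ?thesis
    using 1 2 AE_space
  proof eventually_elim
    case (elim \<omega>)
    then show ?case using range[of \<omega>] by (cases "(\<rho> \<omega>, \<omega>) \<in> D") (auto simp: indicator_def)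
  qed
qed

text \<open>In a Brownian filtration every optional time is announced: it is the first zero of the
  continuous process \<open>E[\<rho> | F\<^sub>t] - t\<close>.\<close>

lemma optional_time_first_zero:
  assumes \<rho>: "optional_time \<rho>"
  shows "\<exists>N :: real \<Rightarrow> 'a \<Rightarrow> real. (\<forall>t\<in>{0..T}. N t \<in> borel_measurable (F t)) \<and>
    (\<forall>\<omega>\<in>space M. continuous_on {0..T} (\<lambda>t. N t \<omega>)) \<and>
    (AE \<omega> in Mc. N (\<rho> \<omega>) \<omega> \<le> 0 \<and> (\<forall>t\<in>{0..<\<rho> \<omega>}. 0 < N t \<omega>))"
proof -
  have range: "\<rho> \<omega> \<in> {0..T}" if "\<omega> \<in> space M" for \<omega> using \<rho> that by (simp add: optional_time_def)
  \<comment> \<open>Division by T brings the terminal variable into [0, 1], as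
    \<open>continuous_martingale\<close> demands.\<close>
  let ?\<xi> = "\<lambda>\<omega>. \<rho> \<omega> / T"
  have \<xi>F: "?\<xi> \<in> borel_measurable (F T)" using optional_time_measurable[OF \<rho>] by measurable
  have \<xi>01: "?\<xi> \<omega> \<in> {0..1}" if "\<omega> \<in> space M" for \<omega> using range[OF that] T_pos by auto
  from continuous_martingale[OF \<xi>F \<xi>01] obtain Q where Q: "martingale_version ?\<xi> Q 1" "\<forall>t \<omega>. Q t \<omega> \<in> {0..1}" by blast
  have \<xi>M: "?\<xi> \<in> borel_measurable Mc" by (rule measurable_F_Mc[OF order_refl \<xi>F])
  have \<xi>b: "\<bar>?\<xi> \<omega>\<bar> \<le> 1" if "\<omega> \<in> space M" for \<omega> using \<xi>01[OF that] by auto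
  define N where "N t \<omega> = T * Q t \<omega> - t" for t \<omega>
  have NF: "N t \<in> borel_measurable (F t)" if "t \<in> {0..T}" for t
    unfolding N_def using martingale_versionD(1)[OF Q(1) that] by measurable
  have Nc: "continuous_on {0..T} (\<lambda>t. N t \<omega>)" if "\<omega> \<in> space M" for \<omega>
    unfolding N_def using martingale_versionD(2)[OF Q(1) that] by (intro continuous_intros)
  have Npred: "(\<lambda>x. N (fst x) (snd x)) \<in> borel_measurable Pr"
  proof -
    have "(\<lambda>x. T * (\<lambda>(t, \<omega>). Q t \<omega>) x - fst x) \<in> borel_measurable Pr"
      using martingale_predictable[OF Q(1)] fst_measurable_Pr unfolding predictable_process_def by measurable
    then show ?thesis by (simp add: N_def split_beta')
  qed
  \<comment> \<open>Sample on the event that N is positive at \<rho>: there \<open>T * Q\<close> at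
    \<rho> exceeds \<rho>, yet both have the same integral over this event.\<close>
  have N\<rho>: "AE \<omega> in Mc. N (\<rho> \<omega>) \<omega> \<le> 0"
  proof -
    let ?D = "{x \<in> space Pr. 0 < N (fst x) (snd x)}"
    have D: "?D \<in> sets Pr" using Npred by measurable
    let ?A = "{\<omega> \<in> space M. (\<rho> \<omega>, \<omega>) \<in> ?D}"
    have AM: "?A \<in> sets Mc" using optional_time_event_T[OF \<rho> D] sets_F_Mc[of T] by blast
    note sm = sampled_measurable[OF Q(1) \<rho>]
    have i1: "integrable Mc (\<lambda>\<omega>. indicator ?A \<omega> * Q (\<rho> \<omega>) \<omega>)" by (rule set_bounded_integrable_Mc[OF sm AM])
    have i2: "integrable Mc (\<lambda>\<omega>. indicator ?A \<omega> * ?\<xi> \<omega>)" by (rule set_bounded_integrable_Mc[OF \<xi>M \<xi>b AM])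
    have "(\<integral>\<omega>. indicator ?A \<omega> * Q (\<rho> \<omega>) \<omega> - indicator ?A \<omega> * ?\<xi> \<omega> \<partial>Mc) = 0"
      using Bochner_Integration.integral_diff[OF i1 i2] optional_sampling[OF Q(1) \<xi>M \<xi>b \<rho> D] by simp
    moreover have "AE \<omega> in Mc. 0 \<le> indicator ?A \<omega> * Q (\<rho> \<omega>) \<omega> - indicator ?A \<omega> * ?\<xi> \<omega>"
      using T_pos by (intro AE_I2) (auto simp: indicator_def N_def field_simps)
    ultimately have "AE \<omega> in Mc. indicator ?A \<omega> * Q (\<rho> \<omega>) \<omega> - indicator ?A \<omega> * ?\<xi> \<omega> = 0"
      using i1 i2 by (intro integral_zero_AE) auto
    then show ?thesis using AE_space
    proof eventually_elim
      case (elim \<omega>)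
      show ?case
      proof (rule ccontr)
        assume c: "\<not> N (\<rho> \<omega>) \<omega> \<le> 0"
        then have "\<omega> \<in> ?A" using elim range[of \<omega>] by auto
        then have "Q (\<rho> \<omega>) \<omega> = \<rho> \<omega> / T" using elim by (simp add: indicator_def)
        then show False using c T_pos by (simp add: N_def)
      qed
    qed
  qed
  define Z where "Z \<omega> = {t \<in> {0..T}. N t \<omega> \<le> 0}" for \<omega>
  \<comment> \<open>Inserting T avoids the infimum of an empty set; a path without zeros receives
    the value T.\<close>
  define \<tau> where "\<tau> \<omega> = Inf (insert T (Z \<omega>))" for \<omega>
  have bddZ: "bdd_below (insert T (Z \<omega>))" for \<omega> by (rule bdd_belowI[of _ 0]) (use T_pos in \<open>auto simp: Z_def\<close>)
  have \<tau>T: "\<tau> \<omega> \<in> {0..T}" for \<omega>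
  proof -
    have "\<tau> \<omega> \<le> T" unfolding \<tau>_def by (rule cInf_lower[OF _ bddZ]) simp
    moreover have "0 \<le> \<tau> \<omega>" unfolding \<tau>_def by (rule cInf_greatest) (use T_pos in \<open>auto simp: Z_def\<close>)
    ultimately show ?thesis by simp
  qed
  have \<tau>_le: "\<tau> \<omega> \<le> t" if "t \<in> Z \<omega>" for t \<omega> unfolding \<tau>_def by (rule cInf_lower[OF _ bddZ]) (use that in simp)
  have \<tau>_less: "0 < N t \<omega>" if "t \<in> {0..<\<tau> \<omega>}" for t \<omega>
    using \<tau>_le[of t \<omega>] that \<tau>T[of \<omega>] by (force simp: Z_def)
  have \<tau>Z: "\<tau> \<omega> \<in> Z \<omega>" if \<omega>: "\<omega> \<in> space M" and ne: "Z \<omega> \<noteq> {}" for \<omega>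
  proof -
    have "closed ({0..T} \<inter> (\<lambda>t. N t \<omega>) -` {..0})"
      by (rule continuous_closed_preimage[OF Nc[OF \<omega>]]) auto
    then have cl: "closed (Z \<omega>)" by (simp add: Z_def vimage_def Int_def)
    obtain z where z: "z \<in> Z \<omega>" using ne by auto
    have bZ: "bdd_below (Z \<omega>)" using bddZ[of \<omega>] by simp
    have "Inf (Z \<omega>) \<in> Z \<omega>" by (rule closed_contains_Inf[OF ne bZ cl])
    moreover have "\<tau> \<omega> = Inf (Z \<omega>)"
    proof (rule antisym)
      show "\<tau> \<omega> \<le> Inf (Z \<omega>)" by (rule \<tau>_le) fact
      show "Inf (Z \<omega>) \<le> \<tau> \<omega>" unfolding \<tau>_def
      proof (rule cInf_greatest)
        fix x assume "x \<in> insert T (Z \<omega>)"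
        moreover have "Inf (Z \<omega>) \<le> T" using cInf_lower[OF z bZ] z by (auto simp: Z_def)
        ultimately show "Inf (Z \<omega>) \<le> x" using cInf_lower[OF _ bZ] by auto
      qed simp
    qed
    ultimately show ?thesis by simp
  qed
  have \<tau>: "optional_time \<tau>"
    unfolding optional_time_def
  proof (intro conjI ballI allI impI)
    fix u :: real assume u: "0 < u"
    show "{\<omega> \<in> space M. \<tau> \<omega> < u} \<in> sets (F (min u T))"
    proof (cases "u \<le> T")
      case False
      then have "\<tau> \<omega> < u" for \<omega> using \<tau>T[of \<omega>] by auto
      then have "{\<omega> \<in> space M. \<tau> \<omega> < u} = space (F (min u T))" by simp
      then show ?thesis by (simp only: sets.top)
    next
      case True
      \<comment> \<open>By continuity of N the first zero is attained, so it lies before u precisely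
        when the running infimum is nonpositive at some rational time before u.\<close>
      have "{\<omega> \<in> space M. \<tau> \<omega> < u} = (\<Union>r\<in>{r\<in>rat_times. r < u}. {\<omega> \<in> space M. running_inf N r \<omega> \<le> 0})"
      proof (intro set_eqI iffI)
        fix \<omega> assume "\<omega> \<in> {\<omega> \<in> space M. \<tau> \<omega> < u}"
        then have \<omega>: "\<omega> \<in> space M" "\<tau> \<omega> < u" by auto
        then have "Z \<omega> \<noteq> {}" using True by (auto simp: \<tau>_def)
        then have z: "N (\<tau> \<omega>) \<omega> \<le> 0" using \<tau>Z[OF \<omega>(1)] by (simp add: Z_def)
        obtain r where r: "r \<in> \<rat>" "\<tau> \<omega> < r" "r < u" using Rats_dense_in_real[OF \<omega>(2)] by auto
        have rt: "r \<in> rat_times" using r True \<tau>T[of \<omega>] by (auto simp: rat_times_def)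
        then have "r \<in> {0..T}" using rat_times(3) by auto
        then have "\<not> 0 < running_inf N r \<omega>"
          using running_inf(3)[OF NF Nc \<omega>(1), of r] z r(2) \<tau>T[of \<omega>] by force
        then show "\<omega> \<in> (\<Union>r\<in>{r\<in>rat_times. r < u}. {\<omega> \<in> space M. running_inf N r \<omega> \<le> 0})"
          using rt r(3) \<omega>(1) by auto
      next
        fix \<omega> assume "\<omega> \<in> (\<Union>r\<in>{r\<in>rat_times. r < u}. {\<omega> \<in> space M. running_inf N r \<omega> \<le> 0})"
        then obtain r where r: "r \<in> rat_times" "r < u" "\<omega> \<in> space M" "running_inf N r \<omega> \<le> 0" by auto
        then have rT: "r \<in> {0..T}" using rat_times(3) by auto
        have "\<not> (\<forall>s\<in>{0..r}. 0 < N s \<omega>)"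
          using running_inf(3)[OF NF Nc r(3) rT] r(4) by simp
        then obtain s where "s \<in> {0..r}" "N s \<omega> \<le> 0" by (auto simp: not_less)
        then have "\<tau> \<omega> \<le> s" "s \<le> r" using rT by (auto intro!: \<tau>_le simp: Z_def)
        then show "\<omega> \<in> {\<omega> \<in> space M. \<tau> \<omega> < u}" using r by auto
      qed
      also have "\<dots> \<in> sets (F (min u T))"
      proof (rule sets.countable_UN'')
        show "countable {r \<in> rat_times. r < u}" using rat_times(1) by (rule countable_subset[rotated]) auto
        fix r assume "r \<in> {r \<in> rat_times. r < u}"
        then have r: "r \<in> {0..T}" "r < u" using rat_times(3) by auto
        have "{\<omega> \<in> space (F r). running_inf N r \<omega> \<le> 0} \<in> sets (F r)"
          using running_inf(1)[OF NF Nc r(1)] by measurable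
        then show "{\<omega> \<in> space M. running_inf N r \<omega> \<le> 0} \<in> sets (F (min u T))"
          using sets_F_mono[of r "min u T"] r by auto
      qed
      finally show ?thesis .
    qed
  qed (rule \<tau>T)
  have \<tau>\<rho>: "AE \<omega> in Mc. \<tau> \<omega> \<le> \<rho> \<omega> \<and> N (\<tau> \<omega>) \<omega> \<le> 0"
    using N\<rho> AE_space
  proof eventually_elim
    case (elim \<omega>)
    then have \<rho>Z: "\<rho> \<omega> \<in> Z \<omega>" using range[of \<omega>] by (simp add: Z_def)
    then have "\<tau> \<omega> \<in> Z \<omega>" using \<tau>Z[of \<omega>] elim by auto
    then show ?case using \<tau>_le[OF \<rho>Z] by (simp add: Z_def)
  qed
  \<comment> \<open>At the first zero \<open>T * Q \<le> \<tau> \<le> \<rho>\<close>, while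
    \<open>T * Q\<close> sampled at \<tau> has the same mean as \<rho>. Hence it equals \<rho>,
    which forces \<rho> \<le> \<tau>.\<close>
  have "AE \<omega> in Mc. ?\<xi> \<omega> - Q (\<tau> \<omega>) \<omega> = 0"
  proof (rule integral_zero_AE)
    have top: "{\<omega> \<in> space M. (\<tau> \<omega>, \<omega>) \<in> space Pr} = space M" using \<tau>T by auto
    have "(\<integral>\<omega>. indicator (space M) \<omega> * Q (\<tau> \<omega>) \<omega> \<partial>Mc) = (\<integral>\<omega>. indicator (space M) \<omega> * ?\<xi> \<omega> \<partial>Mc)"
      using optional_sampling[OF Q(1) \<xi>M \<xi>b \<tau> sets.top] unfolding top .
    moreover have "(\<integral>\<omega>. indicator (space M) \<omega> * X \<omega> \<partial>Mc) = (\<integral>\<omega>. X \<omega> \<partial>Mc)" for X :: "'a \<Rightarrow> real"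
      by (rule Bochner_Integration.integral_cong) auto
    ultimately have "(\<integral>\<omega>. Q (\<tau> \<omega>) \<omega> \<partial>Mc) = (\<integral>\<omega>. ?\<xi> \<omega> \<partial>Mc)" by simp
    moreover note i = bounded_integrable_Mc[OF sampled_measurable[OF Q(1) \<tau>]] bounded_integrable_Mc[OF \<xi>M \<xi>b]
    ultimately show "(\<integral>\<omega>. ?\<xi> \<omega> - Q (\<tau> \<omega>) \<omega> \<partial>Mc) \<le> 0" by (subst Bochner_Integration.integral_diff) auto
    show "integrable Mc (\<lambda>\<omega>. ?\<xi> \<omega> - Q (\<tau> \<omega>) \<omega>)" using i by (intro Bochner_Integration.integrable_diff)
    show "AE \<omega> in Mc. 0 \<le> ?\<xi> \<omega> - Q (\<tau> \<omega>) \<omega>"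
      using \<tau>\<rho>
    proof eventually_elim
      case (elim \<omega>)
      then have "T * Q (\<tau> \<omega>) \<omega> \<le> \<rho> \<omega>" by (simp add: N_def)
      then show ?case using T_pos by (simp add: field_simps)
    qed
  qed
  then have "AE \<omega> in Mc. \<tau> \<omega> = \<rho> \<omega>"
    using \<tau>\<rho>
  proof eventually_elim
    case (elim \<omega>)
    then have "T * Q (\<tau> \<omega>) \<omega> = \<rho> \<omega>" using T_pos by (simp add: field_simps)
    then show ?case using elim by (simp add: N_def)
  qed
  then have "AE \<omega> in Mc. N (\<rho> \<omega>) \<omega> \<le> 0 \<and> (\<forall>t\<in>{0..<\<rho> \<omega>}. 0 < N t \<omega>)"
    using N\<rho>
  proof eventually_elim
    case (elim \<omega>)
    then show ?case using \<tau>_less[of _ \<omega>] by simp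
  qed
  then show ?thesis using NF Nc by (intro exI[of _ N]) blast
qed

text \<open>On \<open>]q, \<rho>[\<close> the process \<open>E[\<rho> | F\<^sub>t] - t\<close> is positive, and at \<open>\<rho>\<close> the continuous martingale
  closed by the indicator of \<open>{V\<^sub>\<rho> = 0}\<close> takes the value of that indicator; their sum, killed at \<open>\<rho>\<close>, has
  the required left limits.\<close>

lemma rcll_with_left_support:
  fixes V :: "real \<times> 'a \<Rightarrow> ennreal"
  assumes q: "0 \<le> q" "q < T" and V: "V \<in> borel_measurable Pr"
    and mono: "\<And>\<omega> s t. \<omega> \<in> space M \<Longrightarrow> q < s \<Longrightarrow> s \<le> t \<Longrightarrow> t \<le> T \<Longrightarrow> V (s, \<omega>) \<le> V (t, \<omega>)"
  shows "\<exists>\<eta>\<in>rcllP. AE \<omega> in Mc. \<forall>t\<in>{0<..T}. left_lim \<eta> t \<omega> \<in> {0..1} \<and>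
    (0 < left_lim \<eta> t \<omega> \<longleftrightarrow> q < t \<and> V (t, \<omega>) = 0)"
proof -
  define D where "D = {x \<in> space Pr. q < fst x \<and> V x = 0}"
  have D: "D \<in> sets Pr" unfolding D_def using V fst_measurable_Pr by measurable
  define J where "J \<omega> = {t \<in> {q<..T}. V (t, \<omega>) = 0}" for \<omega>
  \<comment> \<open>The end of the interval on which V vanishes; inserting q gives the value q when
    that interval is empty.\<close>
  define \<rho> where "\<rho> \<omega> = Sup (insert q (J \<omega>))" for \<omega>
  have bdd: "bdd_above (insert q (J \<omega>))" for \<omega> by (rule bdd_aboveI[of _ T]) (use q in \<open>auto simp: J_def\<close>)
  have \<rho>_ge: "t \<le> \<rho> \<omega>" if "t \<in> J \<omega>" for t \<omega> unfolding \<rho>_def by (rule cSup_upper[OF _ bdd]) (use that in simp)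
  have q\<rho>: "q \<le> \<rho> \<omega>" for \<omega> unfolding \<rho>_def by (rule cSup_upper[OF _ bdd]) simp
  have \<rho>T: "\<rho> \<omega> \<le> T" for \<omega> unfolding \<rho>_def by (rule cSup_least) (use q in \<open>auto simp: J_def\<close>)
  \<comment> \<open>Monotonicity of V makes J an interval starting at q, so that only membership of
    its end point \<rho> remains open.\<close>
  have below: "t \<in> J \<omega>" if \<omega>: "\<omega> \<in> space M" and t: "q < t" "t < \<rho> \<omega>" for t \<omega>
  proof -
    obtain t' where t': "t' \<in> insert q (J \<omega>)" "t < t'"
      using t(2) less_cSup_iff[OF _ bdd, of \<omega> t] unfolding \<rho>_def by auto
    then have "t' \<in> J \<omega>" using t(1) by auto
    then have "V (t, \<omega>) \<le> 0" using mono[OF \<omega> t(1), of t'] t'(2) by (auto simp: J_def)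
    then show ?thesis using t \<rho>T[of \<omega>] by (simp add: J_def)
  qed
  have \<rho>: "optional_time \<rho>"
    unfolding optional_time_def
  proof (intro conjI ballI allI impI)
    show "\<rho> \<omega> \<in> {0..T}" for \<omega> using q\<rho>[of \<omega>] \<rho>T[of \<omega>] q by auto
    fix u :: real assume u: "0 < u"
    consider "u \<le> q" | "T < u" | "q < u" "u \<le> T" by linarith
    then show "{\<omega> \<in> space M. \<rho> \<omega> < u} \<in> sets (F (min u T))"
    proof cases
      case 1
      then have "\<not> \<rho> \<omega> < u" for \<omega> using q\<rho>[of \<omega>] by linarith
      then have "{\<omega> \<in> space M. \<rho> \<omega> < u} = {}" by blast
      then show ?thesis by (simp only: sets.empty_sets)
    next
      case 2
      then have "\<rho> \<omega> < u" for \<omega> using \<rho>T[of \<omega>] by linarith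
      then have "{\<omega> \<in> space M. \<rho> \<omega> < u} = space (F (min u T))" by simp
      then show ?thesis by (simp only: sets.top)
    next
      case 3
      \<comment> \<open>The supremum lies below u exactly if V is nonzero at a rational time in ]q,
        u[, because V stays nonzero once it has become so.\<close>
      have "{\<omega> \<in> space M. \<rho> \<omega> < u} = (\<Union>r\<in>\<rat> \<inter> {q<..<u}. {\<omega> \<in> space M. (r, \<omega>) \<in> {x \<in> space Pr. V x \<noteq> 0}})"
      proof (intro set_eqI iffI)
        fix \<omega> assume "\<omega> \<in> {\<omega> \<in> space M. \<rho> \<omega> < u}"
        then have \<omega>: "\<omega> \<in> space M" "\<rho> \<omega> < u" by auto
        obtain r where r: "r \<in> \<rat>" "\<rho> \<omega> < r" "r < u" using Rats_dense_in_real[OF \<omega>(2)] by auto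
        then have "r \<notin> J \<omega>" using \<rho>_ge[of r \<omega>] by auto
        moreover have "r \<in> {q<..T}" using r q\<rho>[of \<omega>] 3 by auto
        ultimately have "V (r, \<omega>) \<noteq> 0" by (auto simp: J_def)
        then show "\<omega> \<in> (\<Union>r\<in>\<rat> \<inter> {q<..<u}. {\<omega> \<in> space M. (r, \<omega>) \<in> {x \<in> space Pr. V x \<noteq> 0}})"
          using r \<omega> \<open>r \<in> {q<..T}\<close> q by auto
      next
        fix \<omega> assume "\<omega> \<in> (\<Union>r\<in>\<rat> \<inter> {q<..<u}. {\<omega> \<in> space M. (r, \<omega>) \<in> {x \<in> space Pr. V x \<noteq> 0}})"
        then obtain r where r: "q < r" "r < u" "\<omega> \<in> space M" "V (r, \<omega>) \<noteq> 0" by auto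
        then have "r \<notin> J \<omega>" by (simp add: J_def)
        then have "\<not> r < \<rho> \<omega>" using below[OF r(3,1)] by auto
        then show "\<omega> \<in> {\<omega> \<in> space M. \<rho> \<omega> < u}" using r by auto
      qed
      also have "\<dots> \<in> sets (F (min u T))"
      proof (rule sets.countable_UN'')
        show "countable (\<rat> \<inter> {q<..<u})" using countable_rat by (rule countable_Int1)
        fix r assume "r \<in> \<rat> \<inter> {q<..<u}"
        then have r: "r \<in> {0..T}" "r \<le> min u T" using q 3 by auto
        have "{x \<in> space Pr. V x \<noteq> 0} \<in> sets Pr" using V by measurable
        from Pr_section_event[OF this r(1)] sets_F_mono[OF r(2)]
        show "{\<omega> \<in> space M. (r, \<omega>) \<in> {x \<in> space Pr. V x \<noteq> 0}} \<in> sets (F (min u T))" by blast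
      qed
      finally show ?thesis .
    qed
  qed
  from optional_time_first_zero[OF \<rho>] obtain N :: "real \<Rightarrow> 'a \<Rightarrow> real" where N': "\<forall>t\<in>{0..T}. N t \<in> borel_measurable (F t)"
    "\<forall>\<omega>\<in>space M. continuous_on {0..T} (\<lambda>t. N t \<omega>)"
    and N: "AE \<omega> in Mc. N (\<rho> \<omega>) \<omega> \<le> 0 \<and> (\<forall>t\<in>{0..<\<rho> \<omega>}. 0 < N t \<omega>)"
    by blast
  have NF: "\<And>t. t \<in> {0..T} \<Longrightarrow> N t \<in> borel_measurable (F t)"
    and Nc: "\<And>\<omega>. \<omega> \<in> space M \<Longrightarrow> continuous_on {0..T} (\<lambda>t. N t \<omega>)"
    using N' by blast+
  have "(indicator {\<omega> \<in> space M. (\<rho> \<omega>, \<omega>) \<in> D} :: 'a \<Rightarrow> real) \<in> borel_measurable (F T)"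
    using optional_time_event_T[OF \<rho> D] by simp
  from continuous_martingale[OF this] obtain Q where
    Q: "martingale_version (indicator {\<omega> \<in> space M. (\<rho> \<omega>, \<omega>) \<in> D}) Q 1" "\<forall>t \<omega>. Q t \<omega> \<in> {0..1}"
    by (auto simp: indicator_def)
  have Q01: "Q t \<omega> \<in> {0..1}" for t \<omega> using Q(2) by blast
  have Q\<rho>: "AE \<omega> in Mc. Q (\<rho> \<omega>) \<omega> = indicator D (\<rho> \<omega>, \<omega>)"
    by (rule optional_sampling_indicator[OF \<rho> D Q(1) Q01])
  let ?m = "running_inf N"
  have m: "t \<in> {0..T} \<Longrightarrow> ?m t \<in> borel_measurable (F t)"
    "\<omega> \<in> space M \<Longrightarrow> continuous_on {0..T} (\<lambda>t. ?m t \<omega>)"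
    "\<omega> \<in> space M \<Longrightarrow> t \<in> {0..T} \<Longrightarrow> 0 < ?m t \<omega> \<longleftrightarrow> (\<forall>s\<in>{0..t}. 0 < N s \<omega>)" for t \<omega>
    by (rule running_inf[OF NF Nc], assumption+)+
  \<comment> \<open>Almost surely N is positive before \<rho>, and at \<rho> it is 0 (if \<rho> >
    0), so that Q decides there. The minimum with 1 supplies the upper bound on the left
    limits.\<close>
  define H where "H t \<omega> = min 1 (Q t \<omega> + N t \<omega>)" for t \<omega>
  have HF: "H t \<in> borel_measurable (F t)" if "t \<in> {0..T}" for t
    unfolding H_def using martingale_versionD(1)[OF Q(1) that] NF[OF that] by measurable
  have Hc: "continuous_on {0..T} (\<lambda>t. H t \<omega>)" if "\<omega> \<in> space M" for \<omega>
    unfolding H_def using martingale_versionD(2)[OF Q(1) that] Nc[OF that] by (intro continuous_intros)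
  have left: "(x \<longlongrightarrow> x t) (at_left t)"
    if X: "continuous_on {0..T} x" and t: "t \<in> {0<..T}" for x :: "real \<Rightarrow> real" and t
  proof -
    have "(x \<longlongrightarrow> x t) (at t within {0..T})"
      using X t by (auto simp: continuous_on_def)
    moreover have "at_left t = at t within {0..<t}"
      by (rule at_within_nhd[of t "{0<..}"]) (use t in auto)
    ultimately show ?thesis using t by (auto elim!: tendsto_within_subset)
  qed
  have right: "(x \<longlongrightarrow> x t) (at_right t)"
    if X: "continuous_on {0..T} x" and t: "t \<in> {0..<T}" for x :: "real \<Rightarrow> real" and t
  proof -
    have "(x \<longlongrightarrow> x t) (at t within {0..T})"
      using X t by (auto simp: continuous_on_def)
    moreover have "at_right t = at t within {t<..T}"
      by (rule at_within_nhd[of t "{..<T}"]) (use t in auto)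
    ultimately show ?thesis using t by (auto elim!: tendsto_within_subset)
  qed
  have pred: "(\<lambda>(t, \<omega>). X t \<omega>) \<in> borel_measurable Pr"
    if "\<And>t. t \<in> {0..T} \<Longrightarrow> X t \<in> borel_measurable (F t)" "\<And>\<omega>. \<omega> \<in> space M \<Longrightarrow> continuous_on {0..T} (\<lambda>t. X t \<omega>)" for X :: "real \<Rightarrow> 'a \<Rightarrow> real"
  proof -
    have "predictable_process M T B X"
    proof (rule left_continuous_adapted_predictable)
      fix \<omega> t assume "\<omega> \<in> space M" "t \<in> {0<..T}"
      then show "((\<lambda>s. X s \<omega>) \<longlongrightarrow> X t \<omega>) (at_left t)" by (intro left that(2))
    qed (rule that(1))
    then show ?thesis by (simp add: predictable_process_def)
  qed
  \<comment> \<open>Including q gives right continuity at q, while the left limit there stays 0. The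
    running infimum, rather than N, kills the process for good at the first zero, even if N becomes
    positive again.\<close>
  define \<eta> where "\<eta> t \<omega> = (if q \<le> t \<and> 0 < ?m t \<omega> then H t \<omega> else 0)" for t \<omega>
  have m_anti: "0 < ?m s \<omega>" if "\<omega> \<in> space M" "0 \<le> s" "s \<le> t" "t \<le> T" "0 < ?m t \<omega>" for \<omega> s t
    using m(3)[OF that(1), of s] m(3)[OF that(1), of t] that by auto
  \<comment> \<open>The limit at t involves the running infimum strictly before t only; hence at t =
    \<rho> > q it is almost surely \<open>H\<close> at \<rho>, although \<eta> is already 0
    there.\<close>
  have \<eta>left: "((\<lambda>s. \<eta> s \<omega>) \<longlongrightarrow> (if q < t \<and> (\<forall>s\<in>{0..<t}. 0 < ?m s \<omega>) then H t \<omega> else 0)) (at_left t)"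
    if \<omega>: "\<omega> \<in> space M" and t: "t \<in> {0<..T}" for \<omega> t
  proof -
    consider "t \<le> q" | s where "s \<in> {0..<t}" "\<not> 0 < ?m s \<omega>" | "q < t" "\<forall>s\<in>{0..<t}. 0 < ?m s \<omega>" by force
    then show ?thesis
    proof cases
      case 1
      have "eventually (\<lambda>s. \<eta> s \<omega> = 0) (at_left t)"
        unfolding eventually_at_left_field using 1 by (intro exI[of _ "t - 1"]) (auto simp: \<eta>_def)
      then show ?thesis using 1 by (auto intro: tendsto_eventually)
    next
      case 2
      have "\<eta> r \<omega> = 0" if "s < r" "r < t" for r
        using m_anti[OF \<omega>, of s r] 2 that t by (auto simp: \<eta>_def)
      then have "eventually (\<lambda>s. \<eta> s \<omega> = 0) (at_left t)"
        unfolding eventually_at_left_field using 2(1) by (intro exI[of _ s]) auto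
      then show ?thesis using 2 by (auto intro: tendsto_eventually)
    next
      case 3
      have "eventually (\<lambda>s. \<eta> s \<omega> = H s \<omega>) (at_left t)"
        unfolding eventually_at_left_field using 3 q by (intro exI[of _ q]) (auto simp: \<eta>_def)
      then show ?thesis using 3 left[OF Hc[OF \<omega>] t] by (auto simp: tendsto_cong)
    qed
  qed
  have \<eta>right: "((\<lambda>s. \<eta> s \<omega>) \<longlongrightarrow> \<eta> t \<omega>) (at_right t)" if \<omega>: "\<omega> \<in> space M" and t: "t \<in> {0..<T}" for \<omega> t
  proof -
    consider "t < q" | "\<not> 0 < ?m t \<omega>" | "q \<le> t" "0 < ?m t \<omega>" by linarith
    then show ?thesis
    proof cases
      case 1
      have "eventually (\<lambda>s. \<eta> s \<omega> = 0) (at_right t)"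
        unfolding eventually_at_right_field using 1 by (intro exI[of _ q]) (auto simp: \<eta>_def)
      then show ?thesis using 1 by (auto intro: tendsto_eventually simp: \<eta>_def)
    next
      case 2
      have "\<eta> r \<omega> = 0" if "t < r" "r < T" for r
        using m_anti[OF \<omega>, of t r] 2 that t by (auto simp: \<eta>_def)
      then have "eventually (\<lambda>s. \<eta> s \<omega> = 0) (at_right t)"
        unfolding eventually_at_right_field using t by (intro exI[of _ T]) auto
      then show ?thesis using 2 by (auto intro: tendsto_eventually simp: \<eta>_def)
    next
      case 3
      have "eventually (\<lambda>s. 0 < ?m s \<omega>) (at_right t)"
        by (rule order_tendstoD(1)[OF right[OF m(2)[OF \<omega>] t] 3(2)])
      moreover have "eventually (\<lambda>s. t < s) (at_right t)" by (simp add: eventually_at_right_less)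
      ultimately have "eventually (\<lambda>s. \<eta> s \<omega> = H s \<omega>) (at_right t)"
        by eventually_elim (use 3 in \<open>auto simp: \<eta>_def\<close>)
      then show ?thesis using 3 right[OF Hc[OF \<omega>] t] by (auto simp: tendsto_cong \<eta>_def)
    qed
  qed
  have "\<eta> \<in> rcllP"
    unfolding rcll_processes_def
  proof (intro CollectI conjI ballI)
    note [measurable] = pred[OF HF Hc] pred[OF m(1,2)] fst_measurable_Pr
    have "(\<lambda>x. if q \<le> fst x \<and> 0 < (\<lambda>(t, \<omega>). ?m t \<omega>) x then (\<lambda>(t, \<omega>). H t \<omega>) x else 0) \<in> borel_measurable Pr"
      by measurable
    then show "predictable_process M T B \<eta>"
      by (simp add: predictable_process_def \<eta>_def case_prod_unfold cong: if_cong)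
    show "rcll_on T (\<lambda>t. \<eta> t \<omega>)" if "\<omega> \<in> space M" for \<omega>
      unfolding rcll_on_def using \<eta>right[OF that] \<eta>left[OF that] by blast
  qed
  moreover have "AE \<omega> in Mc. \<forall>t\<in>{0<..T}. left_lim \<eta> t \<omega> \<in> {0..1} \<and> (0 < left_lim \<eta> t \<omega> \<longleftrightarrow> q < t \<and> V (t, \<omega>) = 0)"
    using N Q\<rho> AE_space
  proof eventually_elim
    case (elim \<omega>)
    then have \<omega>: "\<omega> \<in> space M" by simp
    have Npos: "0 < N t \<omega>" if "0 \<le> t" "t < \<rho> \<omega>" for t using elim that by auto
    have mpos: "0 < ?m t \<omega> \<longleftrightarrow> t < \<rho> \<omega>" if t: "t \<in> {0..T}" for t
    proof
      assume "0 < ?m t \<omega>"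
      then have "\<forall>s\<in>{0..t}. 0 < N s \<omega>" using m(3)[OF \<omega> t] by simp
      then show "t < \<rho> \<omega>" using elim q\<rho>[of \<omega>] q by (meson atLeastAtMost_iff not_le order_trans)
    next
      assume "t < \<rho> \<omega>"
      then show "0 < ?m t \<omega>" using m(3)[OF \<omega> t] Npos by auto
    qed
    show ?case
    proof
      fix t assume t: "t \<in> {0<..T}"
      have all: "(\<forall>s\<in>{0..<t}. 0 < ?m s \<omega>) \<longleftrightarrow> t \<le> \<rho> \<omega>"
      proof
        assume a: "\<forall>s\<in>{0..<t}. 0 < ?m s \<omega>"
        show "t \<le> \<rho> \<omega>"
        proof (rule ccontr)
          assume "\<not> t \<le> \<rho> \<omega>"
          then have "0 < ?m (\<rho> \<omega>) \<omega>" using a q\<rho>[of \<omega>] q by auto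
          then show False using mpos[of "\<rho> \<omega>"] q\<rho>[of \<omega>] \<rho>T[of \<omega>] q by auto
        qed
      next
        assume "t \<le> \<rho> \<omega>"
        then show "\<forall>s\<in>{0..<t}. 0 < ?m s \<omega>" using mpos t by auto
      qed
      have ll: "left_lim \<eta> t \<omega> = (if q < t \<and> t \<le> \<rho> \<omega> then H t \<omega> else 0)"
        by (rule left_lim_eqI) (use \<eta>left[OF \<omega> t] t all in auto)
      show "left_lim \<eta> t \<omega> \<in> {0..1} \<and> (0 < left_lim \<eta> t \<omega> \<longleftrightarrow> q < t \<and> V (t, \<omega>) = 0)"
      proof (cases "q < t \<and> t \<le> \<rho> \<omega>")
        case False
        then have "\<not> (q < t \<and> V (t, \<omega>) = 0)" using \<rho>_ge[of t \<omega>] t by (auto simp: J_def)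
        then show ?thesis using ll False by simp
      next
        case True
        show ?thesis
        proof (cases "t < \<rho> \<omega>")
          case lt: True
          have "V (t, \<omega>) = 0" using below[OF \<omega>, of t] True lt by (simp add: J_def)
          moreover have "0 < H t \<omega>" "H t \<omega> \<le> 1" using Npos[of t] lt t Q01[of t \<omega>] by (auto simp: H_def)
          ultimately show ?thesis using ll True by simp
        next
          case False
          then have eq: "t = \<rho> \<omega>" using True by simp
          \<comment> \<open>N is positive before \<rho>, so by continuity it is at least 0 at
            \<rho>; being also at most 0 it vanishes there, and \<open>H\<close> reduces to the
            indicator of D.\<close>
          have "0 \<le> N t \<omega>"
          proof (rule tendsto_lowerbound[OF left[OF Nc[OF \<omega>] t]])
            show "eventually (\<lambda>s. 0 \<le> N s \<omega>) (at_left t)"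
              unfolding eventually_at_left_field using Npos eq t by (intro exI[of _ 0]) (auto intro: less_imp_le)
          qed simp
          then have "N t \<omega> = 0" using elim eq by auto
          then have "H t \<omega> = indicator D (t, \<omega>)" using elim eq by (auto simp: H_def indicator_def)
          moreover have "(t, \<omega>) \<in> D \<longleftrightarrow> V (t, \<omega>) = 0" using True t \<omega> by (simp add: D_def)
          ultimately show ?thesis using ll True by (auto simp: indicator_def)
        qed
      qed
    qed
  qed
  ultimately show ?thesis by blast
qed

end

section \<open>The envelopes of the obstacles and minimality\<close>

text \<open>The rational points of J, with its supremum if attained, are cofinal. This turns
  uncountably many almost-everywhere statements, one on ]q, r] for each r in J, into a single one on
  J.\<close>

lemma cofinal_countable:
  fixes J :: "real set"
  assumes down: "\<And>s t. t \<in> J \<Longrightarrow> q < s \<Longrightarrow> s \<le> t \<Longrightarrow> s \<in> J" and bd: "\<And>t. t \<in> J \<Longrightarrow> q < t \<and> t \<le> T"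
  obtains R where "R \<subseteq> J" "countable R" "\<And>s. s \<in> J \<Longrightarrow> \<exists>r\<in>R. s \<le> r"
proof
  let ?R = "(\<rat> \<inter> J) \<union> ({Sup J} \<inter> J)"
  show "?R \<subseteq> J" by auto
  show "countable ?R" using countable_rat by (auto intro: countable_Int1)
  fix s assume s: "s \<in> J"
  have bdd: "bdd_above J" by (rule bdd_aboveI[of _ T]) (use bd in auto)
  show "\<exists>r\<in>?R. s \<le> r"
  proof (cases "s = Sup J")
    case True
    then show ?thesis using s by auto
  next
    case False
    then have "s < Sup J" using cSup_upper[OF s bdd] by simp
    then obtain g where g: "g \<in> J" "s < g" using less_cSup_iff[OF _ bdd] s by auto
    obtain r where r: "r \<in> \<rat>" "s < r" "r < g" using Rats_dense_in_real[OF g(2)] by auto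
    then have "r \<in> J" using down[OF g(1), of r] bd[OF s] by auto
    then show ?thesis using r by (intro bexI[of _ r]) auto
  qed
qed

lemma mono_borel_measurable_ereal:
  fixes f :: "real \<Rightarrow> ereal"
  assumes "mono f" shows "f \<in> borel_measurable borel"
proof (rule borel_measurableI_less)
  fix y
  have "is_interval {x \<in> space borel. f x < y}"
    unfolding is_interval_1 using assms by (auto simp: mono_def intro: le_less_trans)
  then show "{x \<in> space borel. f x < y} \<in> sets borel"
    by (rule real_interval_borel_measurable)
qed

lemma ereal_integral_eq_0_iff:
  assumes nn: "\<And>x. x \<in> S \<Longrightarrow> 0 \<le> h x"
    and m: "(\<lambda>x. e2ennreal (h x) * indicator S x) \<in> borel_measurable N"
  shows "ereal_integral N S h = 0 \<longleftrightarrow> (AE x in N. x \<in> S \<longrightarrow> h x \<le> 0)"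
proof -
  have "(\<integral>\<^sup>+x\<in>S. e2ennreal (- h x) \<partial>N) = (\<integral>\<^sup>+x. 0 \<partial>N)"
    by (rule nn_integral_cong) (auto simp: indicator_def e2ennreal_neg nn)
  then have "ereal_integral N S h = enn2ereal (\<integral>\<^sup>+x\<in>S. e2ennreal (h x) \<partial>N)"
    by (simp add: ereal_integral_def zero_ennreal.rep_eq)
  then have "ereal_integral N S h = 0 \<longleftrightarrow> (\<integral>\<^sup>+x\<in>S. e2ennreal (h x) \<partial>N) = 0"
    by (metis e2ennreal_enn2ereal zero_ennreal.rep_eq)
  also have "\<dots> \<longleftrightarrow> (AE x in N. e2ennreal (h x) * indicator S x = 0)"
    by (rule nn_integral_0_iff_AE[OF m])
  also have "\<dots> \<longleftrightarrow> (AE x in N. x \<in> S \<longrightarrow> h x \<le> 0)"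
  proof (rule AE_cong)
    fix x
    have "e2ennreal (h x) = 0 \<longleftrightarrow> h x \<le> 0" if "x \<in> S"
      using enn2ereal_e2ennreal[OF nn[OF that]] by (auto simp: e2ennreal_neg zero_ennreal.rep_eq)
    then show "(e2ennreal (h x) * indicator S x = 0) \<longleftrightarrow> (x \<in> S \<longrightarrow> h x \<le> 0)"
      by (cases "x \<in> S") auto
  qed
  finally show ?thesis .
qed

text \<open>A violation at t persists on an open interval ending at t, which has positive Lebesgue
  measure.\<close>

lemma AE_lborel_left_continuous_le:
  fixes a b :: "real \<Rightarrow> real"
  assumes ae: "AE t in lborel. q < t \<and> t \<le> r \<longrightarrow> a t \<le> b t"
    and lc: "(a \<longlongrightarrow> a t) (at_left t)" "(b \<longlongrightarrow> b t) (at_left t)" and t: "q < t" "t \<le> r"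
  shows "a t \<le> b t"
proof (rule ccontr)
  assume "\<not> a t \<le> b t"
  then have "eventually (\<lambda>s. 0 < a s - b s) (at_left t)"
    by (intro order_tendstoD(1)[OF tendsto_diff[OF lc]]) simp
  then obtain c where c: "c < t" "\<And>s. c < s \<Longrightarrow> s < t \<Longrightarrow> b s < a s"
    unfolding eventually_at_left_field by auto
  let ?c = "max c q"
  have "AE s in lborel. s \<notin> {?c<..<t}"
    using ae by eventually_elim (use c t in force)
  then have "{?c<..<t} \<in> null_sets lborel"
    by (subst AE_iff_null_sets) auto
  then have "emeasure lborel {?c<..<t} = 0" by auto
  then show False using c t by (auto simp: ennreal_eq_0_iff)
qed

context brownian_setting
begin

section \<open>Pathwise form of the domain and of the envelopes\<close>

lemma left_lim_at_left:
  assumes "X \<in> rcllP" "\<omega> \<in> space M" "t \<in> {0<..T}"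
  shows "((\<lambda>s. left_lim X s \<omega>) \<longlongrightarrow> left_lim X t \<omega>) (at_left t)"
  by (rule left_lim_left_continuous[where X=X and \<omega>=\<omega>, OF rcllP_path[OF assms(1,2)] assms(3)])

lemma gap_measurable:
  assumes "predictable_process M T B p" "predictable_process M T B r"
  shows "(\<lambda>(t, \<omega>). ennreal (max 0 (p t \<omega> - r t \<omega>))) \<in> borel_measurable Pr"
proof -
  have "(\<lambda>x. ennreal (max 0 ((\<lambda>(t, \<omega>). p t \<omega>) x - (\<lambda>(t, \<omega>). r t \<omega>) x))) \<in> borel_measurable Pr"
    using assms unfolding predictable_process_def by measurable
  then show ?thesis by (simp add: split_beta')
qed

lemma predictable_const_add:
  assumes "predictable_process M T B p"
  shows "predictable_process M T B (\<lambda>t \<omega>. p t \<omega> + c * t + d)"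
proof -
  have "(\<lambda>x. (\<lambda>(t, \<omega>). p t \<omega>) x + c * fst x + d) \<in> borel_measurable Pr"
    using assms fst_measurable_Pr unfolding predictable_process_def by measurable
  then show ?thesis by (simp add: predictable_process_def split_beta')
qed

lemma predictable_uminus:
  fixes p :: "real \<Rightarrow> 'a \<Rightarrow> real"
  assumes "predictable_process M T B p"
  shows "predictable_process M T B (\<lambda>t \<omega>. - p t \<omega>)"
proof -
  have "(\<lambda>x. - (\<lambda>(t, \<omega>). p t \<omega>) x) \<in> borel_measurable Pr"
    using assms unfolding predictable_process_def by measurable
  then show ?thesis by (simp add: predictable_process_def split_beta')
qed

lemma gap_zero_iff:
  assumes p: "predictable_process M T B p" "predictable_process M T B r"
    and N: "sets (N \<omega>) = sets borel" and \<omega>: "\<omega> \<in> space M" and t: "t \<le> T"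
  shows "(\<integral>\<^sup>+s\<in>{0<..t}. ennreal (max 0 (p s \<omega> - r s \<omega>)) \<partial>N \<omega>) = 0 \<longleftrightarrow>
    (AE s in N \<omega>. s \<in> {0<..t} \<longrightarrow> p s \<omega> \<le> r s \<omega>)"
proof -
  have "(\<lambda>s. ennreal (max 0 (p s \<omega> - r s \<omega>)) * indicator {0<..t} s) \<in> borel_measurable borel"
    using path_indicator_borel[OF gap_measurable[OF p] \<omega> t] by simp
  then have "(\<lambda>s. ennreal (max 0 (p s \<omega> - r s \<omega>)) * indicator {0<..t} s) \<in> borel_measurable (N \<omega>)"
    using N by (simp cong: measurable_cong_sets)
  from nn_integral_0_iff_AE[OF this]
  have "(\<integral>\<^sup>+s\<in>{0<..t}. ennreal (max 0 (p s \<omega> - r s \<omega>)) \<partial>N \<omega>) = 0 \<longleftrightarrow>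
    (AE s in N \<omega>. ennreal (max 0 (p s \<omega> - r s \<omega>)) * indicator {0<..t} s = 0)" .
  also have "\<dots> \<longleftrightarrow> (AE s in N \<omega>. s \<in> {0<..t} \<longrightarrow> p s \<omega> \<le> r s \<omega>)"
  proof (rule AE_cong)
    fix s
    show "ennreal (max 0 (p s \<omega> - r s \<omega>)) * indicator {0<..t} s = 0 \<longleftrightarrow> (s \<in> {0<..t} \<longrightarrow> p s \<omega> \<le> r s \<omega>)"
      by (cases "s \<in> {0<..t}") (auto simp: max_def ennreal_eq_0_iff)
  qed
  finally show ?thesis .
qed

text \<open>f may be measurable for the completion alone; the criterion is applied there and
  transferred, since integral and null sets agree.\<close>

lemma nn_integral_M_0_iff:
  assumes "f \<in> borel_measurable Mc"
  shows "(\<integral>\<^sup>+\<omega>. f \<omega> \<partial>M) = 0 \<longleftrightarrow> (AE \<omega> in M. f \<omega> = 0)"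
  using nn_integral_0_iff_AE[OF assms] by (simp add: nn_integral_completion AE_completion_iff)

text \<open>One half of membership in the domain, for a single path. The upper half is the same
  condition for -U, -u, \<alpha> and -Y, so the analysis below treats lower obstacles throughout.
  Left continuity is why the condition on L can be asked at every t.\<close>

definition above_lower ::
  "(real \<Rightarrow> 'a \<Rightarrow> real) \<Rightarrow> (real \<Rightarrow> 'a \<Rightarrow> real) \<Rightarrow> (real \<Rightarrow> 'a \<Rightarrow> real) \<Rightarrow> (real \<Rightarrow> 'a \<Rightarrow> real) \<Rightarrow> 'a \<Rightarrow> bool" where
  "above_lower L l \<delta> Y \<omega> \<longleftrightarrow> (\<forall>t\<in>{0<..T}. left_lim L t \<omega> \<le> left_lim Y t \<omega>) \<and>
     (AE t in stieltjes T \<delta> \<omega>. t \<in> {0<..T} \<longrightarrow> l t \<omega> \<le> left_lim Y t \<omega>)"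

lemma left_lim_lborel_le_iff:
  assumes X: "X \<in> rcllP" and Y: "Y \<in> rcllP" and \<omega>: "\<omega> \<in> space M"
  shows "(AE t in lborel. t \<in> {0<..T} \<longrightarrow> left_lim X t \<omega> \<le> left_lim Y t \<omega>) \<longleftrightarrow>
    (\<forall>t\<in>{0<..T}. left_lim X t \<omega> \<le> left_lim Y t \<omega>)"
proof
  assume ae: "AE t in lborel. t \<in> {0<..T} \<longrightarrow> left_lim X t \<omega> \<le> left_lim Y t \<omega>"
  show "\<forall>t\<in>{0<..T}. left_lim X t \<omega> \<le> left_lim Y t \<omega>"
  proof
    fix t assume t: "t \<in> {0<..T}"
    show "left_lim X t \<omega> \<le> left_lim Y t \<omega>"
    proof (rule AE_lborel_left_continuous_le[where q=0 and r=T and a="\<lambda>t. left_lim X t \<omega>" and b="\<lambda>t. left_lim Y t \<omega>"])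
      show "((\<lambda>t. left_lim X t \<omega>) \<longlongrightarrow> left_lim X t \<omega>) (at_left t)"
        by (rule left_lim_at_left[OF X \<omega> t])
      show "((\<lambda>t. left_lim Y t \<omega>) \<longlongrightarrow> left_lim Y t \<omega>) (at_left t)"
        by (rule left_lim_at_left[OF Y \<omega> t])
    qed (use ae t in auto)
  qed
qed (auto intro!: AE_I2)

lemma Dom_iff:
  assumes L: "L \<in> rcllP" and U: "U \<in> rcllP" and l: "predictable_process M T B l" and u: "predictable_process M T B u"
    and \<alpha>: "\<alpha> \<in> incP" and \<delta>: "\<delta> \<in> incP"
  shows "Y \<in> Dom M T B L U l u \<alpha> \<delta> \<longleftrightarrow> Y \<in> rcllP \<and>
    (AE \<omega> in M. above_lower L l \<delta> Y \<omega> \<and> above_lower (\<lambda>t \<omega>. - U t \<omega>) (\<lambda>t \<omega>. - u t \<omega>) \<alpha> (\<lambda>t \<omega>. - Y t \<omega>) \<omega>)"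
proof (cases "Y \<in> rcllP")
  case Y: True
  note pY = left_lim_predictable[OF Y] and pL = left_lim_predictable[OF L] and pU = left_lim_predictable[OF U]
  let ?a = "\<lambda>\<omega>. \<integral>\<^sup>+t\<in>{0<..T}. ennreal (max 0 (left_lim L t \<omega> - left_lim Y t \<omega>)) \<partial>lborel"
  let ?b = "\<lambda>\<omega>. \<integral>\<^sup>+t\<in>{0<..T}. ennreal (max 0 (l t \<omega> - left_lim Y t \<omega>)) \<partial>stieltjes T \<delta> \<omega>"
  let ?c = "\<lambda>\<omega>. \<integral>\<^sup>+t\<in>{0<..T}. ennreal (max 0 (left_lim Y t \<omega> - left_lim U t \<omega>)) \<partial>lborel"
  let ?d = "\<lambda>\<omega>. \<integral>\<^sup>+t\<in>{0<..T}. ennreal (max 0 (left_lim Y t \<omega> - u t \<omega>)) \<partial>stieltjes T \<alpha> \<omega>"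
  have m: "?a \<in> borel_measurable Mc" "?b \<in> borel_measurable Mc" "?c \<in> borel_measurable Mc" "?d \<in> borel_measurable Mc"
    using kernel_integral_T_measurable[OF predictable_kernel_lborel gap_measurable[OF pL pY]]
      kernel_integral_T_measurable[OF predictable_kernel_stieltjes[OF \<delta>] gap_measurable[OF l pY]]
      kernel_integral_T_measurable[OF predictable_kernel_lborel gap_measurable[OF pY pU]]
      kernel_integral_T_measurable[OF predictable_kernel_stieltjes[OF \<alpha>] gap_measurable[OF pY u]]
    by simp_all
  have "Y \<in> Dom M T B L U l u \<alpha> \<delta> \<longleftrightarrow> (\<integral>\<^sup>+\<omega>. ?a \<omega> + ?b \<omega> + ?c \<omega> + ?d \<omega> \<partial>M) = 0"
    using Y by (simp add: Dom_def)
  also have "\<dots> \<longleftrightarrow> (AE \<omega> in M. ?a \<omega> + ?b \<omega> + ?c \<omega> + ?d \<omega> = 0)"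
    using m by (intro nn_integral_M_0_iff borel_measurable_add)
  also have "\<dots> \<longleftrightarrow> (AE \<omega> in M. above_lower L l \<delta> Y \<omega> \<and> above_lower (\<lambda>t \<omega>. - U t \<omega>) (\<lambda>t \<omega>. - u t \<omega>) \<alpha> (\<lambda>t \<omega>. - Y t \<omega>) \<omega>)"
  proof (rule AE_cong)
    fix \<omega> assume \<omega>: "\<omega> \<in> space M"
    have "?a \<omega> = 0 \<longleftrightarrow> (\<forall>t\<in>{0<..T}. left_lim L t \<omega> \<le> left_lim Y t \<omega>)"
      using gap_zero_iff[OF pL pY _ \<omega> order_refl, of "\<lambda>_. lborel"] left_lim_lborel_le_iff[OF L Y \<omega>] by simp
    moreover have "?c \<omega> = 0 \<longleftrightarrow> (\<forall>t\<in>{0<..T}. left_lim Y t \<omega> \<le> left_lim U t \<omega>)"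
      using gap_zero_iff[OF pY pU _ \<omega> order_refl, of "\<lambda>_. lborel"] left_lim_lborel_le_iff[OF Y U \<omega>] by simp
    moreover have "?b \<omega> = 0 \<longleftrightarrow> (AE t in stieltjes T \<delta> \<omega>. t \<in> {0<..T} \<longrightarrow> l t \<omega> \<le> left_lim Y t \<omega>)"
      by (rule gap_zero_iff[OF l pY _ \<omega> order_refl]) simp
    moreover have "?d \<omega> = 0 \<longleftrightarrow> (AE t in stieltjes T \<alpha> \<omega>. t \<in> {0<..T} \<longrightarrow> left_lim Y t \<omega> \<le> u t \<omega>)"
      by (rule gap_zero_iff[OF pY u _ \<omega> order_refl]) simp
    moreover have "(\<forall>t\<in>{0<..T}. left_lim (\<lambda>t \<omega>. - U t \<omega>) t \<omega> \<le> left_lim (\<lambda>t \<omega>. - Y t \<omega>) t \<omega>) \<longleftrightarrow>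
        (\<forall>t\<in>{0<..T}. left_lim Y t \<omega> \<le> left_lim U t \<omega>)"
      by (intro ball_cong refl) (simp add: left_lim_uminus[OF Y \<omega>] left_lim_uminus[OF U \<omega>])
    moreover have "(AE t in stieltjes T \<alpha> \<omega>. t \<in> {0<..T} \<longrightarrow> - u t \<omega> \<le> left_lim (\<lambda>t \<omega>. - Y t \<omega>) t \<omega>) \<longleftrightarrow>
       (AE t in stieltjes T \<alpha> \<omega>. t \<in> {0<..T} \<longrightarrow> left_lim Y t \<omega> \<le> u t \<omega>)"
      by (rule AE_cong) (auto simp: left_lim_uminus[OF Y \<omega>])
    ultimately show "?a \<omega> + ?b \<omega> + ?c \<omega> + ?d \<omega> = 0 \<longleftrightarrow>
        above_lower L l \<delta> Y \<omega> \<and> above_lower (\<lambda>t \<omega>. - U t \<omega>) (\<lambda>t \<omega>. - u t \<omega>) \<alpha> (\<lambda>t \<omega>. - Y t \<omega>) \<omega>"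
      unfolding above_lower_def add_eq_0_iff_both_eq_0 by auto
  qed
  finally show ?thesis using Y by simp
qed (simp add: Dom_def)

lemma env_null_iff:
  assumes l: "predictable_process M T B l" and \<omega>: "\<omega> \<in> space M" and t: "t \<le> T"
  shows "(\<integral>\<^sup>+s\<in>{0<..t}. ennreal (max 0 (l s \<omega> + real n * s - a)) \<partial>stieltjes T \<delta> \<omega>) = 0 \<longleftrightarrow>
    (AE s in stieltjes T \<delta> \<omega>. s \<in> {0<..t} \<longrightarrow> l s \<omega> + real n * s \<le> a)"
proof -
  have z: "predictable_process M T B (\<lambda>_ _. 0 :: real)" by (simp add: predictable_process_def split_beta')
  have "(AE s in stieltjes T \<delta> \<omega>. s \<in> {0<..t} \<longrightarrow> l s \<omega> + real n * s \<le> a) \<longleftrightarrow>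
    (AE s in stieltjes T \<delta> \<omega>. s \<in> {0<..t} \<longrightarrow> l s \<omega> + real n * s + - a \<le> 0)"
    by (rule AE_cong) auto
  then show ?thesis
    using gap_zero_iff[where N="stieltjes T \<delta>", OF predictable_const_add[OF l, of "real n" "- a"] z _ \<omega> t] by simp
qed

text \<open>The \<delta>-essential supremum of \<open>l s + n * s\<close> over ]0, t] in the
  extended reals: minus infinity if \<delta> does not charge ]0, t], infinity if there is no real
  bound.\<close>

definition env_sup :: "(real \<Rightarrow> 'a \<Rightarrow> real) \<Rightarrow> (real \<Rightarrow> 'a \<Rightarrow> real) \<Rightarrow> nat \<Rightarrow> real \<Rightarrow> 'a \<Rightarrow> ereal" where
  "env_sup \<delta> l n t \<omega> =
     Inf (ereal ` {a. (\<integral>\<^sup>+s\<in>{0<..t}. ennreal (max 0 (l s \<omega> + real n * s - a)) \<partial>stieltjes T \<delta> \<omega>) = 0})"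

lemma upper_env_env_sup:
  fixes \<delta> l :: "real \<Rightarrow> 'a \<Rightarrow> real"
  shows "upper_env T \<delta> l t \<omega> = (INF n. ereal (- real n * t) + env_sup \<delta> l n t \<omega>)"
  by (simp add: upper_env_def env_sup_def)

text \<open>Enlarging ]0, t] can only remove admissible bounds. Monotone functions are Borel, whence
  the measurability of the envelope along paths.\<close>

lemma mono_env_sup: "mono (\<lambda>t. env_sup \<delta> l n t \<omega>)"
proof (rule monoI, unfold env_sup_def, rule Inf_superset_mono, rule image_mono, safe)
  fix x y a :: real assume xy: "x \<le> y"
    and z: "(\<integral>\<^sup>+s\<in>{0<..y}. ennreal (max 0 (l s \<omega> + real n * s - a)) \<partial>stieltjes T \<delta> \<omega>) = 0"
  have "(\<integral>\<^sup>+s\<in>{0<..x}. ennreal (max 0 (l s \<omega> + real n * s - a)) \<partial>stieltjes T \<delta> \<omega>) \<le>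
    (\<integral>\<^sup>+s\<in>{0<..y}. ennreal (max 0 (l s \<omega> + real n * s - a)) \<partial>stieltjes T \<delta> \<omega>)"
    by (rule nn_integral_mono) (use xy in \<open>auto simp: indicator_def\<close>)
  then show "(\<integral>\<^sup>+s\<in>{0<..x}. ennreal (max 0 (l s \<omega> + real n * s - a)) \<partial>stieltjes T \<delta> \<omega>) = 0"
    using z by simp
qed

lemma upper_env_borel:
  fixes \<delta> l :: "real \<Rightarrow> 'a \<Rightarrow> real"
  shows "(\<lambda>t. upper_env T \<delta> l t \<omega>) \<in> borel_measurable borel"
proof -
  have [measurable]: "(\<lambda>t. env_sup \<delta> l n t \<omega>) \<in> borel_measurable borel" for n
    by (rule mono_borel_measurable_ereal[OF mono_env_sup])
  show ?thesis unfolding upper_env_env_sup by measurable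
qed

lemma upper_env_le:
  assumes l: "predictable_process M T B l" and Y: "Y \<in> rcllP" and \<omega>: "\<omega> \<in> space M"
    and ae: "AE t in stieltjes T \<delta> \<omega>. t \<in> {0<..T} \<longrightarrow> l t \<omega> \<le> left_lim Y t \<omega>" and t: "t \<in> {0<..T}"
  shows "upper_env T \<delta> l t \<omega> \<le> ereal (left_lim Y t \<omega>)"
proof (rule ereal_le_epsilon2)
  fix e :: real assume e: "0 < e"
  let ?y = "\<lambda>s. left_lim Y s \<omega>"
  obtain C where C: "\<And>s. s \<in> {0<..T} \<Longrightarrow> \<bar>?y s\<bar> \<le> C" using left_lim_bounded[where X=Y and \<omega>=\<omega>, OF rcllP_path[OF Y \<omega>] T_pos] by blast
  have "eventually (\<lambda>s. ?y s < ?y t + e) (at_left t)"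
    by (rule order_tendstoD(2)[OF left_lim_at_left[OF Y \<omega> t]]) (use e in simp)
  then obtain b where b: "b < t" "\<And>s. b < s \<Longrightarrow> s < t \<Longrightarrow> ?y s < ?y t + e"
    unfolding eventually_at_left_field by blast
  \<comment> \<open>The slope makes n (t - b) at least \<open>C - ?y t\<close>, so for s \<le> b the
    deficit n (t - s) outweighs any excess of the bounded path over its value at t.\<close>
  obtain n :: nat where n: "(C - ?y t) / (t - b) < real n" using reals_Archimedean2 by blast
  have nb: "C - ?y t \<le> real n * (t - b)" using n b(1) by (simp add: pos_divide_less_eq less_imp_le)
  have dom: "?y s + real n * s \<le> ?y t + e + real n * t" if s: "s \<in> {0<..t}" for s
  proof -
    consider "s \<le> b" | "b < s" "s < t" | "s = t" using s by fastforce
    then show ?thesis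
    proof cases
      case 1
      have "?y s \<le> C" using C[of s] s t by auto
      moreover have "real n * s \<le> real n * b" using 1 by (rule mult_left_mono) simp
      ultimately show ?thesis using nb e by (simp add: algebra_simps)
    next
      case 2
      have "real n * s \<le> real n * t" using 2 by (intro mult_left_mono) auto
      then show ?thesis using b(2)[OF 2] by linarith
    qed (use e in simp)
  qed
  let ?a = "?y t + e + real n * t"
  have "AE s in stieltjes T \<delta> \<omega>. s \<in> {0<..t} \<longrightarrow> l s \<omega> + real n * s \<le> ?a"
    using ae
  proof eventually_elim
    case (elim s)
    show ?case
    proof
      assume s: "s \<in> {0<..t}"
      then have "l s \<omega> \<le> ?y s" using elim t by auto
      then show "l s \<omega> + real n * s \<le> ?a" using dom[OF s] by linarith
    qed
  qed
  then have "(\<integral>\<^sup>+s\<in>{0<..t}. ennreal (max 0 (l s \<omega> + real n * s - ?a)) \<partial>stieltjes T \<delta> \<omega>) = 0"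
    using env_null_iff[OF l \<omega>, of t] t by auto
  then have "env_sup \<delta> l n t \<omega> \<le> ereal ?a" unfolding env_sup_def by (intro Inf_lower imageI) simp
  then have "ereal (- real n * t) + env_sup \<delta> l n t \<omega> \<le> ereal (- real n * t) + ereal ?a" by (rule add_left_mono)
  also have "\<dots> = ereal (?y t) + ereal e" by simp
  finally show "upper_env T \<delta> l t \<omega> \<le> ereal (?y t) + ereal e"
    unfolding upper_env_env_sup by (rule INF_lower2[OF UNIV_I])
qed

text \<open>A bound on ]0, t] holds off a null set that depends on t, while here t and s coincide.
  For each rational level the times up to which it is a bound form an interval, and a countable
  cofinal set of them leaves one null set.\<close>

lemma env_sup_AE:
  assumes l: "predictable_process M T B l" and \<omega>: "\<omega> \<in> space M"
  shows "AE s in stieltjes T \<delta> \<omega>. s \<in> {0<..T} \<longrightarrow> ereal (l s \<omega> + real n * s) \<le> env_sup \<delta> l n s \<omega>"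
proof -
  define G where "G a = {t \<in> {0<..T}. AE s in stieltjes T \<delta> \<omega>. s \<in> {0<..t} \<longrightarrow> l s \<omega> + real n * s \<le> a}" for a
  have "AE s in stieltjes T \<delta> \<omega>. s \<in> G a \<longrightarrow> l s \<omega> + real n * s \<le> a" for a
  proof -
    have down: "s \<in> G a" if "t \<in> G a" "0 < s" "s \<le> t" for s t
    proof -
      have "AE r in stieltjes T \<delta> \<omega>. r \<in> {0<..t} \<longrightarrow> l r \<omega> + real n * r \<le> a" using that(1) by (simp add: G_def)
      then have "AE r in stieltjes T \<delta> \<omega>. r \<in> {0<..s} \<longrightarrow> l r \<omega> + real n * r \<le> a"
        by eventually_elim (use that in auto)
      then show ?thesis using that by (auto simp: G_def)
    qed
    obtain R where R: "R \<subseteq> G a" "countable R" "\<And>s. s \<in> G a \<Longrightarrow> \<exists>r\<in>R. s \<le> r"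
      by (rule cofinal_countable[of "G a" 0 T, OF down]) (auto simp: G_def)
    have "AE s in stieltjes T \<delta> \<omega>. \<forall>r\<in>R. s \<in> {0<..r} \<longrightarrow> l s \<omega> + real n * s \<le> a"
      by (rule AE_ball_countable'[OF _ R(2)]) (use R(1) in \<open>auto simp: G_def\<close>)
    then show ?thesis
    proof eventually_elim
      case (elim s)
      show ?case
      proof
        assume s: "s \<in> G a"
        then obtain r where "r \<in> R" "s \<le> r" using R(3) by blast
        then show "l s \<omega> + real n * s \<le> a" using elim s by (auto simp: G_def)
      qed
    qed
  qed
  then have "AE s in stieltjes T \<delta> \<omega>. \<forall>a\<in>\<rat>. s \<in> G a \<longrightarrow> l s \<omega> + real n * s \<le> a"
    by (intro AE_ball_countable' countable_rat)
  then show ?thesis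
  proof eventually_elim
    case (elim s)
    show ?case
    proof (rule impI, rule ccontr)
      assume s: "s \<in> {0<..T}" and "\<not> ereal (l s \<omega> + real n * s) \<le> env_sup \<delta> l n s \<omega>"
      then have "env_sup \<delta> l n s \<omega> < ereal (l s \<omega> + real n * s)" by simp
      then obtain a where a: "(\<integral>\<^sup>+s\<in>{0<..s}. ennreal (max 0 (l s \<omega> + real n * s - a)) \<partial>stieltjes T \<delta> \<omega>) = 0"
        "a < l s \<omega> + real n * s"
        unfolding env_sup_def Inf_less_iff by auto
      \<comment> \<open>A rational level between a and the value at s is still a bound on ]0, s],
        yet it is violated at s.\<close>
      obtain a' where a': "a' \<in> \<rat>" "a < a'" "a' < l s \<omega> + real n * s" using Rats_dense_in_real[OF a(2)] by auto
      have "AE r in stieltjes T \<delta> \<omega>. r \<in> {0<..s} \<longrightarrow> l r \<omega> + real n * r \<le> a"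
        using env_null_iff[OF l \<omega>, of s] s a(1) by auto
      then have "AE r in stieltjes T \<delta> \<omega>. r \<in> {0<..s} \<longrightarrow> l r \<omega> + real n * r \<le> a'"
        by eventually_elim (use a' in auto)
      then have "s \<in> G a'" using s by (simp add: G_def)
      then show False using elim a' by force
    qed
  qed
qed

lemma le_upper_env_AE:
  assumes l: "predictable_process M T B l" and \<omega>: "\<omega> \<in> space M"
  shows "AE s in stieltjes T \<delta> \<omega>. s \<in> {0<..T} \<longrightarrow> ereal (l s \<omega>) \<le> upper_env T \<delta> l s \<omega>"
proof -
  have "AE s in stieltjes T \<delta> \<omega>. \<forall>n. s \<in> {0<..T} \<longrightarrow> ereal (l s \<omega> + real n * s) \<le> env_sup \<delta> l n s \<omega>"
    unfolding AE_all_countable using env_sup_AE[OF l \<omega>] by blast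
  then show ?thesis
  proof eventually_elim
    case (elim s)
    show ?case
      unfolding upper_env_env_sup
    proof (intro impI INF_greatest)
      fix n assume "s \<in> {0<..T}"
      then have "ereal (- real n * s) + ereal (l s \<omega> + real n * s) \<le> ereal (- real n * s) + env_sup \<delta> l n s \<omega>"
        using elim by (intro add_left_mono) auto
      then show "ereal (l s \<omega>) \<le> ereal (- real n * s) + env_sup \<delta> l n s \<omega>" by simp
    qed
  qed
qed

lemma above_lower_iff:
  assumes l: "predictable_process M T B l" and Y: "Y \<in> rcllP" and \<omega>: "\<omega> \<in> space M"
  shows "above_lower L l \<delta> Y \<omega> \<longleftrightarrow>
    (\<forall>t\<in>{0<..T}. max (ereal (left_lim L t \<omega>)) (upper_env T \<delta> l t \<omega>) \<le> ereal (left_lim Y t \<omega>))"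
proof
  assume "above_lower L l \<delta> Y \<omega>"
  then show "\<forall>t\<in>{0<..T}. max (ereal (left_lim L t \<omega>)) (upper_env T \<delta> l t \<omega>) \<le> ereal (left_lim Y t \<omega>)"
    using upper_env_le[OF l Y \<omega>] by (auto simp: above_lower_def)
next
  assume *: "\<forall>t\<in>{0<..T}. max (ereal (left_lim L t \<omega>)) (upper_env T \<delta> l t \<omega>) \<le> ereal (left_lim Y t \<omega>)"
  have "AE t in stieltjes T \<delta> \<omega>. t \<in> {0<..T} \<longrightarrow> l t \<omega> \<le> left_lim Y t \<omega>"
    using le_upper_env_AE[OF l \<omega>, of \<delta>]
  proof eventually_elim
    case (elim t)
    show ?case
    proof
      assume t: "t \<in> {0<..T}"
      then have "ereal (l t \<omega>) \<le> upper_env T \<delta> l t \<omega>" using elim by simp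
      also have "\<dots> \<le> ereal (left_lim Y t \<omega>)" using * t by auto
      finally show "l t \<omega> \<le> left_lim Y t \<omega>" by simp
    qed
  qed
  then show "above_lower L l \<delta> Y \<omega>" using * by (auto simp: above_lower_def)
qed

section \<open>Room above the lower obstacles, and what minimality says about it\<close>

definition room :: "(real \<Rightarrow> 'a \<Rightarrow> real) \<Rightarrow> (real \<Rightarrow> 'a \<Rightarrow> real) \<Rightarrow> (real \<Rightarrow> 'a \<Rightarrow> real) \<Rightarrow> (real \<Rightarrow> 'a \<Rightarrow> real) \<Rightarrow>
    real \<Rightarrow> real \<Rightarrow> real \<Rightarrow> 'a \<Rightarrow> bool" where
  "room L l \<delta> Y q e t \<omega> \<longleftrightarrow>
     (AE s in lborel. s \<in> {q<..t} \<longrightarrow> left_lim L s \<omega> + e \<le> left_lim Y s \<omega>) \<and>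
     (AE s in stieltjes T \<delta> \<omega>. s \<in> {q<..t} \<longrightarrow> l s \<omega> + e \<le> left_lim Y s \<omega>)"

text \<open>V integrates the shortfall from the distance e over ]q, t], against dt for L and against
  d\<delta> for l. It is predictable as a kernel integral and vanishes exactly under
  \<open>room\<close>, which is stated almost everywhere for this purpose.\<close>

lemma room_defect:
  assumes L: "L \<in> rcllP" and l: "predictable_process M T B l" and \<delta>: "\<delta> \<in> incP" and Y: "Y \<in> rcllP" and q: "0 \<le> q" "q < T"
  obtains V :: "real \<times> 'a \<Rightarrow> ennreal" where "V \<in> borel_measurable Pr"
    "\<And>\<omega> s t. \<omega> \<in> space M \<Longrightarrow> s \<le> t \<Longrightarrow> V (s, \<omega>) \<le> V (t, \<omega>)"
    "\<And>\<omega> t. \<omega> \<in> space M \<Longrightarrow> t \<le> T \<Longrightarrow> V (t, \<omega>) = 0 \<longleftrightarrow> room L l \<delta> Y q e t \<omega>"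
proof
  define h where "h p = (\<lambda>(s, \<omega>). ennreal (max 0 (p s \<omega> + e - left_lim Y s \<omega>)) * indicator {q<..T} s)" for p :: "real \<Rightarrow> 'a \<Rightarrow> real"
  have hm: "h p \<in> borel_measurable Pr" if p: "predictable_process M T B p" for p
  proof -
    have "{q<..T} \<times> space M \<in> sets Pr" using Pr_Ioc[OF q(1) order_refl sets.top[of "F q"]] by simp
    then have "(\<lambda>x. (\<lambda>(t, \<omega>). ennreal (max 0 ((\<lambda>t \<omega>. p t \<omega> + 0 * t + e) t \<omega> - left_lim Y t \<omega>))) x * indicator ({q<..T} \<times> space M) x) \<in> borel_measurable Pr"
      using gap_measurable[OF predictable_const_add[OF p, of 0 e] left_lim_predictable[OF Y]]
      by (intro borel_measurable_times_ennreal borel_measurable_indicator)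
    also have "?this \<longleftrightarrow> h p \<in> borel_measurable Pr"
      by (rule measurable_cong) (auto simp: h_def indicator_def)
    finally show ?thesis .
  qed
  define V where "V = (\<lambda>(t, \<omega>). (\<integral>\<^sup>+s\<in>{0<..t}. h (left_lim L) (s, \<omega>) \<partial>lborel) + (\<integral>\<^sup>+s\<in>{0<..t}. h l (s, \<omega>) \<partial>stieltjes T \<delta> \<omega>))"
  have "(\<lambda>x. (\<lambda>(t, \<omega>). \<integral>\<^sup>+s\<in>{0<..t}. h (left_lim L) (s, \<omega>) \<partial>lborel) x + (\<lambda>(t, \<omega>). \<integral>\<^sup>+s\<in>{0<..t}. h l (s, \<omega>) \<partial>stieltjes T \<delta> \<omega>) x) \<in> borel_measurable Pr"
    by (intro borel_measurable_add kernel_integral_predictable predictable_kernel_lborel predictable_kernel_stieltjes \<delta> hm l left_lim_predictable L)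
  then show "V \<in> borel_measurable Pr" by (simp add: V_def split_beta')
  show "V (s, \<omega>) \<le> V (t, \<omega>)" if "s \<le> t" for \<omega> s t
    unfolding V_def using that by (auto intro!: add_mono nn_integral_mono simp: indicator_def)
  fix \<omega> t assume \<omega>: "\<omega> \<in> space M" and t: "t \<le> T"
  have z: "(\<integral>\<^sup>+s\<in>{0<..t}. h p (s, \<omega>) \<partial>N) = 0 \<longleftrightarrow> (AE s in N. s \<in> {q<..t} \<longrightarrow> p s \<omega> + e \<le> left_lim Y s \<omega>)"
    if p: "predictable_process M T B p" and N: "sets N = sets borel" for p and N :: "real measure"
  proof -
    have "(\<lambda>s. h p (s, \<omega>) * indicator {0<..t} s) \<in> borel_measurable N"
      using path_indicator_borel[OF hm[OF p] \<omega> t] N by (simp cong: measurable_cong_sets)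
    from nn_integral_0_iff_AE[OF this]
    have "(\<integral>\<^sup>+s\<in>{0<..t}. h p (s, \<omega>) \<partial>N) = 0 \<longleftrightarrow> (AE s in N. h p (s, \<omega>) * indicator {0<..t} s = 0)" .
    also have "\<dots> \<longleftrightarrow> (AE s in N. s \<in> {q<..t} \<longrightarrow> p s \<omega> + e \<le> left_lim Y s \<omega>)"
    proof (rule AE_cong)
      fix s
      show "h p (s, \<omega>) * indicator {0<..t} s = 0 \<longleftrightarrow> (s \<in> {q<..t} \<longrightarrow> p s \<omega> + e \<le> left_lim Y s \<omega>)"
        using q t by (cases "s \<in> {q<..t}") (auto simp: h_def indicator_def max_def ennreal_eq_0_iff)
    qed
    finally show ?thesis .
  qed
  show "V (t, \<omega>) = 0 \<longleftrightarrow> room L l \<delta> Y q e t \<omega>"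
    using z[OF left_lim_predictable[OF L], of lborel] z[OF l, of "stieltjes T \<delta> \<omega>"]
    by (simp add: V_def room_def add_eq_0_iff_both_eq_0)
qed

text \<open>Strictness at t yields n and a level a that bounds \<open>l s + n * s\<close> on ]0, t]
  and lies below \<open>?y t + n * t\<close>. By left continuity the gaps at t persist, reduced by
  at least half at most, on some ]q, t] with q rational.\<close>

lemma room_exists:
  assumes L: "L \<in> rcllP" and l: "predictable_process M T B l" and Y: "Y \<in> rcllP" and \<omega>: "\<omega> \<in> space M" and t: "t \<in> {0<..T}"
    and less: "max (ereal (left_lim L t \<omega>)) (upper_env T \<delta> l t \<omega>) < ereal (left_lim Y t \<omega>)"
  shows "\<exists>q\<in>\<rat> \<inter> {0..<T}. \<exists>k. q < t \<and> room L l \<delta> Y q (1 / real (Suc k)) t \<omega>"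
proof -
  let ?y = "\<lambda>s. left_lim Y s \<omega>" and ?L = "\<lambda>s. left_lim L s \<omega>"
  have "upper_env T \<delta> l t \<omega> < ereal (?y t)" using less by simp
  then obtain n where n: "ereal (- real n * t) + env_sup \<delta> l n t \<omega> < ereal (?y t)"
    unfolding upper_env_env_sup INF_less_iff by auto
  have "env_sup \<delta> l n t \<omega> < ereal (?y t + real n * t)"
    using n by (cases "env_sup \<delta> l n t \<omega>") auto
  then obtain a where a: "(\<integral>\<^sup>+s\<in>{0<..t}. ennreal (max 0 (l s \<omega> + real n * s - a)) \<partial>stieltjes T \<delta> \<omega>) = 0"
    "a < ?y t + real n * t"
    unfolding env_sup_def Inf_less_iff by auto
  have ae: "AE s in stieltjes T \<delta> \<omega>. s \<in> {0<..t} \<longrightarrow> l s \<omega> + real n * s \<le> a"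
    using env_null_iff[OF l \<omega>, of t] t a(1) by auto
  have Lt: "?L t < ?y t" using less by simp
  \<comment> \<open>Half of the smaller gap at t, so that the strict bounds by d survive on a left
    neighbourhood. A distance \<open>1 / (k + 1)\<close> below d is then taken to have countably
    many distances in all.\<close>
  define d where "d = min (?y t - ?L t) (?y t + real n * t - a) / 2"
  have d: "0 < d" using Lt a(2) by (simp add: d_def)
  have "2 * d = min (?y t - ?L t) (?y t + real n * t - a)" by (simp add: d_def)
  then have d': "d < ?y t - ?L t" "d < ?y t + real n * t - a" using d by linarith+
  obtain k where k: "1 / real (Suc k) < d" using nat_approx_posE[OF d] .
  let ?e = "1 / real (Suc k)"
  have lims: "(?y \<longlongrightarrow> ?y t) (at_left t)" "(?L \<longlongrightarrow> ?L t) (at_left t)"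
    by (rule left_lim_at_left[OF Y \<omega> t], rule left_lim_at_left[OF L \<omega> t])
  have "((\<lambda>s. ?y s - ?L s) \<longlongrightarrow> ?y t - ?L t) (at_left t)" by (intro tendsto_diff lims)
  then have e1: "eventually (\<lambda>s. d < ?y s - ?L s) (at_left t)"
    by (rule order_tendstoD(1)) (rule d'(1))
  have "((\<lambda>s. ?y s + real n * s - a) \<longlongrightarrow> ?y t + real n * t - a) (at_left t)"
    by (intro tendsto_diff tendsto_add lims tendsto_mult_left tendsto_const tendsto_ident_at)
  then have e2: "eventually (\<lambda>s. d < ?y s + real n * s - a) (at_left t)"
    by (rule order_tendstoD(1)) (rule d'(2))
  obtain b where b: "b < t" "\<And>s. b < s \<Longrightarrow> s < t \<Longrightarrow> d < ?y s - ?L s \<and> d < ?y s + real n * s - a"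
    using eventually_conj[OF e1 e2] unfolding eventually_at_left_field by blast
  have "max b 0 < t" using b t by auto
  from Rats_dense_in_real[OF this] obtain q where q: "q \<in> \<rat>" "max b 0 < q" "q < t" by auto
  have good: "?L s + ?e \<le> ?y s \<and> a - real n * s + ?e \<le> ?y s" if s: "s \<in> {q<..t}" for s
  proof -
    have "d \<le> ?y s - ?L s \<and> d \<le> ?y s + real n * s - a"
    proof (cases "s = t")
      case True
      then show ?thesis using d' by simp
    next
      case False
      then show ?thesis using b(2)[of s] s q by auto
    qed
    then show ?thesis using k by linarith
  qed
  have "room L l \<delta> Y q ?e t \<omega>"
    unfolding room_def
  proof
    show "AE s in lborel. s \<in> {q<..t} \<longrightarrow> ?L s + ?e \<le> ?y s" using good by (intro AE_I2) blast
    show "AE s in stieltjes T \<delta> \<omega>. s \<in> {q<..t} \<longrightarrow> l s \<omega> + ?e \<le> ?y s"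
      using ae
    proof eventually_elim
      case (elim s)
      show ?case
      proof
        assume s: "s \<in> {q<..t}"
        then have "l s \<omega> + real n * s \<le> a" using elim q by auto
        then show "l s \<omega> + ?e \<le> ?y s" using good[OF s] by linarith
      qed
    qed
  qed
  then show ?thesis using q t by (intro bexI[of _ q] exI[of _ k]) auto
qed

text \<open>Where \<open>Y\<close> keeps a distance \<open>e\<close> from the lower obstacles on \<open>]q, t]\<close>, it can be lowered by
  \<open>e \<eta>\<close> without leaving the domain, so the minimality condition forbids \<open>K\<close> to act there.\<close>

lemma minimality_lower:
  assumes L: "L \<in> rcllP" and l: "predictable_process M T B l" and \<delta>: "\<delta> \<in> incP" and Y: "Y \<in> rcllP"
    and dom: "AE \<omega> in M. above_lower L l \<delta> Y \<omega>"
    and minimal: "\<And>X. X \<in> rcllP \<Longrightarrow> AE \<omega> in M. above_lower L l \<delta> X \<omega> \<Longrightarrow>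
       AE \<omega> in M. \<forall>t\<in>{0<..T}. left_lim X t \<omega> \<le> left_lim Y t \<omega> \<Longrightarrow>
       AE \<omega> in M. AE t in stieltjes T K \<omega>. t \<in> {0<..T} \<longrightarrow> left_lim Y t \<omega> \<le> left_lim X t \<omega>"
  shows "AE \<omega> in M. AE t in stieltjes T K \<omega>. t \<in> {0<..T} \<longrightarrow>
    ereal (left_lim Y t \<omega>) \<le> max (ereal (left_lim L t \<omega>)) (upper_env T \<delta> l t \<omega>)"
proof -
  have noroom: "AE \<omega> in M. AE t in stieltjes T K \<omega>. t \<in> {0<..T} \<longrightarrow> \<not> (q < t \<and> room L l \<delta> Y q e t \<omega>)"
    if q: "0 \<le> q" "q < T" and e: "0 < e" for q e
  proof (rule room_defect[OF L l \<delta> Y q, of e])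
    fix V :: "real \<times> 'a \<Rightarrow> ennreal"
    assume V: "V \<in> borel_measurable Pr"
      and mono: "\<And>\<omega> s t. \<omega> \<in> space M \<Longrightarrow> s \<le> t \<Longrightarrow> V (s, \<omega>) \<le> V (t, \<omega>)"
      and room: "\<And>\<omega> t. \<omega> \<in> space M \<Longrightarrow> t \<le> T \<Longrightarrow> V (t, \<omega>) = 0 \<longleftrightarrow> room L l \<delta> Y q e t \<omega>"
    from rcll_with_left_support[OF q V mono] obtain \<eta> where \<eta>: "\<eta> \<in> rcllP"
      and "AE \<omega> in Mc. \<forall>t\<in>{0<..T}. left_lim \<eta> t \<omega> \<in> {0..1} \<and> (0 < left_lim \<eta> t \<omega> \<longleftrightarrow> q < t \<and> V (t, \<omega>) = 0)"
      by blast
    then have ae\<eta>: "AE \<omega> in M. \<forall>t\<in>{0<..T}. left_lim \<eta> t \<omega> \<in> {0..1} \<and> (0 < left_lim \<eta> t \<omega> \<longleftrightarrow> q < t \<and> V (t, \<omega>) = 0)"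
      by (simp add: AE_completion_iff)
    \<comment> \<open>The left limits of \<eta> are at most 1 and positive exactly on J, so those of
      X are lowered by at most e on J and unchanged elsewhere.\<close>
    define X where "X t \<omega> = Y t \<omega> + (- e) * \<eta> t \<omega>" for t \<omega>
    have X: "X \<in> rcllP" unfolding X_def by (rule rcllP_add_cmult[OF Y \<eta>])
    have Xl: "left_lim X t \<omega> = left_lim Y t \<omega> - e * left_lim \<eta> t \<omega>" if "\<omega> \<in> space M" "t \<in> {0<..T}" for \<omega> t
      unfolding X_def using left_lim_add_cmult[OF Y \<eta> that, of "- e"] by simp
    have "AE \<omega> in M. \<forall>t\<in>{0<..T}. left_lim X t \<omega> \<le> left_lim Y t \<omega>"
      using ae\<eta> AE_space by eventually_elim (use e in \<open>auto simp: Xl\<close>)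
    moreover have "AE \<omega> in M. above_lower L l \<delta> X \<omega>"
      using ae\<eta> dom AE_space
    proof eventually_elim
      case (elim \<omega>)
      then have \<omega>: "\<omega> \<in> space M" by simp
      define J where "J = {t \<in> {q<..T}. room L l \<delta> Y q e t \<omega>}"
      have \<eta>0: "left_lim \<eta> t \<omega> = 0" if "t \<in> {0<..T}" "t \<notin> J" for t
      proof -
        have "\<not> 0 < left_lim \<eta> t \<omega>" using elim(1) that room[OF \<omega>, of t] by (auto simp: J_def)
        then show ?thesis using elim(1) that(1) by force
      qed
      have Xe: "left_lim Y t \<omega> - e \<le> left_lim X t \<omega>" if t: "t \<in> {0<..T}" for t
      proof -
        have "left_lim \<eta> t \<omega> \<le> 1" using elim(1) t by auto
        then have "e * left_lim \<eta> t \<omega> \<le> e * 1" using e by (intro mult_left_mono) auto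
        then show ?thesis using Xl[OF \<omega> t] by linarith
      qed
      have "left_lim L t \<omega> \<le> left_lim X t \<omega>" if t: "t \<in> {0<..T}" for t
      proof (cases "t \<in> J")
        case False
        then show ?thesis using \<eta>0[OF t] Xl[OF \<omega> t] elim(2) t by (auto simp: above_lower_def)
      next
        case True
        then have ae: "AE s in lborel. q < s \<and> s \<le> t \<longrightarrow> left_lim L s \<omega> + e \<le> left_lim Y s \<omega>" and qt: "q < t"
          by (auto simp: J_def room_def)
        \<comment> \<open>Both paths are left continuous, so the distance known Lebesgue-almost
          everywhere on ]q, t] holds at t itself.\<close>
        have "left_lim L t \<omega> + e \<le> left_lim Y t \<omega>"
          by (rule AE_lborel_left_continuous_le[where a="\<lambda>t. left_lim L t \<omega> + e" and b="\<lambda>t. left_lim Y t \<omega>", OF ae _ _ qt order_refl])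
            (intro tendsto_add tendsto_const left_lim_at_left[OF L \<omega> t] left_lim_at_left[OF Y \<omega> t])+
        then show ?thesis using Xe[OF t] by linarith
      qed
      moreover have "AE t in stieltjes T \<delta> \<omega>. t \<in> {0<..T} \<longrightarrow> l t \<omega> \<le> left_lim X t \<omega>"
      proof -
        have down: "s \<in> J" if "t \<in> J" "q < s" "s \<le> t" for s t
        proof -
          have "V (s, \<omega>) \<le> V (t, \<omega>)" by (rule mono[OF \<omega> that(3)])
          moreover have "V (t, \<omega>) = 0" using room[OF \<omega>, of t] that by (auto simp: J_def)
          ultimately have "V (s, \<omega>) = 0" by simp
          then show ?thesis using room[OF \<omega>, of s] that by (auto simp: J_def)
        qed
        \<comment> \<open>\<open>room\<close> at t concerns ]q, t] off a \<delta>-null set depending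
          on t; countably many end points in J cover J and leave one null set.\<close>
        obtain R where R: "R \<subseteq> J" "countable R" "\<And>s. s \<in> J \<Longrightarrow> \<exists>r\<in>R. s \<le> r"
          by (rule cofinal_countable[of J q T, OF down]) (auto simp: J_def)
        have "AE s in stieltjes T \<delta> \<omega>. \<forall>r\<in>R. s \<in> {q<..r} \<longrightarrow> l s \<omega> + e \<le> left_lim Y s \<omega>"
          by (rule AE_ball_countable'[OF _ R(2)]) (use R(1) in \<open>auto simp: J_def room_def\<close>)
        moreover have "AE t in stieltjes T \<delta> \<omega>. t \<in> {0<..T} \<longrightarrow> l t \<omega> \<le> left_lim Y t \<omega>"
          using elim(2) by (simp add: above_lower_def)
        ultimately show ?thesis
        proof eventually_elim
          case (elim t)
          show ?case
          proof
            assume t: "t \<in> {0<..T}"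
            show "l t \<omega> \<le> left_lim X t \<omega>"
            proof (cases "t \<in> J")
              case True
              then obtain r where "r \<in> R" "t \<le> r" using R(3) by blast
              then have "l t \<omega> + e \<le> left_lim Y t \<omega>" using elim(1) True by (auto simp: J_def)
              then show ?thesis using Xe[OF t] by linarith
            next
              case False
              then show ?thesis using elim(2) t \<eta>0[OF t] Xl[OF \<omega> t] by simp
            qed
          qed
        qed
      qed
      ultimately show ?case by (auto simp: above_lower_def)
    qed
    ultimately have "AE \<omega> in M. AE t in stieltjes T K \<omega>. t \<in> {0<..T} \<longrightarrow> left_lim Y t \<omega> \<le> left_lim X t \<omega>"
      by (intro minimal X)
    then show ?thesis
      using ae\<eta> AE_space
    proof eventually_elim
      case (elim \<omega>)
      then have \<omega>: "\<omega> \<in> space M" by simp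
      from elim(1) show ?case
      proof eventually_elim
        case (elim t)
        show ?case
        proof (intro impI notI)
          assume t: "t \<in> {0<..T}" and r: "q < t \<and> room L l \<delta> Y q e t \<omega>"
          \<comment> \<open>On J a positive amount has been subtracted, whereas minimality says that
            X is not below Y where K acts.\<close>
          then have "0 < left_lim \<eta> t \<omega>" using \<open>\<forall>t\<in>{0<..T}. left_lim \<eta> t \<omega> \<in> {0..1} \<and> (0 < left_lim \<eta> t \<omega> \<longleftrightarrow> q < t \<and> V (t, \<omega>) = 0)\<close> room[OF \<omega>, of t] by auto
          then have "0 < e * left_lim \<eta> t \<omega>" using e by simp
          then show False using elim t Xl[OF \<omega> t] by simp
        qed
      qed
    qed
  qed
  \<comment> \<open>Rational q and distances \<open>1 / (k + 1)\<close> leave countably many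
    exceptional sets; by \<open>room_exists\<close> they account for every time at which Y exceeds
    its lower bound.\<close>
  have "AE \<omega> in M. \<forall>q\<in>\<rat> \<inter> {0..<T}. \<forall>k::nat. AE t in stieltjes T K \<omega>. t \<in> {0<..T} \<longrightarrow> \<not> (q < t \<and> room L l \<delta> Y q (1 / real (Suc k)) t \<omega>)"
    by (intro AE_ball_countable' AE_all_countable[THEN iffD2] allI noroom countable_Int1 countable_rat) auto
  then show ?thesis
    using AE_space
  proof eventually_elim
    case (elim \<omega>)
    have "AE t in stieltjes T K \<omega>. \<forall>q\<in>\<rat> \<inter> {0..<T}. \<forall>k::nat. t \<in> {0<..T} \<longrightarrow> \<not> (q < t \<and> room L l \<delta> Y q (1 / real (Suc k)) t \<omega>)"
      using elim(1) by (intro AE_ball_countable' AE_all_countable[THEN iffD2] allI countable_Int1 countable_rat) auto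
    then show ?case
    proof eventually_elim
      case (elim t)
      show ?case
        using elim room_exists[OF L l Y \<open>\<omega> \<in> space M\<close>, of t \<delta>] by (auto simp: not_le[symmetric])
    qed
  qed
qed

text \<open>The domain condition makes the integrand nonnegative on ]0, T], so a difference of
  infinite integrals cannot arise and a zero integral means a vanishing gap.\<close>

lemma ereal_integral_gap_iff:
  assumes L: "L \<in> rcllP" and l: "predictable_process M T B l" and Y: "Y \<in> rcllP" and \<omega>: "\<omega> \<in> space M"
    and dom: "above_lower L l \<delta> Y \<omega>"
  shows "ereal_integral (stieltjes T K \<omega>) {0<..T}
      (\<lambda>t. ereal (left_lim Y t \<omega>) - max (ereal (left_lim L t \<omega>)) (upper_env T \<delta> l t \<omega>)) = 0 \<longleftrightarrow>
    (AE t in stieltjes T K \<omega>. t \<in> {0<..T} \<longrightarrow>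
      ereal (left_lim Y t \<omega>) \<le> max (ereal (left_lim L t \<omega>)) (upper_env T \<delta> l t \<omega>))"
proof -
  let ?b = "\<lambda>t. max (ereal (left_lim L t \<omega>)) (upper_env T \<delta> l t \<omega>)"
  have le: "?b t \<le> ereal (left_lim Y t \<omega>)" if "t \<in> {0<..T}" for t
    using above_lower_iff[OF l Y \<omega>, of L \<delta>] dom that by blast
  have "ereal_integral (stieltjes T K \<omega>) {0<..T} (\<lambda>t. ereal (left_lim Y t \<omega>) - ?b t) = 0 \<longleftrightarrow>
    (AE t in stieltjes T K \<omega>. t \<in> {0<..T} \<longrightarrow> ereal (left_lim Y t \<omega>) - ?b t \<le> 0)"
  proof (rule ereal_integral_eq_0_iff)
    show "0 \<le> ereal (left_lim Y t \<omega>) - ?b t" if "t \<in> {0<..T}" for t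
      using le[OF that] by (simp add: ereal_diff_positive)
    have path: "(\<lambda>t. left_lim X t \<omega>) \<in> borel_measurable (restrict_space borel {0..T})" if "X \<in> rcllP" for X
      using measurable_compose[OF measurable_Pr_path[OF \<omega>] left_lim_predictable[OF that, unfolded predictable_process_def]] by simp
    have env: "(\<lambda>t. upper_env T \<delta> l t \<omega>) \<in> borel_measurable (restrict_space borel {0..T})"
      by (rule measurable_restrict_space1[OF upper_env_borel])
    have "(\<lambda>t. e2ennreal (ereal (left_lim Y t \<omega>) - ?b t)) \<in> borel_measurable (restrict_space borel {0..T})"
      using path[OF Y] path[OF L] env by measurable
    then have "(\<lambda>t. e2ennreal (ereal (left_lim Y t \<omega>) - ?b t) * indicator {0..T} t) \<in> borel_measurable borel"
      using borel_measurable_restrict_space_iff_ennreal[of "{0..T}" borel "\<lambda>t. e2ennreal (ereal (left_lim Y t \<omega>) - ?b t)"] by simp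
    then have "(\<lambda>t. (e2ennreal (ereal (left_lim Y t \<omega>) - ?b t) * indicator {0..T} t) * indicator {0<..T} t) \<in> borel_measurable borel"
      by (rule borel_measurable_times_ennreal) simp
    also have "(\<lambda>t. (e2ennreal (ereal (left_lim Y t \<omega>) - ?b t) * indicator {0..T} t) * indicator {0<..T} t) =
        (\<lambda>t. e2ennreal (ereal (left_lim Y t \<omega>) - ?b t) * indicator {0<..T} t)"
      by (auto simp: fun_eq_iff indicator_def)
    finally show "(\<lambda>t. e2ennreal (ereal (left_lim Y t \<omega>) - ?b t) * indicator {0<..T} t) \<in> borel_measurable (stieltjes T K \<omega>)"
      by (simp cong: measurable_cong_sets)
  qed
  also have "\<dots> \<longleftrightarrow> (AE t in stieltjes T K \<omega>. t \<in> {0<..T} \<longrightarrow> ereal (left_lim Y t \<omega>) \<le> ?b t)"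
  proof (rule AE_cong)
    fix t
    \<comment> \<open>The bound y may be infinite outside ]0, T]; the left limit x is real, which
      keeps the subtraction harmless.\<close>
    have "(x - y \<le> 0) = (x \<le> y)" if "\<bar>x\<bar> \<noteq> \<infinity>" for x y :: ereal
      using that by (cases x; cases y) auto
    from this[of "ereal (left_lim Y t \<omega>)" "?b t"]
    show "(t \<in> {0<..T} \<longrightarrow> ereal (left_lim Y t \<omega>) - ?b t \<le> 0) \<longleftrightarrow> (t \<in> {0<..T} \<longrightarrow> ereal (left_lim Y t \<omega>) \<le> ?b t)"
      by simp
  qed
  finally show ?thesis .
qed

section \<open>Minimality is flatness off the obstacles\<close>

definition minimality_integral ::
  "(real \<Rightarrow> 'a \<Rightarrow> real) \<Rightarrow> (real \<Rightarrow> 'a \<Rightarrow> real) \<Rightarrow> (real \<Rightarrow> 'a \<Rightarrow> real) \<Rightarrow> (real \<Rightarrow> 'a \<Rightarrow> real) \<Rightarrow> ennreal" where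
  "minimality_integral Y X Kp Km = (\<integral>\<^sup>+\<omega>.
     (\<integral>\<^sup>+t\<in>{0<..T}. ennreal (max 0 (left_lim Y t \<omega> - left_lim X t \<omega>)) \<partial>stieltjes T Kp \<omega>) +
     (\<integral>\<^sup>+t\<in>{0<..T}. ennreal (max 0 (- (left_lim Y t \<omega> - left_lim X t \<omega>))) \<partial>stieltjes T Km \<omega>) \<partial>M)"

lemma minimality_integral_eq_0_iff:
  assumes Y: "Y \<in> rcllP" and X: "X \<in> rcllP" and K: "Kp \<in> incP" "Km \<in> incP"
  shows "minimality_integral Y X Kp Km = 0 \<longleftrightarrow> (AE \<omega> in M.
     (AE t in stieltjes T Kp \<omega>. t \<in> {0<..T} \<longrightarrow> left_lim Y t \<omega> \<le> left_lim X t \<omega>) \<and>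
     (AE t in stieltjes T Km \<omega>. t \<in> {0<..T} \<longrightarrow> left_lim X t \<omega> \<le> left_lim Y t \<omega>))"
proof -
  note pY = left_lim_predictable[OF Y] and pX = left_lim_predictable[OF X]
  let ?a = "\<lambda>\<omega>. \<integral>\<^sup>+t\<in>{0<..T}. ennreal (max 0 (left_lim Y t \<omega> - left_lim X t \<omega>)) \<partial>stieltjes T Kp \<omega>"
  let ?b = "\<lambda>\<omega>. \<integral>\<^sup>+t\<in>{0<..T}. ennreal (max 0 (left_lim X t \<omega> - left_lim Y t \<omega>)) \<partial>stieltjes T Km \<omega>"
  have m: "?a \<in> borel_measurable Mc" "?b \<in> borel_measurable Mc"
    using kernel_integral_T_measurable[OF predictable_kernel_stieltjes[OF K(1)] gap_measurable[OF pY pX]]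
      kernel_integral_T_measurable[OF predictable_kernel_stieltjes[OF K(2)] gap_measurable[OF pX pY]]
    by simp_all
  have "minimality_integral Y X Kp Km = 0 \<longleftrightarrow> (\<integral>\<^sup>+\<omega>. ?a \<omega> + ?b \<omega> \<partial>M) = 0"
    by (simp add: minimality_integral_def)
  also have "\<dots> \<longleftrightarrow> (AE \<omega> in M. ?a \<omega> + ?b \<omega> = 0)"
    using m by (intro nn_integral_M_0_iff borel_measurable_add)
  also have "\<dots> \<longleftrightarrow> (AE \<omega> in M.
     (AE t in stieltjes T Kp \<omega>. t \<in> {0<..T} \<longrightarrow> left_lim Y t \<omega> \<le> left_lim X t \<omega>) \<and>
     (AE t in stieltjes T Km \<omega>. t \<in> {0<..T} \<longrightarrow> left_lim X t \<omega> \<le> left_lim Y t \<omega>))"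
  proof (rule AE_cong)
    fix \<omega> assume \<omega>: "\<omega> \<in> space M"
    show "?a \<omega> + ?b \<omega> = 0 \<longleftrightarrow> (AE t in stieltjes T Kp \<omega>. t \<in> {0<..T} \<longrightarrow> left_lim Y t \<omega> \<le> left_lim X t \<omega>) \<and>
     (AE t in stieltjes T Km \<omega>. t \<in> {0<..T} \<longrightarrow> left_lim X t \<omega> \<le> left_lim Y t \<omega>)"
      unfolding add_eq_0_iff_both_eq_0
      using gap_zero_iff[OF pY pX _ \<omega> order_refl, of "stieltjes T Kp"] gap_zero_iff[OF pX pY _ \<omega> order_refl, of "stieltjes T Km"]
      by simp
  qed
  finally show ?thesis .
qed

text \<open>Minimality gives flatness of \<open>Kp\<close> by testing with X \<le> Y, since such an
  X inherits the upper constraints from Y. Conversely, flatness puts Y below its lower bound where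
  \<open>Kp\<close> acts, and every X in the domain dominates that bound. \<open>Km\<close> is
  symmetric.\<close>

lemma Dom_minimal_iff:
  assumes L: "L \<in> rcllP" and U: "U \<in> rcllP" and l: "predictable_process M T B l" and u: "predictable_process M T B u"
    and \<alpha>: "\<alpha> \<in> incP" and \<delta>: "\<delta> \<in> incP" and Y: "Y \<in> rcllP" and K: "Kp \<in> incP" "Km \<in> incP"
  shows "Y \<in> Dom M T B L U l u \<alpha> \<delta> \<and> (\<forall>X\<in>Dom M T B L U l u \<alpha> \<delta>. minimality_integral Y X Kp Km = 0) \<longleftrightarrow>
    (AE \<omega> in M. above_lower L l \<delta> Y \<omega> \<and> above_lower (\<lambda>t \<omega>. - U t \<omega>) (\<lambda>t \<omega>. - u t \<omega>) \<alpha> (\<lambda>t \<omega>. - Y t \<omega>) \<omega>) \<and>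
    (AE \<omega> in M. AE t in stieltjes T Kp \<omega>. t \<in> {0<..T} \<longrightarrow>
      ereal (left_lim Y t \<omega>) \<le> max (ereal (left_lim L t \<omega>)) (upper_env T \<delta> l t \<omega>)) \<and>
    (AE \<omega> in M. AE t in stieltjes T Km \<omega>. t \<in> {0<..T} \<longrightarrow>
      ereal (left_lim (\<lambda>t \<omega>. - Y t \<omega>) t \<omega>) \<le> max (ereal (left_lim (\<lambda>t \<omega>. - U t \<omega>) t \<omega>)) (upper_env T \<alpha> (\<lambda>t \<omega>. - u t \<omega>) t \<omega>))"
    (is "?l \<longleftrightarrow> ?dom \<and> ?p \<and> ?m")
proof -
  note D = Dom_iff[OF L U l u \<alpha> \<delta>]
  note Y' = rcllP_uminus[OF Y] and U' = rcllP_uminus[OF U] and u' = predictable_uminus[OF u]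
  show ?thesis
  proof
    assume lhs: ?l
    then have dom: ?dom using D Y by blast
    have mini: "AE \<omega> in M.
       (AE t in stieltjes T Kp \<omega>. t \<in> {0<..T} \<longrightarrow> left_lim Y t \<omega> \<le> left_lim X t \<omega>) \<and>
       (AE t in stieltjes T Km \<omega>. t \<in> {0<..T} \<longrightarrow> left_lim X t \<omega> \<le> left_lim Y t \<omega>)"
      if "X \<in> Dom M T B L U l u \<alpha> \<delta>" for X
      using minimality_integral_eq_0_iff[OF Y _ K, of X] lhs D[of X] that by blast
    have ?p
    proof (rule minimality_lower[OF L l \<delta> Y])
      show "AE \<omega> in M. above_lower L l \<delta> Y \<omega>" using dom by eventually_elim simp
      fix X assume X: "X \<in> rcllP" and low: "AE \<omega> in M. above_lower L l \<delta> X \<omega>"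
        and le: "AE \<omega> in M. \<forall>t\<in>{0<..T}. left_lim X t \<omega> \<le> left_lim Y t \<omega>"
      have "AE \<omega> in M. above_lower L l \<delta> X \<omega> \<and> above_lower (\<lambda>t \<omega>. - U t \<omega>) (\<lambda>t \<omega>. - u t \<omega>) \<alpha> (\<lambda>t \<omega>. - X t \<omega>) \<omega>"
        using low le dom AE_space
      proof eventually_elim
        case (elim \<omega>)
        have le': "left_lim (\<lambda>t \<omega>. - Y t \<omega>) t \<omega> \<le> left_lim (\<lambda>t \<omega>. - X t \<omega>) t \<omega>" if "t \<in> {0<..T}" for t
          using elim that by (simp add: left_lim_uminus[OF Y] left_lim_uminus[OF X])
        \<comment> \<open>Through \<open>above_lower_iff\<close> the constraint is a lower bound on
          left limits, so it passes from -Y to the larger -X.\<close>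
        have "above_lower (\<lambda>t \<omega>. - U t \<omega>) (\<lambda>t \<omega>. - u t \<omega>) \<alpha> (\<lambda>t \<omega>. - X t \<omega>) \<omega>"
          using elim(3) order_trans[OF _ ereal_less_eq(3)[THEN iffD2, OF le']]
          unfolding above_lower_iff[OF u' Y' \<open>\<omega> \<in> space M\<close>] above_lower_iff[OF u' rcllP_uminus[OF X] \<open>\<omega> \<in> space M\<close>]
          by blast
        then show ?case using elim by simp
      qed
      then have "X \<in> Dom M T B L U l u \<alpha> \<delta>" using D X by blast
      from mini[OF this] show "AE \<omega> in M. AE t in stieltjes T Kp \<omega>. t \<in> {0<..T} \<longrightarrow> left_lim Y t \<omega> \<le> left_lim X t \<omega>"
        by eventually_elim simp
    qed
    \<comment> \<open>The same argument after changing signs; the process tested against the domain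
      is -X.\<close>
    moreover have ?m
    proof (rule minimality_lower[OF U' u' \<alpha> Y'])
      show "AE \<omega> in M. above_lower (\<lambda>t \<omega>. - U t \<omega>) (\<lambda>t \<omega>. - u t \<omega>) \<alpha> (\<lambda>t \<omega>. - Y t \<omega>) \<omega>" using dom by eventually_elim simp
      fix X assume X: "X \<in> rcllP" and low: "AE \<omega> in M. above_lower (\<lambda>t \<omega>. - U t \<omega>) (\<lambda>t \<omega>. - u t \<omega>) \<alpha> X \<omega>"
        and le: "AE \<omega> in M. \<forall>t\<in>{0<..T}. left_lim X t \<omega> \<le> left_lim (\<lambda>t \<omega>. - Y t \<omega>) t \<omega>"
      let ?X = "\<lambda>t \<omega>. - X t \<omega>"
      note X' = rcllP_uminus[OF X]
      have "AE \<omega> in M. above_lower L l \<delta> ?X \<omega> \<and> above_lower (\<lambda>t \<omega>. - U t \<omega>) (\<lambda>t \<omega>. - u t \<omega>) \<alpha> (\<lambda>t \<omega>. - ?X t \<omega>) \<omega>"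
        using low le dom AE_space
      proof eventually_elim
        case (elim \<omega>)
        have le': "left_lim Y t \<omega> \<le> left_lim ?X t \<omega>" if "t \<in> {0<..T}" for t
          using bspec[OF elim(2) that] that elim(4) by (simp add: left_lim_uminus[OF Y] left_lim_uminus[OF X])
        have "above_lower L l \<delta> ?X \<omega>"
          using elim(3) order_trans[OF _ ereal_less_eq(3)[THEN iffD2, OF le']]
          unfolding above_lower_iff[OF l Y \<open>\<omega> \<in> space M\<close>] above_lower_iff[OF l X' \<open>\<omega> \<in> space M\<close>]
          by blast
        then show ?case using elim by simp
      qed
      then have "?X \<in> Dom M T B L U l u \<alpha> \<delta>" using D X' by blast
      from mini[OF this] AE_space
      show "AE \<omega> in M. AE t in stieltjes T Km \<omega>. t \<in> {0<..T} \<longrightarrow> left_lim (\<lambda>t \<omega>. - Y t \<omega>) t \<omega> \<le> left_lim X t \<omega>"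
      proof eventually_elim
        case (elim \<omega>)
        then have "AE t in stieltjes T Km \<omega>. t \<in> {0<..T} \<longrightarrow> left_lim ?X t \<omega> \<le> left_lim Y t \<omega>" by simp
        then show ?case
          by eventually_elim (use elim(2) in \<open>auto simp: left_lim_uminus[OF Y] left_lim_uminus[OF X]\<close>)
      qed
    qed
    ultimately show "?dom \<and> ?p \<and> ?m" using dom by simp
  next
    assume rhs: "?dom \<and> ?p \<and> ?m"
    have "Y \<in> Dom M T B L U l u \<alpha> \<delta>" using D Y rhs by blast
    moreover have "minimality_integral Y X Kp Km = 0" if XD: "X \<in> Dom M T B L U l u \<alpha> \<delta>" for X
    proof -
      have X: "X \<in> rcllP" and Xdom: "AE \<omega> in M. above_lower L l \<delta> X \<omega> \<and> above_lower (\<lambda>t \<omega>. - U t \<omega>) (\<lambda>t \<omega>. - u t \<omega>) \<alpha> (\<lambda>t \<omega>. - X t \<omega>) \<omega>"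
        using D XD by blast+
      note X' = rcllP_uminus[OF X]
      have p: ?p and m: ?m using rhs by blast+
      show ?thesis
        unfolding minimality_integral_eq_0_iff[OF Y X K]
        using Xdom p m AE_space
      proof eventually_elim
        case (elim \<omega>)
        then have \<omega>: "\<omega> \<in> space M" by simp
        have b1: "max (ereal (left_lim L t \<omega>)) (upper_env T \<delta> l t \<omega>) \<le> ereal (left_lim X t \<omega>)" if "t \<in> {0<..T}" for t
          using elim(1) that above_lower_iff[OF l X \<omega>, of L \<delta>] by blast
        have b2: "max (ereal (left_lim (\<lambda>t \<omega>. - U t \<omega>) t \<omega>)) (upper_env T \<alpha> (\<lambda>t \<omega>. - u t \<omega>) t \<omega>) \<le> ereal (left_lim (\<lambda>t \<omega>. - X t \<omega>) t \<omega>)" if "t \<in> {0<..T}" for t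
          using elim(1) that above_lower_iff[OF u' X' \<omega>, of "\<lambda>t \<omega>. - U t \<omega>" \<alpha>] by blast
        show ?case
        proof
          show "AE t in stieltjes T Kp \<omega>. t \<in> {0<..T} \<longrightarrow> left_lim Y t \<omega> \<le> left_lim X t \<omega>"
            using elim(2)
          proof eventually_elim
            case (elim t)
            show ?case using order_trans[OF _ b1, of "ereal (left_lim Y t \<omega>)" t] elim by auto
          qed
          show "AE t in stieltjes T Km \<omega>. t \<in> {0<..T} \<longrightarrow> left_lim X t \<omega> \<le> left_lim Y t \<omega>"
            using elim(3)
          proof eventually_elim
            case (elim t)
            show ?case
            proof
              assume t: "t \<in> {0<..T}"
              have "ereal (left_lim (\<lambda>t \<omega>. - Y t \<omega>) t \<omega>) \<le> ereal (left_lim (\<lambda>t \<omega>. - X t \<omega>) t \<omega>)"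
                using elim t by (intro order_trans[OF _ b2]) auto
              then show "left_lim X t \<omega> \<le> left_lim Y t \<omega>"
                by (simp add: left_lim_uminus[OF X \<omega> t] left_lim_uminus[OF Y \<omega> t])
            qed
          qed
        qed
      qed
    qed
    ultimately show ?l by blast
  qed
qed

text \<open>The integral conditions express flatness once the domain condition has made the gaps
  nonnegative, so their translation is carried out under that condition.\<close>

lemma drbsde_conditions_iff:
  assumes L: "L \<in> rcllP" and U: "U \<in> rcllP" and l: "predictable_process M T B l" and u: "predictable_process M T B u"
    and \<alpha>: "\<alpha> \<in> incP" and \<delta>: "\<delta> \<in> incP" and Y: "Y \<in> rcllP" and K: "Kp \<in> incP" "Km \<in> incP"
  shows "Y \<in> Dom M T B L U l u \<alpha> \<delta> \<and> (\<forall>X\<in>Dom M T B L U l u \<alpha> \<delta>. minimality_integral Y X Kp Km = 0) \<longleftrightarrow>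
     (AE \<omega> in M. \<forall>t\<in>{0<..T}.
        max (ereal (left_lim L t \<omega>)) (upper_env T \<delta> l t \<omega>) \<le> ereal (left_lim Y t \<omega>) \<and>
        ereal (left_lim Y t \<omega>) \<le> min (- upper_env T \<alpha> (\<lambda>s \<omega>. - u s \<omega>) t \<omega>) (ereal (left_lim U t \<omega>))) \<and>
     (AE \<omega> in M.
        ereal_integral (stieltjes T Kp \<omega>) {0<..T}
          (\<lambda>t. ereal (left_lim Y t \<omega>) - max (ereal (left_lim L t \<omega>)) (upper_env T \<delta> l t \<omega>)) = 0 \<and>
        ereal_integral (stieltjes T Km \<omega>) {0<..T}
          (\<lambda>t. min (ereal (left_lim U t \<omega>)) (- upper_env T \<alpha> (\<lambda>s \<omega>. - u s \<omega>) t \<omega>)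
               - ereal (left_lim Y t \<omega>)) = 0)"
    (is "?l \<longleftrightarrow> ?ii \<and> ?iii")
proof -
  note Y' = rcllP_uminus[OF Y] and U' = rcllP_uminus[OF U] and u' = predictable_uminus[OF u]
  let ?Y = "\<lambda>t \<omega>. - Y t \<omega>" and ?U = "\<lambda>t \<omega>. - U t \<omega>" and ?u = "\<lambda>t \<omega>. - u t \<omega>"
  let ?dom = "\<lambda>\<omega>. above_lower L l \<delta> Y \<omega> \<and> above_lower ?U ?u \<alpha> ?Y \<omega>"
  let ?p = "\<lambda>\<omega>. AE t in stieltjes T Kp \<omega>. t \<in> {0<..T} \<longrightarrow>
      ereal (left_lim Y t \<omega>) \<le> max (ereal (left_lim L t \<omega>)) (upper_env T \<delta> l t \<omega>)"
  let ?m = "\<lambda>\<omega>. AE t in stieltjes T Km \<omega>. t \<in> {0<..T} \<longrightarrow>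
      ereal (left_lim ?Y t \<omega>) \<le> max (ereal (left_lim ?U t \<omega>)) (upper_env T \<alpha> ?u t \<omega>)"
  have ii: "?ii \<longleftrightarrow> (AE \<omega> in M. ?dom \<omega>)"
  proof (rule AE_cong)
    fix \<omega> assume \<omega>: "\<omega> \<in> space M"
    have "ereal (left_lim Y t \<omega>) \<le> min (- upper_env T \<alpha> ?u t \<omega>) (ereal (left_lim U t \<omega>)) \<longleftrightarrow>
        max (ereal (left_lim ?U t \<omega>)) (upper_env T \<alpha> ?u t \<omega>) \<le> ereal (left_lim ?Y t \<omega>)" if t: "t \<in> {0<..T}" for t
    proof -
      have "ereal b \<le> min (- e) (ereal a) \<longleftrightarrow> max (ereal (- a)) e \<le> ereal (- b)" for a b e
        by (cases e) auto
      then show ?thesis by (simp add: left_lim_uminus[OF Y \<omega> t] left_lim_uminus[OF U \<omega> t])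
    qed
    then show "(\<forall>t\<in>{0<..T}.
        max (ereal (left_lim L t \<omega>)) (upper_env T \<delta> l t \<omega>) \<le> ereal (left_lim Y t \<omega>) \<and>
        ereal (left_lim Y t \<omega>) \<le> min (- upper_env T \<alpha> ?u t \<omega>) (ereal (left_lim U t \<omega>))) \<longleftrightarrow> ?dom \<omega>"
      unfolding above_lower_iff[OF l Y \<omega>] above_lower_iff[OF u' Y' \<omega>] by blast
  qed
  have iii: "?iii \<longleftrightarrow> (AE \<omega> in M. ?p \<omega> \<and> ?m \<omega>)" if dom: "AE \<omega> in M. ?dom \<omega>"
  proof -
    have eq: "AE \<omega> in M. (ereal_integral (stieltjes T Kp \<omega>) {0<..T}
          (\<lambda>t. ereal (left_lim Y t \<omega>) - max (ereal (left_lim L t \<omega>)) (upper_env T \<delta> l t \<omega>)) = 0 \<and>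
        ereal_integral (stieltjes T Km \<omega>) {0<..T}
          (\<lambda>t. min (ereal (left_lim U t \<omega>)) (- upper_env T \<alpha> ?u t \<omega>) - ereal (left_lim Y t \<omega>)) = 0) \<longleftrightarrow> ?p \<omega> \<and> ?m \<omega>"
      using dom AE_space
    proof eventually_elim
      case (elim \<omega>)
      then have \<omega>: "\<omega> \<in> space M" by simp
      have gap: "min (ereal (left_lim U t \<omega>)) (- upper_env T \<alpha> ?u t \<omega>) - ereal (left_lim Y t \<omega>) =
          ereal (left_lim ?Y t \<omega>) - max (ereal (left_lim ?U t \<omega>)) (upper_env T \<alpha> ?u t \<omega>)" if t: "t \<in> {0<..T}" for t
      proof -
        have "min (ereal a) (- e) - ereal b = ereal (- b) - max (ereal (- a)) e" for a b e
          by (cases e) (auto simp: min_def max_def)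
        then show ?thesis by (simp add: left_lim_uminus[OF Y \<omega> t] left_lim_uminus[OF U \<omega> t])
      qed
      have "ereal_integral (stieltjes T Km \<omega>) {0<..T}
          (\<lambda>t. min (ereal (left_lim U t \<omega>)) (- upper_env T \<alpha> ?u t \<omega>) - ereal (left_lim Y t \<omega>)) =
        ereal_integral (stieltjes T Km \<omega>) {0<..T}
          (\<lambda>t. ereal (left_lim ?Y t \<omega>) - max (ereal (left_lim ?U t \<omega>)) (upper_env T \<alpha> ?u t \<omega>))"
        unfolding ereal_integral_def
        by (intro arg_cong2[where f="(-)"] arg_cong[where f=enn2ereal] nn_integral_cong) (auto simp: indicator_def gap)
      then show ?case
        using ereal_integral_gap_iff[OF L l Y \<omega>, of \<delta> Kp] ereal_integral_gap_iff[OF U' u' Y' \<omega>, of \<alpha> Km] elim(1)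
        by simp
    qed
    show ?thesis
    proof
      show "AE \<omega> in M. ?p \<omega> \<and> ?m \<omega>" if ?iii
        using eq that by eventually_elim blast
      show ?iii if "AE \<omega> in M. ?p \<omega> \<and> ?m \<omega>"
        using eq that by eventually_elim blast
    qed
  qed
  have lhs: "?l \<longleftrightarrow> (AE \<omega> in M. ?dom \<omega>) \<and> (AE \<omega> in M. ?p \<omega>) \<and> (AE \<omega> in M. ?m \<omega>)"
    by (rule Dom_minimal_iff[OF L U l u \<alpha> \<delta> Y K])
  have pm: "(AE \<omega> in M. ?p \<omega> \<and> ?m \<omega>) \<longleftrightarrow> (AE \<omega> in M. ?p \<omega>) \<and> (AE \<omega> in M. ?m \<omega>)"
    by (rule AE_conj_iff)
  show ?thesis
  \<comment> \<open>If the domain condition fails, both sides are false whatever the integrals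
    are.\<close>
  proof (cases "AE \<omega> in M. ?dom \<omega>")
    case True
    show ?thesis unfolding ii iii[OF True] lhs pm ..
  next
    case False
    then show ?thesis unfolding ii lhs by blast
  qed
qed

end

theorem theorem5p1:
  fixes M :: "'a measure" and T :: real and B :: "real \<Rightarrow> 'a \<Rightarrow> real ^ 'd"
    and \<xi> :: "'a \<Rightarrow> real"
    and f :: "real \<Rightarrow> 'a \<Rightarrow> real \<Rightarrow> real ^ 'd \<Rightarrow> real"
    and g :: "real \<Rightarrow> 'a \<Rightarrow> real \<Rightarrow> real \<Rightarrow> real"
    and A L U l u \<alpha> \<delta> Y Kp Km :: "real \<Rightarrow> 'a \<Rightarrow> real"
    and Z :: "real \<Rightarrow> 'a \<Rightarrow> real ^ 'd"
  assumes "prob_space M" and "0 < T" and "brownian_motion M T B"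
    and "\<xi> \<in> borel_measurable (aug_filtration M B T)"
    and "L \<in> rcll_processes M T B" and "U \<in> rcll_processes M T B"
    and "predictable_process M T B l" and "predictable_process M T B u"
    and "\<alpha> \<in> increasing_processes M T B" and "\<delta> \<in> increasing_processes M T B"
    and "A \<in> increasing_processes M T B"
    and "\<And>y z. predictable_process M T B (\<lambda>t \<omega>. f t \<omega> (trunc_between (L t \<omega>) y (U t \<omega>)) z)"
    and "\<And>x y. predictable_process M T B
           (\<lambda>t \<omega>. g t \<omega> (trunc_between (left_lim L t \<omega>) x (left_lim U t \<omega>)) (trunc_between (L t \<omega>) y (U t \<omega>)))"
  shows "drbsde_solution M T B \<xi> f g A L U l u \<alpha> \<delta> Y Z Kp Km \<longleftrightarrow>
     bsde_equation M T B \<xi> f g A Y Z Kp Km \<and>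
     (AE \<omega> in M. \<forall>t\<in>{0<..T}.
        max (ereal (left_lim L t \<omega>)) (upper_env T \<delta> l t \<omega>) \<le> ereal (left_lim Y t \<omega>) \<and>
        ereal (left_lim Y t \<omega>) \<le> min (- upper_env T \<alpha> (\<lambda>s \<omega>. - u s \<omega>) t \<omega>) (ereal (left_lim U t \<omega>))) \<and>
     (AE \<omega> in M.
        ereal_integral (stieltjes T Kp \<omega>) {0<..T}
          (\<lambda>t. ereal (left_lim Y t \<omega>) - max (ereal (left_lim L t \<omega>)) (upper_env T \<delta> l t \<omega>)) = 0 \<and>
        ereal_integral (stieltjes T Km \<omega>) {0<..T}
          (\<lambda>t. min (ereal (left_lim U t \<omega>)) (- upper_env T \<alpha> (\<lambda>s \<omega>. - u s \<omega>) t \<omega>)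
               - ereal (left_lim Y t \<omega>)) = 0) \<and>
     (Y \<in> rcll_processes M T B \<and> Kp \<in> increasing_processes M T B \<and>
      Km \<in> increasing_processes M T B \<and> Z \<in> L2_processes M T B) \<and>
     mutually_singular M T B Kp Km"
    (is "_ \<longleftrightarrow> ?eq \<and> ?ii \<and> ?iii \<and> ?iv \<and> ?v")
proof -
  interpret brownian_setting M T B
    using assms(1-3) by (simp add: brownian_setting_def brownian_setting_axioms_def)
  let ?Dom = "Dom M T B L U l u \<alpha> \<delta>"
  \<comment> \<open>Membership in the domain contains that Y is rcll and predictable, so condition
    (iv) can be split off from the definition of a solution.\<close>
  have sol: "drbsde_solution M T B \<xi> f g A L U l u \<alpha> \<delta> Y Z Kp Km \<longleftrightarrow>
      ?eq \<and> ?iv \<and> ?v \<and> (Y \<in> ?Dom \<and> (\<forall>X\<in>?Dom. minimality_integral Y X Kp Km = 0))"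
    by (auto simp: drbsde_solution_def minimality_integral_def Dom_def)
  have "(Y \<in> ?Dom \<and> (\<forall>X\<in>?Dom. minimality_integral Y X Kp Km = 0)) \<longleftrightarrow> ?ii \<and> ?iii" if ?iv
    by (rule drbsde_conditions_iff) (use that assms in simp_all)
  then show ?thesis unfolding sol by blast
qed

end
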